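(* Let $\widehat{G}$ be a signed bigraph. Then $\widehat{G}$ is chordal if and only if it is $\mathcal{F}$-free, i.e. it contains no signed graph in $\mathcal F=F_1\cup\cdots\cup F_6\cup\mathcal C\cup D\cup\mathcal S\cup\mathcal J$ as an induced subgraph.
   Context: A signed graph is a finite simple graph each of whose edges is assigned a sign, positive or negative. A signed bigraph is a signed graph whose underlying graph is bipartite. An induced subgraph is obtained by deleting vertices only; containing $H$ as an induced subgraph means some induced subgraph is isomorphic to $H$ via a sign-preserving isomorphism. A signed graph is positive if all its edges are positive. In a bigraph with bipartition $(X,Y)$, a subgraph $H$ is a biclique if every vertex of $V(H)\cap X$ is adjacent to every vertex of $V(H)\cap Y$. For an edge $uv$, $N(uv)=(N(u)\cup N(v))\setminus\{u,v\}$; $uv$ is signed simplicial if $N(uv)$ induces a positive biclique. A signed bigraph $\widehat G$ is chordal if its edges can be ordered $e_1,\dots,e_m$ so that each $e_i$ is signed simplicial in $\widehat G-\{e_1,\dots,e_{i-1}\}$ (edges deleted, vertices kept). A family specified by a graph with edges declared negative, positive or free is the set of all signed graphs obtained by giving free edges arbitrary signs. Tadpoles: for $k\ge1$, a tadpole of type 1 has distinct vertices $w,y,z,x_1,\dots,x_k$ and edges exactly $x_ky,x_kz$ (negative), $wy,wz$ (free) and $x_ix_{i+1}$, $1\le i<k$ (free). For $k\ge2$, a tadpole of type 2 is the same with the additional negative edge $wx_{k-1}$. The end is $x_1$; the heads are $w,y,z$. Sum of tadpoles $T,T'$ (disjoint, ends $x,x'$): identify $x$ with $x'$. Join of $T,T'$: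 fix a bipartition of the disjoint union $T\cup T'$ (either relative orientation of the two tadpoles), then add a positive edge from $x$ to every vertex of $T'$ in the part opposite to $x$ and a positive edge from $x'$ to every vertex of $T$ in the part opposite to $x'$; exception: if $x,x'$ are in opposite parts (so $xx'$ is added, positively) and $T$ is a type-1 tadpole with $k=1$, the added edge between $x'$ and the head $w$ of $T$ may have either sign, and symmetrically if $T'$ is a type-1 tadpole with $k=1$, the added edge between $x$ and the head $w'$ of $T'$ may have either sign. $\mathcal S$ ($\mathcal J$) is the set of all sums (joins) of pairs of tadpoles (of any types and lengths). $\mathcal C$ is the set of signed cycles of length $2k$, $k\ge3$ (any signs); $D$: parts $\{a_1,a_2,a_3\},\{b_1,b_2,b_3\}$, edges exactly $a_1b_1,a_1b_2,a_2b_1,a_2b_2,a_2b_3,a_3b_2,a_3b_3$, $a_2b_2$ negative, others free; $F_1$: $K_{2,2}$ all edges negative; $F_2$: $K_{2,3}$ with parts $\{a_1,a_2\},\{b_1,b_2,b_3\}$, $a_1b_1,a_1b_2,a_2b_2,a_2b_3$ negative, $a_1b_3,a_2b_1$ free; $F_3$: $K_{2,4}$ with parts $\{a_1,a_2\},\{b_1,\dots,b_4\}$, $a_1b_1,a_1b_2,a_2b_3,a_2b_4$ negative, rest free; $F_4$: $K_{3,3}$ with parts $\{a_1,a_2,a_3\},\{b_1,b_2,b_3\}$, $a_ib_i$ negative, rest free; $F_5$: parts $\{a_1,a_2,a_3\},\{b_1,b_2,b_3\}$, all nine edges except $a_1b_3$, $a_2b_1,a_3b_2$ negative, rest free; $F_6$: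 parts $\{a_1,\dots,a_4\},\{b_1,\dots,b_4\}$, $a_1,a_2$ adjacent exactly to $b_1,b_2$, $a_3,a_4$ adjacent to all $b_j$, $a_1b_1,a_2b_1,a_3b_2,a_4b_3,a_4b_4$ negative, rest free. *)

theory Defs
  imports Main
begin

text \<open>A signed graph: vertex set, set of edges (each edge a 2-element set of vertices),
  and a sign function on edges (True = positive, False = negative).
  Only the values of pos on edges are meaningful.\<close>

record 'v sgraph =
  verts :: "'v set"
  edges :: "'v set set"
  pos   :: "'v set \<Rightarrow> bool"

definition signed_graph :: "('v, 'z) sgraph_scheme \<Rightarrow> bool" where
  "signed_graph G \<longleftrightarrow> finite (verts G) \<and>
     (\<forall>e\<in>edges G. \<exists>u v. e = {u, v} \<and> u \<noteq> v \<and> u \<in> verts G \<and> v \<in> verts G)"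

definition is_bipartition :: "('v, 'z) sgraph_scheme \<Rightarrow> 'v set \<Rightarrow> bool" where
  "is_bipartition G X \<longleftrightarrow> X \<subseteq> verts G \<and> (\<forall>e\<in>edges G. card (e \<inter> X) = 1)"

definition signed_bigraph :: "('v, 'z) sgraph_scheme \<Rightarrow> bool" where
  "signed_bigraph G \<longleftrightarrow> signed_graph G \<and> (\<exists>X. is_bipartition G X)"

definition nbhd :: "('v, 'z) sgraph_scheme \<Rightarrow> 'v \<Rightarrow> 'v set" where
  "nbhd G u = {w. {u, w} \<in> edges G}"

definition edge_nbhd :: "('v, 'z) sgraph_scheme \<Rightarrow> 'v \<Rightarrow> 'v \<Rightarrow> 'v set" where
  "edge_nbhd G u v = (nbhd G u \<union> nbhd G v) - {u, v}"

definition positive_biclique :: "('v, 'z) sgraph_scheme \<Rightarrow> 'v set \<Rightarrow> 'v set \<Rightarrow> bool" where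
  "positive_biclique G X S \<longleftrightarrow>
     (\<forall>a\<in>S. \<forall>b\<in>S. {a, b} \<in> edges G \<longrightarrow> pos G {a, b}) \<and>
     (\<forall>a\<in>S \<inter> X. \<forall>b\<in>S \<inter> (verts G - X). {a, b} \<in> edges G)"

definition signed_simplicial :: "('v, 'z) sgraph_scheme \<Rightarrow> 'v set \<Rightarrow> 'v \<Rightarrow> 'v \<Rightarrow> bool" where
  "signed_simplicial G X u v \<longleftrightarrow> {u, v} \<in> edges G \<and> positive_biclique G X (edge_nbhd G u v)"

definition delete_edges :: "('v, 'z) sgraph_scheme \<Rightarrow> 'v set set \<Rightarrow> ('v, 'z) sgraph_scheme" where
  "delete_edges G S = G\<lparr>edges := edges G - S\<rparr>"

definition chordal :: "('v, 'z) sgraph_scheme \<Rightarrow> 'v set \<Rightarrow> bool" where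
  "chordal G X \<longleftrightarrow> (\<exists>es. distinct es \<and> set es = edges G \<and>
     (\<forall>i<length es. \<exists>u v. es ! i = {u, v} \<and>
        signed_simplicial (delete_edges G (set (take i es))) X u v))"

definition contains_induced :: "('a, 'z) sgraph_scheme \<Rightarrow> 'b sgraph \<Rightarrow> bool" where
  "contains_induced G H \<longleftrightarrow> (\<exists>f. inj_on f (verts H) \<and> f ` verts H \<subseteq> verts G \<and>
     (\<forall>a\<in>verts H. \<forall>b\<in>verts H.
        ({a, b} \<in> edges H \<longleftrightarrow> {f a, f b} \<in> edges G) \<and>
        ({a, b} \<in> edges H \<longrightarrow> pos H {a, b} = pos G {f a, f b})))"

definition free_of :: "('a, 'z) sgraph_scheme \<Rightarrow> 'b sgraph set \<Rightarrow> bool" where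
  "free_of G Fam \<longleftrightarrow> (\<forall>H\<in>Fam. \<not> contains_induced G H)"

definition sfam :: "'v set \<Rightarrow> 'v set set \<Rightarrow> 'v set set \<Rightarrow> 'v set set \<Rightarrow> 'v sgraph set" where
  "sfam V N P Fr = {H. verts H = V \<and> edges H = N \<union> P \<union> Fr \<and>
      (\<forall>e\<in>N. \<not> pos H e) \<and> (\<forall>e\<in>P. pos H e)}"

definition famC :: "nat sgraph set" where
  "famC = (\<Union>k\<in>{3..}. sfam {0..<2*k} {} {} {{i, Suc i mod (2*k)} | i. i < 2*k})"

text \<open>D: a1,a2,a3 = 0,1,2; b1,b2,b3 = 3,4,5.\<close>
definition famD :: "nat sgraph set" where
  "famD = sfam {0..5} {{1,4}} {} {{0,3},{0,4},{1,3},{1,5},{2,4},{2,5}}"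

text \<open>F1: K_{2,2}, a1,a2 = 0,1; b1,b2 = 2,3; all negative.\<close>
definition famF1 :: "nat sgraph set" where
  "famF1 = sfam {0..3} {{0,2},{0,3},{1,2},{1,3}} {} {}"

text \<open>F2: a1,a2 = 0,1; b1,b2,b3 = 2,3,4.\<close>
definition famF2 :: "nat sgraph set" where
  "famF2 = sfam {0..4} {{0,2},{0,3},{1,3},{1,4}} {} {{0,4},{1,2}}"

text \<open>F3: a1,a2 = 0,1; b1..b4 = 2..5.\<close>
definition famF3 :: "nat sgraph set" where
  "famF3 = sfam {0..5} {{0,2},{0,3},{1,4},{1,5}} {} {{0,4},{0,5},{1,2},{1,3}}"

text \<open>F4: a1,a2,a3 = 0,1,2; b1,b2,b3 = 3,4,5.\<close>
definition famF4 :: "nat sgraph set" where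
  "famF4 = sfam {0..5} {{0,3},{1,4},{2,5}} {} {{0,4},{0,5},{1,3},{1,5},{2,3},{2,4}}"

text \<open>F5: a1,a2,a3 = 0,1,2; b1,b2,b3 = 3,4,5; all edges except a1b3.\<close>
definition famF5 :: "nat sgraph set" where
  "famF5 = sfam {0..5} {{1,3},{2,4}} {} {{0,3},{0,4},{1,4},{1,5},{2,3},{2,5}}"

text \<open>F6: a1..a4 = 0..3; b1..b4 = 4..7.\<close>
definition famF6 :: "nat sgraph set" where
  "famF6 = sfam {0..7} {{0,4},{1,4},{2,5},{3,6},{3,7}} {}
     {{0,5},{1,5},{2,4},{2,6},{2,7},{3,4},{3,5}}"

text \<open>Vertices of two tagged tadpoles (tag True = T, tag False = T').\<close>
datatype tv = TW bool | TY bool | TZ bool | TX bool nat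

definition valid_tp :: "nat \<Rightarrow> nat \<Rightarrow> bool" where
  "valid_tp t k \<longleftrightarrow> (t = 1 \<and> k \<ge> 1) \<or> (t = 2 \<and> k \<ge> 2)"

definition tp_V :: "bool \<Rightarrow> nat \<Rightarrow> tv set" where
  "tp_V b k = {TW b, TY b, TZ b} \<union> TX b ` {1..k}"

definition tp_Neg :: "bool \<Rightarrow> nat \<Rightarrow> nat \<Rightarrow> tv set set" where
  "tp_Neg b t k = {{TX b k, TY b}, {TX b k, TZ b}} \<union>
     (if t = 2 then {{TW b, TX b (k - 1)}} else {})"

definition tp_Free :: "bool \<Rightarrow> nat \<Rightarrow> tv set set" where
  "tp_Free b k = {{TW b, TY b}, {TW b, TZ b}} \<union> {{TX b i, TX b (Suc i)} | i. 1 \<le> i \<and> i < k}"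

text \<open>Sums: identify the end TX False 1 of T' with the end TX True 1 of T.\<close>
definition sum_ren :: "tv \<Rightarrow> tv" where
  "sum_ren v = (if v = TX False 1 then TX True 1 else v)"

definition famS :: "tv sgraph set" where
  "famS = (\<Union>t k t' k'. if valid_tp t k \<and> valid_tp t' k' then
     sfam (sum_ren ` (tp_V True k \<union> tp_V False k'))
          ((`) sum_ren ` (tp_Neg True t k \<union> tp_Neg False t' k')) {}
          ((`) sum_ren ` (tp_Free True k \<union> tp_Free False k'))
   else {})"

text \<open>Joins: P is one side of a bipartition of the disjoint union T \<union> T'.\<close>
definition join_fam :: "nat \<Rightarrow> nat \<Rightarrow> nat \<Rightarrow> nat \<Rightarrow> tv set \<Rightarrow> tv sgraph set" where
  "join_fam t k t' k' P =
    (let x = TX True 1; x' = TX False 1;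
         V1 = tp_V True k; V2 = tp_V False k';
         opp = (\<lambda>a b. (a \<in> P) \<noteq> (b \<in> P));
         Added = {{x, v} | v. v \<in> V2 \<and> opp x v} \<union> {{x', u} | u. u \<in> V1 \<and> opp x' u};
         Exc = (if opp x x' \<and> t = 1 \<and> k = 1 then {{x', TW True}} else {}) \<union>
               (if opp x x' \<and> t' = 1 \<and> k' = 1 then {{x, TW False}} else {})
     in sfam (V1 \<union> V2) (tp_Neg True t k \<union> tp_Neg False t' k') (Added - Exc)
             (tp_Free True k \<union> tp_Free False k' \<union> Exc))"

definition famJ :: "tv sgraph set" where
  "famJ = (\<Union>t k t' k'. if valid_tp t k \<and> valid_tp t' k' then
     (\<Union>P\<in>{P. P \<subseteq> tp_V True k \<union> tp_V False k' \<and>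
              (\<forall>e\<in>tp_Neg True t k \<union> tp_Neg False t' k' \<union> tp_Free True k \<union> tp_Free False k'.
                  card (e \<inter> P) = 1)}.
        join_fam t k t' k' P)
   else {})"

definition F_free :: "('a, 'z) sgraph_scheme \<Rightarrow> bool" where
  "F_free G \<longleftrightarrow> free_of G famF1 \<and> free_of G famF2 \<and> free_of G famF3 \<and> free_of G famF4 \<and>
     free_of G famF5 \<and> free_of G famF6 \<and> free_of G famC \<and> free_of G famD \<and>
     free_of G famS \<and> free_of G famJ"

end

theory Submission
  imports Defs
begin

text \<open>Every member of \<open>\<F>\<close> is \<^emph>\<open>stuck\<close>: for any two vertices \<open>u\<close>, \<open>v\<close> on different sides there are
  neighbours \<open>p\<close> of \<open>u\<close> and \<open>q\<close> of \<open>v\<close>, other than \<open>v\<close> and \<open>u\<close>, such that \<open>pq\<close> is not a positive edge.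
  Hence no edge inside it can be the first one to go, and deleting a simplicial edge never creates a
  member of \<open>\<F>\<close>. So it suffices to find a simplicial edge in an \<open>\<F>\<close>-free graph with edges.

  If no edge is simplicial, consider separations \<open>(A, S, B)\<close>: disjoint connected sets \<open>A\<close>, \<open>B\<close> with edges
  and common neighbourhood \<open>S\<close>. For minimal \<open>A\<close>, every vertex of \<open>S\<close> is complete to \<open>A\<close> and \<open>S\<close> is a
  positive biclique. An induction on \<open>|A|\<close> shows that some tadpole has its end in \<open>S\<close> and its other
  vertices in \<open>A\<close>, whereas no tadpole lies in this way in \<open>B\<close> and \<open>S\<close>, since two tadpoles on different
  sides yield a sum or a join; by symmetry this is absurd. The induction reduces to \<open>2K\<^sub>2\<close>-free \<open>A\<close>,
  whose neighbourhoods form chains; there the families \<open>F\<^sub>1, \<dots>, F\<^sub>6\<close> force the tadpole.\<close>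

subsection \<open>Signed bigraphs as adjacency relations\<close>

text \<open>The inductive claim must speak of both sides of a separation: a tadpole in
  \<open>A\<close> and none in \<open>B\<close>. A copy of \<open>2K\<^sub>2\<close> inside a
  minimal \<open>A\<close> yields a separation with two smaller sides, and the claim read from
  either end says of one side both that it carries a tadpole and that it does not. So
  \<open>2K\<^sub>2\<close>-freeness comes without any construction. For the same reason a graph
  without simplicial edges has no separation at all; it is then a chain graph with empty separator,
  and a tadpole ending in the empty set is the final contradiction.

  Tadpoles are what \<open>F\<^sub>1, \<dots>, F\<^sub>6\<close> cannot exclude on a chain-like
  side. The shortest ones have an end \<open>x\<close> with two negative edges, or a negative edge
  \<open>xw\<close> next to a second vertex with two negative edges; longer ones arise by prepending
  paths.\<close>

locale sbg =
  fixes V :: "'v set" and E Ng :: "'v \<Rightarrow> 'v \<Rightarrow> bool" and c :: "'v \<Rightarrow> bool"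
  assumes finV: "finite V"
    and E_sym: "E u v \<Longrightarrow> E v u"
    and E_V: "E u v \<Longrightarrow> u \<in> V"
    and E_col: "E u v \<Longrightarrow> c u \<noteq> c v"
    and Ng_E: "Ng u v \<Longrightarrow> E u v"
    and Ng_sym: "Ng u v \<Longrightarrow> Ng v u"
begin

lemma E_comm: "E u v \<longleftrightarrow> E v u"
  using E_sym by blast

lemma Ng_comm: "Ng u v \<longleftrightarrow> Ng v u"
  using Ng_sym by blast

lemma E_irrefl [simp]: "\<not> E u u"
  using E_col by blast

lemma E_V2: "E u v \<Longrightarrow> v \<in> V"
  using E_V E_sym by blast

subsection \<open>Induced paths\<close>

text \<open>Induced paths as vertex lists. The quantifier over \<open>set p\<close> is vacuous for
  empty \<open>p\<close>, so the unspecified \<open>hd []\<close> never matters.\<close>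

fun ipl :: "'v list \<Rightarrow> bool" where
  "ipl [] \<longleftrightarrow> True"
| "ipl (x # p) \<longleftrightarrow> x \<notin> set p \<and> ipl p \<and> (\<forall>u\<in>set p. E x u \<longleftrightarrow> u = hd p)"

text \<open>The only edge between two consecutive pieces of an induced path joins the last vertex of
  the first to the first vertex of the second. This is the rule for cutting and gluing paths; with
  an empty piece the cross condition is vacuous.\<close>

lemma ipl_append:
  "ipl (p @ q) \<longleftrightarrow> ipl p \<and> ipl q \<and> set p \<inter> set q = {} \<and>
     (\<forall>u\<in>set p. \<forall>v\<in>set q. E u v \<longleftrightarrow> u = last p \<and> v = hd q)"
proof (induction p)
  case (Cons x p)
  show ?case
  proof (cases "p = []")
    case True
    show ?thesis unfolding True by simp blast
  next
    case False
    then have 1: "last (x # p) = last p" "last p \<in> set p" "hd (p @ q) = hd p" "hd p \<in> set p"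
      by auto
    show ?thesis
      unfolding append_Cons ipl.simps Cons.IH set_append list.set 1(1,3) insert_iff ball_Un Un_iff
      using 1(2,4) by (auto simp: disjoint_iff)
  qed
qed simp

lemma ipl_distinct: "ipl p \<Longrightarrow> distinct p"
  by (induction p) auto

lemma ipl_rev: "ipl p \<Longrightarrow> ipl (rev p)"
proof (induction p)
  case (Cons x p)
  then have 1: "ipl (rev p)" "x \<notin> set p" and 2: "\<And>u. u \<in> set p \<Longrightarrow> E u x \<longleftrightarrow> u = hd p"
    using E_comm[of _ x] by auto
  show ?case
    using 1 2 by (auto simp: ipl_append last_rev)
qed simp

lemma ipl_snoc:
  "p \<noteq> [] \<Longrightarrow> ipl (p @ [x]) \<longleftrightarrow> ipl p \<and> x \<notin> set p \<and> (\<forall>u\<in>set p. E u x \<longleftrightarrow> u = last p)"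
  by (auto simp: ipl_append)

lemma ipl_snocI:
  "p \<noteq> [] \<Longrightarrow> ipl p \<Longrightarrow> x \<notin> set p \<Longrightarrow> (\<And>u. u \<in> set p \<Longrightarrow> E u x \<longleftrightarrow> u = last p) \<Longrightarrow> ipl (p @ [x])"
  by (simp add: ipl_snoc)

text \<open>Colours alternate along edges. This later fixes the parity of a hole.\<close>

lemma ipl_colour:
  assumes "ipl p" "i < length p"
  shows "c (p ! i) = (c (p ! 0) = even i)"
  using assms
proof (induction p arbitrary: i)
  case (Cons x p)
  show ?case
  proof (cases i)
    case (Suc j)
    then have ne: "p \<noteq> []" "j < length p" using Cons.prems by auto
    then have "E x (p ! 0)" using Cons.prems by (auto simp: hd_conv_nth)
    then have "c x \<noteq> c (p ! 0)" by (rule E_col)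
    then show ?thesis using Cons.IH[of j] Cons.prems ne Suc by auto
  qed simp
qed simp

lemma ipl_nth:
  assumes "ipl p" "i < length p" "j < length p"
  shows "E (p ! i) (p ! j) \<longleftrightarrow> j = Suc i \<or> i = Suc j"
  using assms
proof (induction p arbitrary: i j)
  case (Cons x p)
  have x: "E x (p ! k) \<longleftrightarrow> k = 0" if "k < length p" for k
  proof -
    have "p \<noteq> []" using that by auto
    then have "hd p = p ! 0" by (simp add: hd_conv_nth)
    moreover have "p ! k = p ! 0 \<longleftrightarrow> k = 0"
      using ipl_distinct[of p] Cons.prems(1) that \<open>p \<noteq> []\<close> by (auto simp: nth_eq_iff_index_eq)
    ultimately show ?thesis using Cons.prems(1) that by auto
  qed
  have x': "E (p ! k) x \<longleftrightarrow> k = 0" if "k < length p" for k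
    using x[OF that] E_comm[of x] by simp
  show ?case
    using Cons.IH Cons.prems x x' by (cases i; cases j) auto
qed simp

lemma ipl_by_nth:
  assumes "distinct p"
    and "\<And>i j. i < j \<Longrightarrow> j < length p \<Longrightarrow> E (p ! i) (p ! j) \<longleftrightarrow> j = Suc i"
  shows "ipl p"
  using assms
proof (induction p)
  case (Cons x p)
  have "ipl p"
  proof (rule Cons.IH)
    show "distinct p" using Cons.prems by simp
    fix i j assume "i < j" "j < length p"
    then show "E (p ! i) (p ! j) \<longleftrightarrow> j = Suc i" using Cons.prems(2)[of "Suc i" "Suc j"] by simp
  qed
  moreover have "E x u \<longleftrightarrow> u = hd p" if u: "u \<in> set p" for u
  proof -
    obtain k where k: "k < length p" "u = p ! k" using u by (auto simp: in_set_conv_nth)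
    then have "E x u \<longleftrightarrow> k = 0" using Cons.prems(2)[of 0 "Suc k"] by simp
    moreover have "p \<noteq> []" using k by auto
    moreover have "u = hd p \<longleftrightarrow> k = 0"
      using k Cons.prems(1) \<open>p \<noteq> []\<close> by (auto simp: hd_conv_nth nth_eq_iff_index_eq)
    ultimately show ?thesis by blast
  qed
  ultimately show ?case using Cons.prems by auto
qed simp

subsection \<open>Connected sets\<close>

text \<open>\<open>reach U u u\<close> holds even for \<open>u\<close> outside \<open>U\<close>; a
  walk with at least one step stays inside \<open>U\<close>.\<close>

definition reach :: "'v set \<Rightarrow> 'v \<Rightarrow> 'v \<Rightarrow> bool" where
  "reach U = (\<lambda>a b. E a b \<and> a \<in> U \<and> b \<in> U)\<^sup>*\<^sup>*"

definition conn :: "'v set \<Rightarrow> bool" where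
  "conn U \<longleftrightarrow> (\<forall>u\<in>U. \<forall>v\<in>U. reach U u v)"

lemma reach_refl [simp]: "reach U u u"
  by (simp add: reach_def)

lemma reach_step: "E a b \<Longrightarrow> a \<in> U \<Longrightarrow> b \<in> U \<Longrightarrow> reach U a b"
  unfolding reach_def by blast

lemma reach_trans: "reach U a b \<Longrightarrow> reach U b d \<Longrightarrow> reach U a d"
  unfolding reach_def by simp

lemma reach_sym: "reach U a b \<Longrightarrow> reach U b a"
proof -
  assume "reach U a b"
  then have "(\<lambda>a b. E a b \<and> a \<in> U \<and> b \<in> U)\<^sup>*\<^sup>* a b" by (simp add: reach_def)
  then show ?thesis
  proof (induction rule: rtranclp_induct)
    case (step y z)
    then have "reach U z y" using reach_step E_sym by blast
    then show ?case using step reach_trans by blast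
  qed simp
qed

lemma reach_mono: "reach U a b \<Longrightarrow> U \<subseteq> W \<Longrightarrow> reach W a b"
proof -
  assume "reach U a b" and UW: "U \<subseteq> W"
  then have "(\<lambda>a b. E a b \<and> a \<in> U \<and> b \<in> U)\<^sup>*\<^sup>* a b" by (simp add: reach_def)
  then show ?thesis
  proof (induction rule: rtranclp_induct)
    case (step y z)
    then have "reach W y z" using reach_step UW by blast
    then show ?case using step reach_trans by blast
  qed simp
qed

text \<open>Invariance principle behind the confinement of connected sets and components: a set
  closed under steps into \<open>U\<close> cannot be left by a walk in \<open>U\<close>.\<close>

lemma reach_closed:
  assumes "reach U a b" "a \<in> Z" and "\<And>u v. u \<in> Z \<Longrightarrow> E u v \<Longrightarrow> v \<in> U \<Longrightarrow> v \<in> Z"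
  shows "b \<in> Z"
proof -
  from assms(1) have "(\<lambda>a b. E a b \<and> a \<in> U \<and> b \<in> U)\<^sup>*\<^sup>* a b" by (simp add: reach_def)
  then show ?thesis
    by (induction rule: rtranclp_induct) (use assms in auto)
qed

lemma connI:
  assumes "\<And>v. v \<in> U \<Longrightarrow> reach U u v"
  shows "conn U"
  using assms reach_sym reach_trans unfolding conn_def by meson

lemma conn_Un:
  assumes "conn X" "conn Y" "x \<in> X" "y \<in> Y" "E x y"
  shows "conn (X \<union> Y)"
proof (rule connI[of _ x])
  fix v assume "v \<in> X \<union> Y"
  have X: "reach (X \<union> Y) a b" if "a \<in> X" "b \<in> X" for a b
    using that assms(1) reach_mono unfolding conn_def by blast
  have Y: "reach (X \<union> Y) a b" if "a \<in> Y" "b \<in> Y" for a b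
    using that assms(2) reach_mono unfolding conn_def by blast
  have "reach (X \<union> Y) x y" using assms by (intro reach_step) auto
  then show "reach (X \<union> Y) x v"
    using \<open>v \<in> X \<union> Y\<close> X Y assms reach_trans by blast
qed

lemma conn_single [simp]: "conn {x}"
  by (simp add: conn_def)

lemma conn_insert: "conn X \<Longrightarrow> x \<in> X \<Longrightarrow> E x y \<Longrightarrow> conn (insert y X)"
  using conn_Un[of X "{y}" x y] by simp

lemma conn_ipl: "ipl p \<Longrightarrow> conn (set p)"
proof (induction p)
  case (Cons x p)
  show ?case
  proof (cases "p = []")
    case False
    then have "E (hd p) x" using Cons.prems E_sym by auto
    then show ?thesis using Cons conn_insert[of "set p" "hd p" x] False by auto
  qed simp
qed (simp add: conn_def)

definition nb :: "'v set \<Rightarrow> 'v set" where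
  "nb U = {v. v \<notin> U \<and> (\<exists>u\<in>U. E u v)}"

text \<open>A connected set can leave \<open>U\<close> only through \<open>nb U\<close>.\<close>

lemma conn_subset:
  assumes "conn C" "C \<inter> nb U = {}" "u \<in> C" "u \<in> U"
  shows "C \<subseteq> U"
proof
  fix v assume "v \<in> C"
  then have "reach C u v" using assms unfolding conn_def by blast
  then show "v \<in> U"
    by (rule reach_closed) (use assms in \<open>auto simp: nb_def\<close>)
qed

text \<open>Working backwards from the target, each new vertex \<open>u\<close> is put in front of
  the induced path found so far, which is first cut at the last neighbour of \<open>u\<close>, or at
  \<open>u\<close> itself if it is already there. If \<open>u\<close> satisfies \<open>Q\<close>,
  the path restarts as \<open>[u]\<close>, which keeps \<open>Q\<close> away from all vertices but
  the last.\<close>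

lemma reach_induced_path:
  assumes "reach U u v" "u \<in> U" "Q v"
  shows "\<exists>p. p \<noteq> [] \<and> ipl p \<and> set p \<subseteq> U \<and> hd p = u \<and> Q (last p) \<and> (\<forall>x\<in>set (butlast p). \<not> Q x)"
proof -
  from assms(1) have "(\<lambda>a b. E a b \<and> a \<in> U \<and> b \<in> U)\<^sup>*\<^sup>* u v" by (simp add: reach_def)
  then show ?thesis using assms(2)
  proof (induction rule: converse_rtranclp_induct)
    case base
    then show ?case using assms(3) by (intro exI[of _ "[v]"]) auto
  next
    case (step u u')
    then obtain p where p: "p \<noteq> []" "ipl p" "set p \<subseteq> U" "hd p = u'" "Q (last p)"
      "\<forall>x\<in>set (butlast p). \<not> Q x" by blast
    show ?case
    proof (cases "Q u")
      case True
      then show ?thesis using step by (intro exI[of _ "[u]"]) auto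
    next
      case nQ: False
      show ?thesis
      proof (cases "u \<in> set p")
        case True
        then obtain s t where st: "p = s @ u # t" by (meson split_list)
        then show ?thesis using p nQ
          by (intro exI[of _ "u # t"]) (auto simp: ipl_append butlast_append)
      next
        case False
        have "\<exists>x\<in>set p. E u x" using p step by (metis hd_in_set)
        then obtain s a t where st: "p = s @ a # t" "E u a" "\<forall>x\<in>set t. \<not> E u x"
          using split_list_last_prop[of p "E u"] by metis
        have "ipl (u # a # t)" using p st False by (auto simp: ipl_append)
        then show ?thesis using p nQ st step
          by (intro exI[of _ "u # a # t"]) (auto simp: butlast_append split: if_splits)
      qed
    qed
  qed
qed

text \<open>Starting the path at its last \<open>P\<close>-vertex makes \<open>P\<close> hold at the
  front only, as \<open>Q\<close> already holds at the back only.\<close>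

lemma conn_induced_path:
  assumes "conn U" "u \<in> U" "P u" "v \<in> U" "Q v"
  obtains p where "p \<noteq> []" "ipl p" "set p \<subseteq> U" "P (hd p)" "\<forall>x\<in>set (tl p). \<not> P x"
    "Q (last p)" "\<forall>x\<in>set (butlast p). \<not> Q x"
proof -
  have "reach U u v" using assms unfolding conn_def by blast
  then obtain p where p: "p \<noteq> []" "ipl p" "set p \<subseteq> U" "hd p = u" "Q (last p)"
      "\<forall>x\<in>set (butlast p). \<not> Q x" using reach_induced_path assms by metis
  have "\<exists>x\<in>set p. P x" using p assms by (metis hd_in_set)
  then obtain s a t where st: "p = s @ a # t" "P a" "\<forall>x\<in>set t. \<not> P x"
    using split_list_last_prop[of p P] by metis
  show thesis
    by (rule that[of "a # t"]) (use p st in \<open>auto simp: ipl_append butlast_append split: if_splits\<close>)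
qed

definition comp :: "'v set \<Rightarrow> 'v \<Rightarrow> 'v set" where
  "comp U u = {v. reach U u v}"

lemma comp_props:
  assumes "u \<in> U"
  shows "u \<in> comp U u" "comp U u \<subseteq> U" "conn (comp U u)" "nb (comp U u) \<inter> U = {}"
proof -
  show 1: "u \<in> comp U u" by (simp add: comp_def)
  show 2: "comp U u \<subseteq> U"
  proof
    fix v assume "v \<in> comp U u"
    then have "reach U u v" by (simp add: comp_def)
    then show "v \<in> U" by (rule reach_closed) (use assms in auto)
  qed
  show 4: "nb (comp U u) \<inter> U = {}"
  proof -
    have "v \<in> comp U u" if "v \<in> U" "x \<in> comp U u" "E x v" for x v
      using that 2 reach_step reach_trans unfolding comp_def by blast
    then show ?thesis by (auto simp: nb_def)
  qed
  show "conn (comp U u)"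
  proof (rule connI)
    fix v assume "v \<in> comp U u"
    then have "(\<lambda>a b. E a b \<and> a \<in> U \<and> b \<in> U)\<^sup>*\<^sup>* u v" by (simp add: reach_def comp_def)
    then show "reach (comp U u) u v"
    proof (induction rule: rtranclp_induct)
      case (step y z)
      then have "reach U u y" "reach U y z" using reach_step by (auto simp: reach_def)
      then have "y \<in> comp U u" "z \<in> comp U u" using reach_trans by (auto simp: comp_def)
      then have "reach (comp U u) y z" using step reach_step by blast
      then show ?case using step reach_trans by blast
    qed simp
  qed
qed

subsection \<open>Separations\<close>

definition has_edge :: "'v set \<Rightarrow> bool" where
  "has_edge A \<longleftrightarrow> (\<exists>u\<in>A. \<exists>v\<in>A. E u v)"

definition sep :: "'v set \<Rightarrow> 'v set \<Rightarrow> 'v set \<Rightarrow> bool" where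
  "sep A S B \<longleftrightarrow> A \<inter> B = {} \<and> conn A \<and> conn B \<and> has_edge A \<and> has_edge B \<and> nb A = S \<and> nb B = S"

lemma sep_sym: "sep A S B \<Longrightarrow> sep B S A"
  by (auto simp: sep_def)

lemma sepD:
  assumes "sep A S B"
  shows "A \<inter> B = {}" "conn A" "conn B" "has_edge A" "has_edge B" "nb A = S" "nb B = S"
    "A \<inter> S = {}" "B \<inter> S = {}" "\<And>a b. a \<in> A \<Longrightarrow> b \<in> B \<Longrightarrow> \<not> E a b"
    "\<And>a b. a \<in> A \<Longrightarrow> b \<in> B \<Longrightarrow> \<not> E b a"
proof -
  show "A \<inter> B = {}" "conn A" "conn B" "has_edge A" "has_edge B" "nb A = S" "nb B = S"
    using assms by (auto simp: sep_def)
  show AS: "A \<inter> S = {}" "B \<inter> S = {}" using assms by (auto simp: sep_def nb_def)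
  show n: "\<not> E a b" if "a \<in> A" "b \<in> B" for a b
  proof
    assume "E a b"
    then have "b \<in> nb A" using that assms by (auto simp: nb_def sep_def)
    then show False using AS assms that by (auto simp: sep_def)
  qed
  show "\<not> E b a" if "a \<in> A" "b \<in> B" for a b
    using n that E_sym by blast
qed

lemma has_edge_mono: "has_edge A \<Longrightarrow> A \<subseteq> B \<Longrightarrow> has_edge B"
  unfolding has_edge_def by blast

lemma has_edge_colours:
  assumes "has_edge A"
  shows "\<exists>a\<in>A. c a = k"
proof -
  obtain u v where "u \<in> A" "v \<in> A" "E u v" using assms unfolding has_edge_def by blast
  then show ?thesis using E_col by (cases "c u = k") auto
qed

lemma has_edge_subset_V: "conn A \<Longrightarrow> has_edge A \<Longrightarrow> A \<subseteq> V"
proof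
  fix v assume "conn A" "has_edge A" "v \<in> A"
  then obtain u where "u \<in> A" "u \<in> V" unfolding has_edge_def using E_V by blast
  then have "reach A u v" using \<open>conn A\<close> \<open>v \<in> A\<close> unfolding conn_def by blast
  then show "v \<in> V" by (rule reach_closed) (use \<open>u \<in> V\<close> E_V2 in auto)
qed

lemma conn_nbr:
  assumes "conn A" "has_edge A" "a \<in> A"
  shows "\<exists>b\<in>A. E a b"
proof (rule ccontr)
  assume n: "\<not> ?thesis"
  obtain u v where uv: "u \<in> A" "v \<in> A" "E u v" using assms unfolding has_edge_def by blast
  have "reach A a u" using assms uv unfolding conn_def by blast
  then have "u \<in> {a}" by (rule reach_closed) (use n in auto)
  then show False using n uv by blast
qed

text \<open>The other side is the component containing \<open>D0\<close> of the graph without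
  \<open>C\<close> and \<open>nb C\<close>. Its boundary lies in \<open>nb C\<close> because it is a
  component, and \<open>nb C \<subseteq> nb D0\<close> gives the reverse inclusion.\<close>

lemma sep_extend:
  assumes "conn C" "has_edge C" "conn D0" "has_edge D0" "C \<inter> D0 = {}" "D0 \<inter> nb C = {}"
    "nb C \<subseteq> nb D0"
  obtains D where "D0 \<subseteq> D" "sep C (nb C) D"
proof -
  define U where "U = V - C - nb C"
  have D0V: "D0 \<subseteq> V" using has_edge_subset_V assms by blast
  then have D0U: "D0 \<subseteq> U" using assms by (auto simp: U_def)
  obtain d where d: "d \<in> D0" using assms unfolding has_edge_def by blast
  define D where "D = comp U d"
  have dU: "d \<in> U" using d D0U by blast
  have cp: "d \<in> D" "D \<subseteq> U" "conn D" "nb D \<inter> U = {}"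
    unfolding D_def using comp_props[OF dU] by auto
  have sub: "D0 \<subseteq> D"
  proof (rule conn_subset[OF assms(3) _ d cp(1)])
    show "D0 \<inter> nb D = {}" using D0U cp by blast
  qed
  have "nb D \<subseteq> nb C"
  proof
    fix v assume v: "v \<in> nb D"
    then obtain u where u: "u \<in> D" "E u v" by (auto simp: nb_def)
    then have "v \<in> V" "v \<notin> U" using E_V2 v cp by auto
    moreover have "v \<notin> C" using u cp(2) E_sym by (auto simp: U_def nb_def)
    ultimately show "v \<in> nb C" by (auto simp: U_def)
  qed
  moreover have "nb C \<subseteq> nb D"
  proof
    fix v assume v: "v \<in> nb C"
    then have "v \<notin> D" using cp(2) by (auto simp: U_def)
    moreover obtain u where "u \<in> D0" "E u v" using v assms(7) by (auto simp: nb_def)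
    ultimately show "v \<in> nb D" using sub by (auto simp: nb_def)
  qed
  ultimately have "sep C (nb C) D"
    using assms cp sub has_edge_mono[OF assms(4) sub] by (auto simp: sep_def U_def)
  then show thesis using that sub by blast
qed

text \<open>\<open>D\<close> is the component of \<open>d\<close>, \<open>e\<close> after removal of
  \<open>{a, b}\<close> and its neighbours. Its boundary lies in \<open>nb {a, b}\<close>, so
  \<open>sep_extend\<close>, with \<open>D\<close> as the fixed side, grows \<open>{a, b}\<close> to
  the opposite side. The condition \<open>c a = c d\<close> leaves only \<open>ae\<close> and
  \<open>db\<close> as possible edges between the two pairs.\<close>

lemma sep_of_2K2:
  assumes "E a b" "E d e" "c a = c d" "\<not> E a e" "\<not> E d b"
  obtains C S D where "sep C S D" "a \<in> C" "b \<in> C" "d \<in> D" "e \<in> D"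
proof -
  have col: "c b \<noteq> c a" "c e = c b" using assms E_col by blast+
  have n: "\<not> E a d" "\<not> E b e" "\<not> E b d" "\<not> E e a" using col assms E_col E_sym by metis+
  have ne: "a \<noteq> d" "b \<noteq> e" "a \<noteq> e" "b \<noteq> d" using assms E_col by auto
  define U where "U = V - {a,b} - nb {a,b}"
  have de: "d \<in> U" "e \<in> U" using n ne assms E_V E_V2 by (auto simp: U_def nb_def)
  define D where "D = comp U d"
  have cp: "d \<in> D" "D \<subseteq> U" "conn D" "nb D \<inter> U = {}"
    unfolding D_def using comp_props[OF de(1)] by auto
  have eD: "e \<in> D" using cp de assms by (auto simp: nb_def)
  have c1: "conn {a,b}" using conn_insert[of "{b}" b a] E_sym assms by simp
  have c3: "has_edge {a,b}" using assms by (auto simp: has_edge_def)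
  have c2: "has_edge D" using eD cp assms by (auto simp: has_edge_def)
  have sub: "nb D \<subseteq> nb {a,b}"
  proof
    fix v assume v: "v \<in> nb D"
    then obtain u where u: "u \<in> D" "E u v" by (auto simp: nb_def)
    then have "v \<in> V" "v \<notin> U" using E_V2 v cp by auto
    moreover have "v \<notin> {a,b}" using u cp(2) E_sym by (auto simp: U_def nb_def)
    ultimately show "v \<in> nb {a,b}" by (auto simp: U_def)
  qed
  have "D \<inter> {a,b} = {}" using cp by (auto simp: U_def)
  moreover have "{a,b} \<inter> nb D = {}"
    using sub by (auto simp: nb_def)
  ultimately obtain C where C: "{a,b} \<subseteq> C" "sep D (nb D) C"
    using sep_extend[OF cp(3) c2 c1 c3 _ _ sub] by blast
  show thesis by (rule that[OF sep_sym[OF C(2)]]) (use C cp eD in auto)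
qed

text \<open>The new small side is a component \<open>C\<close> of the non-neighbours of
  \<open>s\<close> in \<open>A\<close>, and \<open>s\<close> moves over to \<open>B\<close>. A
  boundary vertex of \<open>C\<close> lies in \<open>A\<close> and is adjacent to \<open>s\<close>,
  or lies in \<open>S\<close> and is adjacent to \<open>B\<close>; so \<open>insert s B\<close> sees
  all of \<open>nb C\<close>. The inclusion is proper because \<open>s\<close> has a neighbour in
  \<open>A\<close>.\<close>

lemma sep_shrink:
  assumes sep: "sep A S B" and s: "s \<in> S" "a \<in> A" "c s \<noteq> c a" "\<not> E s a"
  obtains A' S' B' where "A' \<subset> A" "B \<subseteq> B'" "sep A' S' B'"
proof -
  note sp = sepD[OF sep]
  define U where "U = {x\<in>A. \<not> E s x}"
  obtain a' where a': "a' \<in> A" "E a a'" using conn_nbr[OF sp(2,4) s(2)] by blast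
  \<comment> \<open>A neighbour of \<open>a\<close> has the colour of \<open>s\<close>, so it is not
    adjacent to \<open>s\<close> and stays with \<open>a\<close>: this provides the edge that
    \<open>C\<close> needs.\<close>
  then have "c a' = c s" using s(3) E_col[of a a'] by auto
  then have U: "a \<in> U" "a' \<in> U" using a' s E_col[of s a'] by (auto simp: U_def)
  define C where "C = comp U a"
  have cp: "a \<in> C" "C \<subseteq> U" "conn C" "nb C \<inter> U = {}"
    unfolding C_def using comp_props[OF U(1)] by auto
  have "a' \<in> C" using cp U a' by (auto simp: nb_def)
  then have hC: "has_edge C" using cp a' by (auto simp: has_edge_def)
  have sB: "s \<in> nb B" "s \<in> nb A" using s(1) sp(6,7) by auto
  then obtain b where b: "b \<in> B" "E b s" by (auto simp: nb_def)
  have cB: "conn (insert s B)" using conn_insert[OF sp(3) b] .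
  have hB: "has_edge (insert s B)" using has_edge_mono[OF sp(5)] by blast
  have CA: "C \<subseteq> A" using cp by (auto simp: U_def)
  have sC: "s \<notin> nb C" using cp(2) E_sym by (auto simp: U_def nb_def)
  have BC: "B \<inter> nb C = {}" using CA sp(1,10) by (auto simp: nb_def)
  have sub: "nb C \<subseteq> nb (insert s B)"
  proof
    fix v assume v: "v \<in> nb C"
    then obtain u where u: "u \<in> C" "E u v" "v \<notin> C" by (auto simp: nb_def)
    show "v \<in> nb (insert s B)"
    proof (cases "v \<in> A")
      case True
      then have "v \<notin> U" using v cp by blast
      then have "E s v" using True by (auto simp: U_def)
      then show ?thesis using True sp(1,8) s(1) by (auto simp: nb_def)
    next
      case False
      then have "v \<in> S" using u CA sp(6) by (auto simp: nb_def)
      then have "v \<in> nb B" "v \<noteq> s" using sp(7) sC v by auto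
      then show ?thesis by (auto simp: nb_def)
    qed
  qed
  have "C \<inter> insert s B = {}" using CA sp(1,8) s(1) by blast
  then obtain D where D: "insert s B \<subseteq> D" "sep C (nb C) D"
    using sep_extend[OF cp(3) hC cB hB _ _ sub] sC BC by blast
  obtain a0 where "a0 \<in> A" "E a0 s" using sB by (auto simp: nb_def)
  then have "a0 \<in> A - C" using cp(2) E_sym by (auto simp: U_def)
  then show thesis using that[of C D "nb C"] D CA by blast
qed

end

subsection \<open>Tadpoles\<close>

context sbg
begin

text \<open>Here \<open>p\<close> lists \<open>x\<^sub>1, \<dots>, x\<^sub>k\<close>, so the end is \<open>hd p\<close>; the tadpole has type 2 iff some vertex
  of \<open>p\<close> is adjacent to \<open>w\<close>.\<close>
definition tad :: "'v list \<Rightarrow> 'v \<Rightarrow> 'v \<Rightarrow> 'v \<Rightarrow> bool" where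
  "tad p w y z \<longleftrightarrow> p \<noteq> [] \<and> ipl p \<and> y \<noteq> z \<and> w \<notin> set p \<and> y \<notin> set p \<and> z \<notin> set p \<and>
     (\<forall>u\<in>set p. E u y \<longleftrightarrow> u = last p) \<and> (\<forall>u\<in>set p. E u z \<longleftrightarrow> u = last p) \<and>
     Ng (last p) y \<and> Ng (last p) z \<and> E w y \<and> E w z \<and>
     (\<forall>u\<in>set p. E u w \<longrightarrow> Ng u w \<and> u = last (butlast p))"

abbreviation tl_verts :: "'v list \<Rightarrow> 'v \<Rightarrow> 'v \<Rightarrow> 'v \<Rightarrow> 'v set" where
  "tl_verts p w y z \<equiv> set (tl p) \<union> {w, y, z}"

lemma tadD:
  assumes "tad p w y z"
  shows "p \<noteq> []" "ipl p" "y \<noteq> z" "w \<notin> set p" "y \<notin> set p" "z \<notin> set p"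
    "\<And>u. u \<in> set p \<Longrightarrow> E u y \<longleftrightarrow> u = last p" "\<And>u. u \<in> set p \<Longrightarrow> E u z \<longleftrightarrow> u = last p"
    "Ng (last p) y" "Ng (last p) z" "E w y" "E w z" "E (last p) y" "E (last p) z"
    "\<And>u. u \<in> set p \<Longrightarrow> E u w \<Longrightarrow> Ng u w" "\<And>u. u \<in> set p \<Longrightarrow> E u w \<Longrightarrow> u = last (butlast p)"
    "c w = c (last p)" "c z = c y" "c y \<noteq> c w"
proof -
  show "p \<noteq> []" "ipl p" "y \<noteq> z" "w \<notin> set p" "y \<notin> set p" "z \<notin> set p"
    "\<And>u. u \<in> set p \<Longrightarrow> E u y \<longleftrightarrow> u = last p" "\<And>u. u \<in> set p \<Longrightarrow> E u z \<longleftrightarrow> u = last p"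
    and 1: "Ng (last p) y" "Ng (last p) z" "E w y" "E w z"
    and "\<And>u. u \<in> set p \<Longrightarrow> E u w \<Longrightarrow> Ng u w" "\<And>u. u \<in> set p \<Longrightarrow> E u w \<Longrightarrow> u = last (butlast p)"
    using assms unfolding tad_def by blast+
  show 2: "E (last p) y" "E (last p) z" using 1 Ng_E by blast+
  show "c w = c (last p)" "c z = c y" "c y \<noteq> c w"
    using 1(3,4)[THEN E_col] 2[THEN E_col] by auto
qed

lemma tadI:
  assumes "p \<noteq> []" "ipl p" "y \<noteq> z" "w \<notin> set p" "y \<notin> set p" "z \<notin> set p"
    "\<And>u. u \<in> set p \<Longrightarrow> E u y \<longleftrightarrow> u = last p" "\<And>u. u \<in> set p \<Longrightarrow> E u z \<longleftrightarrow> u = last p"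
    "Ng (last p) y" "Ng (last p) z" "E w y" "E w z"
    "\<And>u. u \<in> set p \<Longrightarrow> E u w \<Longrightarrow> Ng u w \<and> u = last (butlast p)"
  shows "tad p w y z"
  using assms unfolding tad_def by blast

lemma tad_swap: "tad p w y z \<Longrightarrow> tad p w z y"
  unfolding tad_def by blast

lemma tad_path_nbr:
  assumes t: "tad p w y z" and u: "u \<in> set p"
  shows "\<exists>v\<in>tl_verts p w y z. E u v"
proof -
  obtain s q where p: "p = s @ u # q" using u by (meson split_list)
  show ?thesis
  proof (cases q)
    case Nil
    then have "u = last p" using p by simp
    then show ?thesis using tadD(13)[OF t] by auto
  next
    case (Cons b q')
    have "E u b" using tadD(2)[OF t] p Cons by (auto simp: ipl_append)
    moreover have "b \<in> set (tl p)" using p Cons by (cases s) auto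
    ultimately show ?thesis by blast
  qed
qed

lemma set_tl_subset: "set (tl p) \<subseteq> set p"
  by (cases p) auto

text \<open>A vertex without neighbours in the non-end part is therefore not in the tadpole. In this
  way the absence of edges between two sets already yields their disjointness.\<close>

lemma tad_nbr:
  assumes t: "tad p w y z" and u: "u \<in> set p \<union> {w, y, z}"
  shows "\<exists>v\<in>tl_verts p w y z. E u v"
  using tad_path_nbr[OF t] u tadD(11,12)[OF t] E_sym by blast

lemma tad_conn:
  assumes t: "tad (x # p) w y z"
  shows "conn (set p \<union> {w, y, z})" "has_edge (set p \<union> {w, y, z})"
proof -
  note d = tadD[OF t]
  have 1: "conn {w, y, z}"
    using conn_insert[OF conn_insert[OF conn_single[of w], of w y], of w z] d(11,12)
    by (simp add: insert_commute)
  show "conn (set p \<union> {w, y, z})"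
  proof (cases "p = []")
    case False
    then have "conn (set p)" "last p \<in> set p" "E (last p) y" using conn_ipl[of p] d(2,13) by auto
    then show ?thesis using conn_Un[of "set p" "{w,y,z}" "last p" y] 1 by simp
  qed (use 1 in simp)
  show "has_edge (set p \<union> {w, y, z})" using d(11) unfolding has_edge_def by blast
qed

text \<open>A path that sees only the end of a tadpole can be put in front of it; heads and type
  stay the same. The chord condition survives because it is counted from the far end of the list, as
  \<open>last (butlast p)\<close>.\<close>

lemma tad_extend:
  assumes t: "tad (x # p) w y z" and es: "ipl (es @ [x])"
    and n: "\<And>e r. e \<in> set es \<Longrightarrow> r \<in> set p \<union> {w, y, z} \<Longrightarrow> \<not> E e r"
  shows "tad (es @ x # p) w y z"
proof -
  note d = tadD[OF t]
  have nin: "e \<notin> set p \<union> {w, y, z}" if e: "e \<in> set es" for e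
  proof
    assume "e \<in> set p \<union> {w, y, z}"
    then obtain v where "v \<in> set p \<union> {w, y, z}" "E e v"
      using tad_nbr[OF t, of e] by auto
    then show False using n e by blast
  qed
  have ip: "ipl (es @ x # p)"
    using d(2) es n nin by (auto simp: ipl_append)
  have lx: "last (es @ x # p) = last (x # p)" by simp
  have l2: "u = last (butlast (es @ x # p))" if "u \<in> set (x # p)" "E u w" for u
  proof -
    have u: "u = last (butlast (x # p))" using d(16) that by blast
    \<comment> \<open>With a single path vertex the chord at \<open>w\<close> would lead to
      \<open>last (x # p)\<close>, which has the colour of \<open>w\<close>.\<close>
    have "p \<noteq> []"
    proof
      assume "p = []"
      then have "u = last (x # p)" using that by simp
      then show False using d(17) that(2) E_col by blast
    qed
    then show ?thesis using u by (simp add: butlast_append)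
  qed
  have in_last: "last (x # p) \<in> set (x # p)" by simp
  have es_last: "last (x # p) \<notin> set es"
    using es nin in_last by (auto simp: ipl_append simp del: last_in_set split: if_splits)
  show ?thesis
    unfolding tad_def lx
  proof (intro conjI ballI impI)
    fix u assume u: "u \<in> set (es @ x # p)"
    show "E u y \<longleftrightarrow> u = last (x # p)" using u n es_last d(7) by auto
    show "E u z \<longleftrightarrow> u = last (x # p)" using u n es_last d(8) by auto
  next
    fix u assume u: "u \<in> set (es @ x # p)" "E u w"
    then have "u \<in> set (x # p)" using n by auto
    then show "Ng u w" "u = last (butlast (es @ x # p))" using l2 u d(15) by blast+
  qed (use ip d(3-6,9-12) nin in \<open>simp_all del: last.simps, auto\<close>)
qed

end

text \<open>The forbidden families as implications: negative edges are given by \<open>Ng\<close>,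
  free ones by \<open>E\<close>. Non-edges and inequalities that follow from the colouring or from
  the listed adjacencies are left out. In \<open>noC\<close> the vertex \<open>v\<close> closes the
  path \<open>q\<close> to a cycle on at least five, hence by parity at least six vertices. In
  \<open>noJ\<close> the alternative \<open>u = w' \<and> p' = []\<close> is the free edge of a
  join: for \<open>p' = []\<close> the vertices \<open>x'\<close> and \<open>w'\<close> have the
  same colour, so \<open>x\<close> and \<open>x'\<close> are then automatically on opposite
  sides.\<close>

locale sbg_free = sbg V E Ng c
  for V :: "'v set" and E Ng :: "'v \<Rightarrow> 'v \<Rightarrow> bool" and c :: "'v \<Rightarrow> bool" +
  assumes noF2: "\<lbrakk>Ng a1 b1; Ng a1 b2; Ng a2 b2; Ng a2 b3; E a1 b3; E a2 b1;
      a1 \<noteq> a2; b1 \<noteq> b2; b1 \<noteq> b3; b2 \<noteq> b3\<rbrakk> \<Longrightarrow> False"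
    and noF1: "\<lbrakk>Ng a1 b1; Ng a1 b2; Ng a2 b1; Ng a2 b2; a1 \<noteq> a2; b1 \<noteq> b2\<rbrakk> \<Longrightarrow> False"
    and noF3: "\<lbrakk>Ng a1 b1; Ng a1 b2; Ng a2 b3; Ng a2 b4; E a1 b3; E a1 b4; E a2 b1; E a2 b2;
      a1 \<noteq> a2; distinct [b1, b2, b3, b4]\<rbrakk> \<Longrightarrow> False"
    and noF4: "\<lbrakk>Ng a1 b1; Ng a2 b2; Ng a3 b3; E a1 b2; E a1 b3; E a2 b1; E a2 b3; E a3 b1; E a3 b2;
      distinct [a1, a2, a3]; distinct [b1, b2, b3]\<rbrakk> \<Longrightarrow> False"
    and noF5: "\<lbrakk>E a1 b1; E a1 b2; Ng a2 b1; E a2 b2; E a2 b3; E a3 b1; Ng a3 b2; E a3 b3; \<not> E a1 b3;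
      a2 \<noteq> a3; b1 \<noteq> b2\<rbrakk> \<Longrightarrow> False"
    and noF6: "\<lbrakk>Ng a1 b1; E a1 b2; Ng a2 b1; E a2 b2; E a3 b1; Ng a3 b2; E a3 b3; E a3 b4;
      E a4 b1; E a4 b2; Ng a4 b3; Ng a4 b4; \<not> E a1 b3; \<not> E a1 b4; \<not> E a2 b3; \<not> E a2 b4;
      a1 \<noteq> a2; a3 \<noteq> a4; b1 \<noteq> b2; b3 \<noteq> b4\<rbrakk> \<Longrightarrow> False"
    and noD: "\<lbrakk>E a1 b1; E a1 b2; E a2 b1; Ng a2 b2; E a2 b3; E a3 b2; E a3 b3;
      \<not> E a1 b3; \<not> E a3 b1\<rbrakk> \<Longrightarrow> False"
    and noC: "\<lbrakk>ipl q; length q \<ge> 4; v \<notin> set q; \<And>u. u \<in> set q \<Longrightarrow> E v u \<longleftrightarrow> u = hd q \<or> u = last q\<rbrakk> \<Longrightarrow> False"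
    and noS: "\<lbrakk>tad (x # p) w y z; tad (x # p') w' y' z';
      \<And>u u'. u \<in> set p \<union> {w, y, z} \<Longrightarrow> u' \<in> set p' \<union> {w', y', z'} \<Longrightarrow> \<not> E u u'\<rbrakk> \<Longrightarrow> False"
    and noJ: "\<lbrakk>tad (x # p) w y z; tad (x' # p') w' y' z';
      \<And>u u'. u \<in> set p \<union> {w, y, z} \<Longrightarrow> u' \<in> set p' \<union> {w', y', z'} \<Longrightarrow> \<not> E u u';
      x \<noteq> x'; x \<notin> set p' \<union> {w', y', z'}; x' \<notin> set p \<union> {w, y, z};
      \<And>u. u \<in> insert x' (set p' \<union> {w', y', z'}) \<Longrightarrow> c u \<noteq> c x \<Longrightarrow> E x u \<and> (\<not> Ng x u \<or> u = w' \<and> p' = []);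
      \<And>u. u \<in> insert x (set p \<union> {w, y, z}) \<Longrightarrow> c u \<noteq> c x' \<Longrightarrow> E x' u \<and> (\<not> Ng x' u \<or> u = w \<and> p = [])\<rbrakk>
      \<Longrightarrow> False"
begin

text \<open>An inner neighbour of \<open>v\<close> splits the path into two shorter fans. Without
  one, \<open>v\<close> and \<open>q\<close> form a hole unless \<open>q\<close> has at most three
  vertices, and then a middle vertex has the colour of \<open>v\<close>.\<close>

lemma fan_complete:
  assumes "ipl q" "q \<noteq> []" "v \<notin> set q" "E v (hd q)" "E v (last q)" "u \<in> set q" "c u \<noteq> c v"
  shows "E v u"
  using assms
proof (induction "length q" arbitrary: q rule: less_induct)
  case less
  show ?case
  proof (cases "\<exists>s a t. q = s @ a # t \<and> s \<noteq> [] \<and> t \<noteq> [] \<and> E v a")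
    case True
    then obtain s a t where st: "q = s @ a # t" "s \<noteq> []" "t \<noteq> []" "E v a" by blast
    have h: "hd q = hd (s @ [a])" "last q = last (a # t)" using st by auto
    have 1: "ipl (s @ [a])" "ipl (a # t)" using less.prems(1) st by (auto simp: ipl_append)
    show ?thesis
    proof (cases "u \<in> set (s @ [a])")
      case True
      show ?thesis
        by (rule less.hyps[of "s @ [a]"]) (use less.prems st h 1 True in auto)
    next
      case False
      then have ut: "u \<in> set (a # t)" using less.prems st by auto
      show ?thesis
        by (rule less.hyps[of "a # t"]) (use less.prems st h 1 ut in auto)
    qed
  next
    case False
    have only: "E v u \<longleftrightarrow> u = hd q \<or> u = last q" if u: "u \<in> set q" for u
    proof
      assume Eu: "E v u"
      obtain s t where st: "q = s @ u # t" using u by (meson split_list)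
      then show "u = hd q \<or> u = last q" using False Eu by (cases "s = []"; cases "t = []") auto
    qed (use less.prems in auto)
    have "length q < 4"
      using noC[OF less.prems(1) _ less.prems(3) only] by fastforce
    moreover have "length q \<noteq> 0" using less.prems by simp
    ultimately consider a where "q = [a]" | a b where "q = [a, b]" | a b d where "q = [a, b, d]"
      by (cases q; cases "tl q"; cases "tl (tl q)") auto
    then show ?thesis
    proof cases
      case (3 a b d)
      have "E a b" "E v a" using 3 less.prems by auto
      then have "c b = c v" using E_col by blast
      then have "u \<noteq> b" using less.prems by blast
      then show ?thesis using 3 less.prems by auto
    qed (use less.prems in auto)
  qed
qed

text \<open>Two path vertices on each side of \<open>u\<close> give a window
  \<open>a b u d e\<close> in which \<open>v\<close> sees \<open>a\<close>, \<open>u\<close> and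
  \<open>e\<close>, by \<open>fan_complete\<close>. With \<open>vu\<close> negative this is
  \<open>D\<close>, and \<open>vu\<close> is its central edge.\<close>

lemma fan_positive:
  assumes q: "ipl (s @ u # t)" "v \<notin> set (s @ u # t)" "length s \<ge> 2" "length t \<ge> 2"
    and "E v (hd (s @ u # t))" "E v (last (s @ u # t))" "E v u"
  shows "\<not> Ng v u"
proof
  assume N: "Ng v u"
  obtain s' a b where s: "s = s' @ [a, b]"
    using q(3) by (cases s rule: rev_cases; cases "butlast s" rule: rev_cases) auto
  obtain d e t' where t: "t = d # e # t'"
    using q(4) by (cases t; cases "tl t") auto
  have i: "E a b" "E b u" "E u d" "E d e" "\<not> E b e" "\<not> E a d" "\<not> E a u" "\<not> E u e"
    using q(1) unfolding s t by (auto simp: ipl_append)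
  have col: "c a \<noteq> c v" "c e \<noteq> c v" using i(1-4)[THEN E_col] assms(7)[THEN E_col] by auto
  have "E v a" "E v e"
    using fan_complete[of "s @ u # t" v a] fan_complete[of "s @ u # t" v e] assms col s t by auto
  then show False
    using noD[of b a u v e d] i N E_sym by blast
qed

text \<open>\<open>v\<close> sees the first vertex of a path leading to the end of a tadpole and
  also some other vertex of the tadpole. The cycles closed in this way leave two outcomes:
  \<open>v\<close> is the end of a tadpole whose other vertices belong to the old one, or
  \<open>v\<close> is joined to the tadpole as the end of its partner is in a join, including the
  free sign at \<open>w\<close> for \<open>p = []\<close>.\<close>

lemma tad_attach_path:
  assumes t: "tad (x # p) w y z"
    and ls: "ls \<noteq> []" "ipl (ls @ x # p)" "E v (hd ls)" "v \<notin> set ls"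
    and nls: "\<And>e r. e \<in> set ls \<Longrightarrow> r \<in> {w, y, z} \<Longrightarrow> \<not> E e r"
      "set ls \<inter> {w, y, z} = {}"
    and v: "v \<notin> insert x (set p \<union> {w, y, z})"
    and r: "\<exists>r\<in>set p \<union> {w, y, z}. E v r"
  shows "(\<exists>p' w' y' z'. tad (v # p') w' y' z' \<and> set p' \<union> {w', y', z'} \<subseteq> set p \<union> {w, y, z}) \<or>
    (\<forall>u\<in>insert x (set p \<union> {w, y, z}). c u \<noteq> c v \<longrightarrow> E v u \<and> (\<not> Ng v u \<or> u = w \<and> p = []))"
    (is "?tad \<or> ?pos")
proof -
  note d = tadD[OF t]
  have lsd: "last (x # p) \<notin> set ls"
    using ls(2) last_in_set[of "x # p"] by (auto simp: ipl_append simp del: last_in_set last.simps)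
  define xk where "xk = last (x # p)"
  \<comment> \<open>The predecessor of \<open>xk\<close> on the whole path; it lies in
    \<open>ls\<close> when \<open>p = []\<close>.\<close>
  define u where "u = last (butlast (ls @ x # p))"
  have xk: "xk \<in> set (x # p)" by (simp add: xk_def)
  have lsp: "ls @ x # p = butlast (ls @ x # p) @ [xk]"
    using append_butlast_last_id[of "ls @ x # p"] by (simp add: xk_def del: append_butlast_last_id)
  have bne: "butlast (ls @ x # p) \<noteq> []" using ls(1) by (simp add: butlast_append)
  define s where "s = butlast (butlast (ls @ x # p))"
  have lsu: "ls @ x # p = s @ [u, xk]"
    using lsp bne unfolding u_def s_def by (metis append_Cons append_Nil append_assoc append_butlast_last_id)
  have sne: "s \<noteq> []" if "p \<noteq> []"
    using that lsu ls(1) by (cases ls; cases p) (auto simp: Cons_eq_append_conv append_eq_Cons_conv)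
  have Euxk: "E u xk" using ls(2) unfolding lsu by (auto simp: ipl_append)
  have cu: "c u = c y" using E_col[OF Euxk] E_col[OF d(13)] by (auto simp: xk_def)
  have u_in: "u \<in> set ls \<or> u \<in> set (x # p) \<and> u \<noteq> xk"
    using arg_cong[OF lsu, of set] Euxk by auto
  have nuy: "\<not> E u y" "\<not> E u z" using cu d(18) E_col by auto
  have hdq: "hd (ls @ q) = hd ls" for q using ls(1) by simp
  \<comment> \<open>At least two vertices precede any neighbour of \<open>v\<close> on the tadpole
    path, as \<open>fan_positive\<close> requires. Otherwise \<open>v\<close>, the only vertex of
    \<open>ls\<close> and that neighbour would form a triangle.\<close>
  have front: "length (ls @ s1) \<ge> 2" if "x # p = s1 @ u' # t1" "E v u'" for s1 u' t1
  proof (cases "s1 = []")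
    case True
    show ?thesis
    proof (rule ccontr)
      assume "\<not> ?thesis"
      then obtain l where l: "ls = [l]" using True ls(1) by (cases ls; cases "tl ls") auto
      then have "E l u'" using ls(2) True that by auto
      then show False using that ls(3) l E_col[of l u'] E_col[of v u'] E_col[of v l] by auto
    qed
  qed (use ls(1) in \<open>cases ls; cases s1; auto\<close>)
  \<comment> \<open>If \<open>v\<close> has the colour of \<open>w\<close> and sees one of
    \<open>y\<close>, \<open>z\<close>, it sees both, and positively. The names are primed so that
    the claim serves \<open>(w, y, z)\<close> and \<open>(w, z, y)\<close> alike. It is decided on
    \<open>v\<close>, \<open>w'\<close>, \<open>xk\<close> against \<open>u\<close>,
    \<open>y'\<close>, \<open>z'\<close>. Whether \<open>w'u\<close> is an edge tells the types
    apart: in type 2 and type 1 respectively, a missing \<open>vz'\<close> gives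
    \<open>F\<^sub>5\<close> or \<open>D\<close>, and a negative \<open>vy'\<close> gives
    \<open>F\<^sub>4\<close> or \<open>F\<^sub>5\<close>.\<close>
  have yz: "tad (x # p) w' y' z' \<Longrightarrow> {w', y', z'} = {w, y, z} \<Longrightarrow> E v y' \<Longrightarrow> c v = c w' \<Longrightarrow> E v z' \<and> \<not> Ng v y'"
    for w' y' z'
  proof -
    assume t': "tad (x # p) w' y' z'" and eq: "{w', y', z'} = {w, y, z}"
      and vy: "E v y'" and cv: "c v = c w'"
    note d' = tadD[OF t']
    have ls': "\<not> E e r" "e \<noteq> r" if "e \<in> set ls" "r \<in> {w', y', z'}" for e r
      using nls that unfolding eq[symmetric] by auto
    have q: "ipl (ls @ x # p @ [y'])"
    proof -
      have "ipl ((ls @ x # p) @ [y'])"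
        by (rule ipl_snocI) (use ls(2) ls' d'(5,7) xk lsd in \<open>auto simp: xk_def\<close>)
      then show ?thesis by simp
    qed
    have ev: "E v a" if "a \<in> set (ls @ x # p)" "c a \<noteq> c v" for a
      by (rule fan_complete[OF q]) (use v ls vy that eq in auto)
    have cuv: "c u \<noteq> c v" using E_col[OF Euxk] d'(17) cv by (simp add: xk_def)
    have vu: "E v u" by (rule ev) (use u_in cuv in auto)
    have nuy': "\<not> E u y'" "\<not> E u z'" using cuv cv d'(18,19) E_col[of u y'] E_col[of u z'] by auto
    have nuw: "Ng w' u" if "E w' u"
    proof -
      have "u \<notin> set ls" using that ls' E_sym by blast
      then show ?thesis using u_in d'(15)[of u] that E_sym Ng_sym by blast
    qed
    have xky: "Ng xk y'" "Ng xk z'" "E xk y'" "E xk z'" using d' by (auto simp: xk_def)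
    have "v \<notin> {w', y', z'}" using v unfolding eq by blast
    moreover have "u \<noteq> y'" "u \<noteq> z'"
      using u_in ls'(2)[of u] d'(5,6) by blast+
    ultimately have ne: "v \<noteq> xk" "v \<noteq> w'" "xk \<noteq> w'" "u \<noteq> y'" "u \<noteq> z'"
      using v xk d'(4) by auto
    have vz: "E v z'"
    proof (rule ccontr)
      assume n: "\<not> E v z'"
      show False
      proof (cases "E w' u")
        case True
        show False
          by (rule noF5[of v u y' w' z' xk])
            (use True nuw n vu vy xky Euxk d'(11,12) E_sym ne in auto)
      next
        case False
        show False
          by (rule noD[of v u y' xk z' w'])
            (use False n vu vy xky Euxk d'(11,12) E_sym in auto)
      qed
    qed
    moreover have "\<not> Ng v y'"
    proof
      assume N: "Ng v y'"
      show False
      proof (cases "E w' u")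
        case True
        show False
          by (rule noF4[of v y' xk z' w' u])
            (use True nuw N vz vu vy xky Euxk d'(11,12) d'(3) E_sym ne in auto)
      next
        case False
        show False
          by (rule noF5[of w' y' z' v u xk])
            (use False N vz vu vy xky Euxk d'(11,12) d'(3) E_sym ne in auto)
      qed
    qed
    ultimately show "E v z' \<and> \<not> Ng v y'" by blast
  qed
  show ?thesis
  proof (cases "E v w \<or> E v y \<or> E v z")
    \<comment> \<open>No head is seen. Cutting the path at the last neighbour \<open>a\<close> of
      \<open>v\<close> and putting \<open>v\<close> in front gives a tadpole with the same
      heads.\<close>
    case False
    then have "\<exists>a\<in>set p. E v a" using r by auto
    then obtain q a q' where p: "p = q @ a # q'" "E v a" "\<forall>b\<in>set q'. \<not> E v b"
      using split_list_last_prop[of p "E v"] by metis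
    have lst: "last (v # a # q') = last (x # p)" using p by simp
    have sub: "set (a # q') \<subseteq> set (x # p)" using p by auto
    have "ipl (v # a # q')" using d(2) p v by (auto simp: ipl_append)
    moreover have "b = last (butlast (v # a # q'))" if b: "b \<in> set (a # q')" "E b w" for b
    proof -
      have bl: "b = last (butlast (x # p))" using d(16) b sub by blast
      have "q' \<noteq> []"
      proof
        assume "q' = []"
        then have "b = last (x # p)" using b p by simp
        then show False using d(17) E_col b by blast
      qed
      then show ?thesis using bl p by (simp add: butlast_append)
    qed
    moreover have "v \<noteq> last (x # p)" using v xk by (auto simp: xk_def)
    moreover have "set (v # a # q') \<subseteq> insert v (set (x # p))" using sub by auto
    ultimately have "tad (v # a # q') w y z"
      using False v d(4-6) sub
      by (intro tadI; (unfold lst)?) (use d(3,7-12,15) in \<open>auto simp del: last.simps butlast.simps\<close>)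
    moreover have "set (a # q') \<union> {w, y, z} \<subseteq> set p \<union> {w, y, z}" using p by auto
    ultimately show ?thesis by blast
  next
    case vr: True
    show ?thesis
    proof (cases "c v = c w")
      case True
      have tz: "tad (x # p) w z y" using tad_swap[OF t] .
      have "\<not> E v w" using True E_col by blast
      then have yz': "E v y" "E v z" "\<not> Ng v y" "\<not> Ng v z"
        using vr yz[OF t _ _ True] yz[OF tz _ _ True] by auto
      have "ipl ((ls @ x # p) @ [y])"
        by (rule ipl_snocI) (use ls(2) nls d(5,7) xk lsd in \<open>auto simp: xk_def\<close>)
      then have q: "ipl (ls @ x # p @ [y])" by simp
      have ev: "E v a" if "a \<in> set (x # p)" "c a \<noteq> c v" for a
        by (rule fan_complete[OF q]) (use v ls yz' that in auto)
      have "\<not> Ng v a" if a: "a \<in> set (x # p)" "c a \<noteq> c v" for a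
      proof -
        obtain s1 t1 where st: "x # p = s1 @ a # t1" using a by (meson split_list)
        \<comment> \<open>By colour \<open>a\<close> is not \<open>xk\<close>, so at least one path
          vertex and then \<open>y\<close> follow it: the two vertices needed on the right.\<close>
        have "t1 \<noteq> []"
        proof
          assume "t1 = []"
          then have "a = xk" using arg_cong[OF st, of last] by (simp add: xk_def)
          then show False using a True d(17) by (simp add: xk_def)
        qed
        then have t2: "length (t1 @ [y]) \<ge> 2" by (cases t1) auto
        have eq: "(ls @ s1) @ a # t1 @ [y] = ls @ x # p @ [y]" using st by (metis append_Cons append_assoc)
        show ?thesis
          by (rule fan_positive[of "ls @ s1" a "t1 @ [y]"])
            (use q v ls yz' front[OF st] ev[OF a] t2 in \<open>auto simp: eq simp del: append_assoc\<close>)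
      qed
      then have ?pos using ev yz' True by auto
      then show ?thesis by blast
    next
      case False
      then have cv: "c v = c y" "c v = c z" using d(18,19) by auto
      then have vw: "E v w" using vr E_col[of v y] E_col[of v z] by auto
      have nvy: "\<not> E v y" "\<not> E v z" using cv E_col[of v y] E_col[of v z] by auto
      have cxk: "c xk \<noteq> c v" using d(17) False by (simp add: xk_def)
      have xkp: "xk \<in> set p" if "p \<noteq> []" using that by (simp add: xk_def)
      \<comment> \<open>If \<open>vw\<close> is negative, \<open>v\<close> followed by
        \<open>xk\<close> is the path of a type 2 tadpole with the old heads and chord
        \<open>vw\<close>. For \<open>p = []\<close> the vertex \<open>xk\<close> would be the old
        end \<open>x\<close>, which is excluded from the new tadpole; hence the exception.\<close>
      have tadN: ?tad if "E v xk" "Ng v w" "p \<noteq> []"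
      proof -
        have "tad [v, xk] w y z"
        proof (rule tadI)
          have 1: "Ng xk y" "Ng xk z" "E xk y" "E xk z" "xk \<noteq> w" "xk \<noteq> y" "xk \<noteq> z"
            using d(9,10,13,14) xk d(4-6) by (auto simp: xk_def simp del: last.simps)
          have 2: "\<not> E xk w" using d(17) E_col[of xk w] by (auto simp: xk_def simp del: last.simps)
          have 3: "v \<notin> {xk, w, y, z}" using v xk by auto
          show "ipl [v, xk]" using that 3 by simp
          show "w \<notin> set [v, xk]" "y \<notin> set [v, xk]" "z \<notin> set [v, xk]" using 1 3 by auto
          show "E a y \<longleftrightarrow> a = last [v, xk]" "E a z \<longleftrightarrow> a = last [v, xk]" if "a \<in> set [v, xk]" for a
            using that 1 3 nvy by auto
          show "Ng a w \<and> a = last (butlast [v, xk])" if "a \<in> set [v, xk]" "E a w" for a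
            using that 2 \<open>Ng v w\<close> by auto
        qed (use d(3,9-12) in \<open>simp_all add: xk_def del: last.simps, simp_all\<close>)
        then show ?thesis using xkp[OF that(3)] by (intro exI[of _ "[xk]"]) auto
      qed
      show ?thesis
      proof (cases "E u w")
        case True
        then have up: "u \<in> set (x # p)" "u \<noteq> xk" using u_in nls by auto
        then have Nuw: "Ng u w" using d(15) True by blast
        have pne: "p \<noteq> []" using up by (auto simp: xk_def)
        note sne = sne[OF pne]
        have ul: "u = last (butlast (x # p))" using d(16) up True by blast
        have w1: "E b w \<longleftrightarrow> b = u" if "b \<in> set (s @ [u])" for b
        proof -
          have "b \<in> set ls \<or> b \<in> set (x # p)" using that arg_cong[OF lsu, of set] by auto
          then show ?thesis using nls(1)[of b w] d(16)[of b] ul True by auto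
        qed
        have ips: "ipl (s @ [u])" using ls(2) unfolding lsu by (auto simp: ipl_append)
        have wns: "w \<notin> set (s @ [u])" using arg_cong[OF lsu, of set] nls(2) d(4) by auto
        \<comment> \<open>In type 2 the head \<open>w\<close> can follow \<open>u\<close> in place
          of \<open>xk\<close>, so the fan over \<open>s @ [u, w]\<close> covers the whole path
          except \<open>xk\<close>. The edge from \<open>v\<close> to \<open>xk\<close> is treated
          separately: \<open>D\<close> forces it and \<open>F\<^sub>5\<close> makes it
          positive.\<close>
        have q: "ipl (s @ [u, w])"
          using ips w1 wns ipl_snoc[of "s @ [u]" w] by simp
        have hds: "hd (s @ q) = hd ls" for q
          using arg_cong[OF lsu, of hd] sne ls(1) by simp
        have vns: "v \<notin> set (s @ [u, w])"
          using arg_cong[OF lsu, of set] v ls(4) by auto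
        have ev: "E v a" if "a \<in> set (s @ [u])" "c a \<noteq> c v" for a
          by (rule fan_complete[OF q]) (use vns vw ls hds that in auto)
        define u0 where "u0 = last s"
        have u0: "u0 \<in> set s" "E u0 u" using ips sne by (auto simp: u0_def ipl_append)
        have cu0: "c u0 \<noteq> c v" using u0 E_col cu cv by metis
        have vu0: "E v u0" using ev u0 cu0 by auto
        have nyu0: "\<not> E y u0"
        proof
          assume "E y u0"
          then have E0: "E u0 y" using E_sym by blast
          then have "u0 \<notin> set ls" using nls by blast
          moreover have "u0 \<in> set ls \<or> u0 \<in> set (x # p)" using u0 arg_cong[OF lsu, of set] by auto
          ultimately have "u0 = xk" using d(7) E0 by (auto simp: xk_def)
          then show False using u0 ipl_distinct[OF ls(2)] unfolding lsu by auto
        qed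
        have xky: "E y xk" "E y w" "E u w" "E u u0" using d(11,13) E_sym True u0 by (auto simp: xk_def)
        have vxk: "E v xk"
          by (rule ccontr, rule noD[of v u0 w u xk y]) (use vu0 vw xky Euxk Nuw nyu0 in auto)
        have nxk: "\<not> Ng v xk"
        proof
          assume "Ng v xk"
          show False
            by (rule noF5[of y xk w v u0 u])
              (use vu0 vw xky Euxk Nuw nyu0 vxk \<open>Ng v xk\<close> v up d(4) xk in auto)
        qed
        have pos: "\<not> Ng v a" if a: "a \<in> set (x # p)" "E v a" for a
        proof (cases "a = xk")
          case False
          obtain s1 t1 where st: "x # p = s1 @ a # t1" using a by (meson split_list)
          have "t1 \<noteq> []"
          proof
            assume "t1 = []"
            then have "a = xk" using arg_cong[OF st, of last] by (simp add: xk_def)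
            then show False using False by simp
          qed
          moreover have lst: "last t1 = xk" using arg_cong[OF st, of last] \<open>t1 \<noteq> []\<close> by (simp add: xk_def)
          ultimately have t1: "t1 = butlast t1 @ [xk]" by (metis append_butlast_last_id)
          have "(ls @ s1) @ a # butlast t1 @ [xk] = s @ [u, xk]" using lsu st t1 by simp
          then have e2: "(ls @ s1) @ a # butlast t1 = s @ [u]"
            by (metis append1_eq_conv append_Cons append_Nil append_assoc)
          have "butlast t1 \<noteq> []"
          proof
            assume "butlast t1 = []"
            then have "a = u" using e2 by simp
            then show False using a(2) E_col[of v u] cu cv by simp
          qed
          then have t2: "length (butlast t1 @ [w]) \<ge> 2" by (cases "butlast t1") auto
          have e3: "(ls @ s1) @ a # butlast t1 @ [w] = s @ [u, w]" using e2
            by (metis append_Cons append_Nil append_assoc)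
          show ?thesis
            by (rule fan_positive[of "ls @ s1" a "butlast t1 @ [w]"])
              (use q vns ls hds vw front[OF st a(2)] a t2 in \<open>auto simp: e3 simp del: append_assoc set_append\<close>)
        qed (use nxk in simp)
        have sub: "a \<in> set (s @ [u]) \<or> a = xk" if "a \<in> set (x # p)" for a
          using arg_cong[OF lsu, of set] that by auto
        show ?thesis
        proof (cases "Ng v w")
          case True
          then show ?thesis using tadN[OF vxk True pne] by blast
        next
          case False
          have ?pos
          proof (intro ballI impI)
            fix a assume a: "a \<in> insert x (set p \<union> {w, y, z})" "c a \<noteq> c v"
            then have "a = w \<or> a \<in> set (x # p)" using cv by auto
            moreover have "E v a" if "a \<in> set (x # p)" using sub[OF that] ev vxk a by blast
            ultimately show "E v a \<and> (\<not> Ng v a \<or> a = w \<and> p = [])" using False vw pos by blast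
          qed
          then show ?thesis by blast
        qed
      next
        case nuw: False
        have nw: "\<not> E a w" if "a \<in> set (x # p)" for a
        proof
          assume aw: "E a w"
          then have al: "a = last (butlast (x # p))" using d(16) that by blast
          have "p \<noteq> []"
          proof
            assume "p = []"
            then have "a = last (x # p)" using that by simp
            then show False using d(17) E_col aw by blast
          qed
          then have "a = u" using al by (simp add: u_def butlast_append)
          then show False using nuw aw by blast
        qed
        have q0: "ipl (ls @ x # p @ [y])"
        proof -
          have "ipl ((ls @ x # p) @ [y])"
            by (rule ipl_snocI) (use ls(2) nls d(5,7) xk lsd in \<open>auto simp: xk_def\<close>)
          then show ?thesis by simp
        qed
        \<comment> \<open>Without the chord the path continues through \<open>y\<close> and
          \<open>w\<close>. One fan then handles every path vertex, \<open>xk\<close> included, with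
          two vertices to its right.\<close>
        have q: "ipl (ls @ x # p @ [y, w])"
        proof -
          have "ipl ((ls @ x # p @ [y]) @ [w])"
            by (rule ipl_snocI) (use q0 nls d(4) nw d(11,19) E_sym in auto)
          then show ?thesis by simp
        qed
        have vn: "v \<notin> set (ls @ x # p @ [y, w])" using v ls by auto
        have ev: "E v a" if "a \<in> set (x # p)" "c a \<noteq> c v" for a
          by (rule fan_complete[OF q]) (use vn ls vw that in auto)
        have pos: "\<not> Ng v a" if a: "a \<in> set (x # p)" "E v a" for a
        proof -
          obtain s1 t1 where st: "x # p = s1 @ a # t1" using a by (meson split_list)
          have eq: "(ls @ s1) @ a # t1 @ [y, w] = ls @ x # p @ [y, w]"
            using st by (metis append_Cons append_assoc)
          show ?thesis
            by (rule fan_positive[of "ls @ s1" a "t1 @ [y, w]"])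
              (use q vn ls hdq vw front[OF st a(2)] a in \<open>auto simp: eq simp del: append_assoc set_append\<close>)
        qed
        have vxk: "E v xk" using ev xk cxk by blast
        show ?thesis
        proof (cases "Ng v w \<and> p \<noteq> []")
          case True
          then show ?thesis using tadN[OF vxk] by blast
        next
          case False
          have ?pos
          proof (intro ballI impI)
            fix a assume a: "a \<in> insert x (set p \<union> {w, y, z})" "c a \<noteq> c v"
            then have "a = w \<or> a \<in> set (x # p)" using cv by auto
            then show "E v a \<and> (\<not> Ng v a \<or> a = w \<and> p = [])" using False vw pos ev a by blast
          qed
          then show ?thesis by blast
        qed
      qed
    qed
  qed
qed

text \<open>The connecting path is now found inside a connected set \<open>C\<close> that touches
  \<open>v\<close> and \<open>x\<close> but has no edge to the rest of the tadpole.\<close>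

lemma tad_attach:
  assumes t: "tad (x # p) w y z" and C: "conn C" "a \<in> C" "E v a" "b \<in> C" "E x b"
    and nin: "x \<notin> C" "v \<notin> C" "v \<notin> insert x (set p \<union> {w, y, z})"
    and nC: "\<And>u r. u \<in> C \<Longrightarrow> r \<in> set p \<union> {w, y, z} \<Longrightarrow> \<not> E u r"
    and r: "r \<in> set p \<union> {w, y, z}" "E v r"
  shows "(\<exists>p' w' y' z'. tad (v # p') w' y' z' \<and> set p' \<union> {w', y', z'} \<subseteq> set p \<union> {w, y, z}) \<or>
    (\<forall>u\<in>insert x (set p \<union> {w, y, z}). c u \<noteq> c v \<longrightarrow> E v u \<and> (\<not> Ng v u \<or> u = w \<and> p = []))"
proof -
  obtain ls where ls: "ls \<noteq> []" "ipl ls" "set ls \<subseteq> C" "E v (hd ls)" "E x (last ls)"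
    "\<forall>u\<in>set (butlast ls). \<not> E x u"
    using conn_induced_path[of C a "E v" b "E x"] C by metis
  have CR: "C \<inter> (set p \<union> {w, y, z}) = {}"
  proof (rule ccontr)
    assume "\<not> ?thesis"
    then obtain u where u: "u \<in> C" "u \<in> set p \<union> {w, y, z}" by blast
    then obtain r where "r \<in> set p \<union> {w, y, z}" "E u r" using tad_nbr[OF t, of u] by auto
    then show False using nC u by blast
  qed
  have lx: "E u x \<longleftrightarrow> u = last ls" if "u \<in> set ls" for u
  proof -
    have "u \<in> set (butlast ls) \<or> u = last ls" 
      using that append_butlast_last_id[OF ls(1)] by (metis Un_iff empty_iff insert_iff list.set set_append)
    then show ?thesis using ls(5,6) E_comm[of x] by blast
  qed
  have ip: "ipl (ls @ x # p)"
    using ls(2,3) lx tadD(2)[OF t] nin CR nC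
    by (simp add: ipl_append) blast
  show ?thesis
  proof (rule tad_attach_path[OF t ls(1) ip ls(4)])
    show "v \<notin> set ls" using ls(3) nin by blast
    show "\<not> E e r" if "e \<in> set ls" "r \<in> {w, y, z}" for e r using that ls(3) nC by blast
    show "set ls \<inter> {w, y, z} = {}" using ls(3) CR by blast
  qed (use nin r in blast)+
qed

section \<open>Tadpoles across separations\<close>

definition tad_in :: "'v set \<Rightarrow> 'v set \<Rightarrow> bool" where
  "tad_in A S \<longleftrightarrow> (\<exists>x p w y z. x \<in> S \<and> tad (x # p) w y z \<and> set p \<union> {w, y, z} \<subseteq> A)"

lemma tad_inI: "x \<in> S \<Longrightarrow> tad (x # p) w y z \<Longrightarrow> set p \<union> {w, y, z} \<subseteq> A \<Longrightarrow> tad_in A S"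
  unfolding tad_in_def by blast

text \<open>If the end of the tadpole is not in \<open>S1\<close>, it has been absorbed into
  \<open>B1\<close> and is moved to \<open>S1\<close> along an induced path through
  \<open>A\<close>. That path sees nothing of the tadpole beyond its end, since \<open>A\<close> and
  \<open>B\<close> are not adjacent, and it has to meet \<open>S1\<close>, since \<open>A\<close>
  contains \<open>A1\<close>, which is disjoint from \<open>B1\<close>.\<close>

lemma tad_in_extend_sep:
  assumes s: "sep A S B" and s1: "sep A1 S1 B1" and sub: "A1 \<subseteq> A" "B \<subseteq> B1" and t: "tad_in B S"
  shows "tad_in B1 S1"
proof -
  note d = sepD[OF s] and d1 = sepD[OF s1]
  obtain x p w y z where x: "x \<in> S" "tad (x # p) w y z" "set p \<union> {w, y, z} \<subseteq> B"
    using t unfolding tad_in_def by blast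
  show ?thesis
  proof (cases "x \<in> S1")
    case True
    then show ?thesis using x sub unfolding tad_in_def by blast
  next
    case nx: False
    have "x \<in> nb B" using x d(7) by blast
    then obtain b where "b \<in> B" "E b x" unfolding nb_def by blast
    then have xB1: "x \<in> B1" using nx sub(2) d1(7) unfolding nb_def by blast
    have "x \<in> nb A" using x d(6) by blast
    then obtain a where a: "a \<in> A" "E a x" "x \<notin> A" unfolding nb_def by blast
    define C where "C = insert x A"
    have cC: "conn C" unfolding C_def using conn_insert[OF d(2) a(1,2)] .
    have "C \<inter> S1 \<noteq> {}"
    proof
      assume "C \<inter> S1 = {}"
      then have "C \<inter> nb B1 = {}" using d1(7) by blast
      then have "C \<subseteq> B1" using conn_subset[OF cC _ _ xB1] by (auto simp: C_def)
      moreover obtain a1 where "a1 \<in> A1" using d1(4) unfolding has_edge_def by blast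
      ultimately show False using sub d1(1) by (auto simp: C_def)
    qed
    then obtain v where v: "v \<in> C" "v \<in> S1" by blast
    obtain g where g: "g \<noteq> []" "ipl g" "set g \<subseteq> C" "hd g = x" "last g \<in> S1"
      "\<forall>u\<in>set (butlast g). u \<notin> S1"
      using conn_induced_path[where U = C and u = x and P = "\<lambda>u. u = x" and v = v and Q = "\<lambda>u. u \<in> S1"] cC v C_def
    by (metis insertI1)
    have gx: "g = x # tl g" using g(1,4) by (cases g) auto
    have tlA: "set (tl g) \<subseteq> A" using g(2,3) gx unfolding C_def by (metis insert_iff ipl.simps(2) set_tl_subset subset_iff)
    have bl: "butlast g \<noteq> []" using gx g(5) nx by (cases "tl g") auto
    then have xb: "x \<in> set (butlast g)" using gx by (metis butlast.simps(2) list.set_intros(1))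
    have gl: "g = butlast g @ [last g]" using g(1) by simp
    have ipb: "ipl (butlast g)" using g(2) gl ipl_append by metis
    have bB: "set (butlast g) \<subseteq> B1"
    proof (rule conn_subset[OF conn_ipl[OF ipb] _ xb xB1])
      show "set (butlast g) \<inter> nb B1 = {}" using g(6) d1(7) by blast
    qed
    have "tad (rev (tl g) @ x # p) w y z"
    proof (rule tad_extend[OF x(2)])
      show "ipl (rev (tl g) @ [x])" using ipl_rev[OF g(2)] gx by (metis rev.simps(2))
      show "\<not> E e r" if "e \<in> set (rev (tl g))" "r \<in> set p \<union> {w, y, z}" for e r
        using that tlA x(3) d(10) by (metis set_rev subset_iff)
    qed
    moreover have "rev (tl g) @ x # p = rev g @ p" using gx by (metis append_Cons append_Nil append_assoc rev.simps(2))
    moreover have "rev g @ p = last g # rev (butlast g) @ p" using gl by (metis append_Cons rev.simps(2) rev_append append_Nil rev_singleton_conv)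
    ultimately have "tad (last g # rev (butlast g) @ p) w y z" by simp
    then show ?thesis unfolding tad_in_def using g(5) bB x(3) sub(2)
      by (intro exI[of _ "last g"] exI[of _ "rev (butlast g) @ p"] exI[of _ w] exI[of _ y] exI[of _ z]) auto
  qed
qed

text \<open>Equal ends give a sum. Otherwise \<open>g\<close> runs from \<open>x1\<close> through
  \<open>B\<close> to the first vertex \<open>v\<close> that sees the second tadpole beyond its end.
  Then \<open>tad_attach\<close> is applied twice: to \<open>v\<close> and the second tadpole, and
  to \<open>x2\<close> and the first tadpole lengthened along \<open>g\<close> up to
  \<open>v\<close>. A new tadpole would give a sum in either case, so the other outcome holds twice,
  and this is a join with ends \<open>v\<close> and \<open>x2\<close>.\<close>

lemma sep_complete_not_both_tad_in:
  assumes s: "sep A S B" and compl: "\<And>s a. s \<in> S \<Longrightarrow> a \<in> A \<Longrightarrow> c s \<noteq> c a \<Longrightarrow> E s a"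
    and tA: "tad_in A S" and tB: "tad_in B S"
  shows False
proof -
  note d = sepD[OF s]
  obtain x1 p1 w1 y1 z1 where t1: "x1 \<in> S" "tad (x1 # p1) w1 y1 z1" "set p1 \<union> {w1, y1, z1} \<subseteq> A"
    using tA unfolding tad_in_def by blast
  obtain x2 p2 w2 y2 z2 where t2: "x2 \<in> S" "tad (x2 # p2) w2 y2 z2" "set p2 \<union> {w2, y2, z2} \<subseteq> B"
    using tB unfolding tad_in_def by blast
  define R1 where "R1 = set p1 \<union> {w1, y1, z1}"
  define R2 where "R2 = set p2 \<union> {w2, y2, z2}"
  have R1: "R1 \<subseteq> A" "w1 \<in> R1" "y1 \<in> R1" using t1 by (auto simp: R1_def)
  have R2: "R2 \<subseteq> B" "w2 \<in> R2" "y2 \<in> R2" using t2 by (auto simp: R2_def)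
  have nR: "\<not> E u u'" if "u \<in> R1" "u' \<in> R2" for u u' using that R1 R2 d(10) by blast
  have x1n: "x1 \<notin> A" "x1 \<notin> B" and x2n: "x2 \<notin> A" "x2 \<notin> B" using t1(1) t2(1) d(8,9) by blast+
  have ne: "x1 \<noteq> x2"
  proof
    assume eq: "x1 = x2"
    show False
      by (rule noS[OF t1(2) t2(2)[folded eq]]) (use nR in \<open>auto simp: R1_def R2_def\<close>)
  qed
  have R2n: "\<exists>r\<in>R2. E u r" if "u \<in> insert x2 R2" for u
    using tad_nbr[OF t2(2), of u] that by (auto simp: R2_def)
  have "x1 \<in> nb B" using t1 d(7) by blast
  then obtain b where b: "b \<in> B" "E b x1" unfolding nb_def by blast
  have cB: "conn (insert x1 B)" using conn_insert[OF d(3) b] .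
  obtain r0 where "w2 \<in> insert x1 B" "r0 \<in> R2" "E w2 r0" using R2n[of w2] R2 by auto
  then obtain g where g: "g \<noteq> []" "ipl g" "set g \<subseteq> insert x1 B" "hd g = x1" "\<exists>r\<in>R2. E (last g) r"
      "\<forall>u\<in>set (butlast g). \<not> (\<exists>r\<in>R2. E u r)"
    using conn_induced_path[where U = "insert x1 B" and u = x1 and P = "\<lambda>u. u = x1" and v = w2
      and Q = "\<lambda>u. \<exists>r\<in>R2. E u r"] cB by (metis insertI1)
  define v where "v = last g"
  define g' where "g' = butlast g"
  have gv: "g = g' @ [v]" using g(1) by (simp add: v_def g'_def)
  have gx: "g = x1 # tl g" using g(1,4) by (cases g) auto
  have g'n: "\<not> E u r" if "u \<in> set g'" "r \<in> R2" for u r using that g(6) by (auto simp: g'_def)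
  obtain rv where rv: "rv \<in> R2" "E v rv" using g(5) by (auto simp: v_def)
  have ipg': "ipl g'" using g(2) gv ipl_append by metis
  have tlB: "set (tl g) \<subseteq> B" using g(2,3) gx by (metis insert_iff ipl.simps(2) set_tl_subset subset_iff)
  have hdg': "g' \<noteq> [] \<Longrightarrow> hd g' = x1" using gv g(4) by auto
  have tlg': "g' \<noteq> [] \<Longrightarrow> tl g = tl g' @ [v]" using gv by simp
  have g'B: "set g' \<subseteq> insert x1 B" and vB: "v \<in> insert x1 B" using g(3) gv by auto
  have lg': "E (last g') v" if "g' \<noteq> []" using g(2) gv that by (auto simp: ipl_append)
  have vR2: "v \<notin> R2"
  proof
    assume vR: "v \<in> R2"
    then have "v \<noteq> x1" using x1n R2 by auto
    then have "g' \<noteq> []" using gv g(4) by auto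
    then show False using lg' g'n[of "last g'" v] vR by auto
  qed
  have vA: "v \<notin> A" using vB x1n d(1) by blast
  have vg': "v \<notin> set g'" using ipl_distinct[OF g(2)] gv by auto
  have x1A: "\<exists>a\<in>A. E x1 a" "\<exists>a\<in>A. E x2 a"
    using t1(1) t2(1) d(6) E_sym unfolding nb_def by blast+
  \<comment> \<open>The link between \<open>v\<close> and \<open>x2\<close> runs back along
    \<open>g'\<close> to \<open>x1\<close> and on through \<open>A\<close>, where nothing is
    adjacent to \<open>R2\<close>. If \<open>g'\<close> is empty, then
    \<open>v = x1\<close>.\<close>
  define C where "C = A \<union> set g'"
  have cC: "conn C"
  proof (cases "g' = []")
    case False
    obtain a where "a \<in> A" "E a x1" using x1A E_sym by blast
    then show ?thesis unfolding C_def
      using conn_Un[OF d(2) conn_ipl[OF ipg'], of a x1] hdg'[OF False] False hd_in_set[OF False] by auto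
  qed (use d(2) in \<open>simp add: C_def\<close>)
  have "\<exists>a\<in>C. E v a"
  proof (cases "g' = []")
    case True
    then have "v = x1" using gv g(4) by simp
    then show ?thesis using x1A by (auto simp: C_def)
  next
    case False
    then show ?thesis using lg' E_sym by (force simp: C_def)
  qed
  then obtain a where a: "a \<in> C" "E v a" by blast
  obtain a' where a': "a' \<in> C" "E x2 a'" using x1A by (auto simp: C_def)
  have nC: "\<not> E u r" if "u \<in> C" "r \<in> set p2 \<union> {w2, y2, z2}" for u r
    using that g'n[of u r] R2 d(10)[of u r] by (auto simp: C_def R2_def)
  have x2g': "x2 \<notin> set g" using g(3) x2n ne by auto
  have posv: "\<forall>u\<in>insert x2 R2. c u \<noteq> c v \<longrightarrow> E v u \<and> (\<not> Ng v u \<or> u = w2 \<and> p2 = [])"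
  proof (rule ccontr)
    assume np: "\<not> ?thesis"
    have "v \<notin> insert x2 (set p2 \<union> {w2, y2, z2})" using vR2 x2g' gv by (auto simp: R2_def)
    moreover have "x2 \<notin> C" "v \<notin> C" using x2n x2g' gv vA vg' by (auto simp: C_def)
    ultimately obtain q w y z where q: "tad (v # q) w y z" "set q \<union> {w, y, z} \<subseteq> R2"
      using tad_attach[OF t2(2) cC a a' _ _ _ nC rv(1)[unfolded R2_def] rv(2)] np
      unfolding R2_def by blast
    have "tad (g' @ v # q) w y z"
    proof (rule tad_extend[OF q(1)])
      show "ipl (g' @ [v])" using g(2) gv by simp
    qed (use g'n q(2) in blast)
    moreover have "g' @ v # q = x1 # tl g @ q" using gx gv by (metis append_Cons append_Nil append_assoc)
    ultimately have t: "tad (x1 # tl g @ q) w y z" by simp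
    show False
    proof (rule noS[OF t1(2) t])
      fix u u' assume "u \<in> set p1 \<union> {w1, y1, z1}" "u' \<in> set (tl g @ q) \<union> {w, y, z}"
      then have "u \<in> A" "u' \<in> B" using t1(3) tlB q(2) R2 by auto
      then show "\<not> E u u'" using d(10) by blast
    qed
  qed
  have "tad (rev (tl g) @ x1 # p1) w1 y1 z1"
  proof (rule tad_extend[OF t1(2)])
    show "ipl (rev (tl g) @ [x1])" using ipl_rev[OF g(2)] gx by (metis rev.simps(2))
    show "\<not> E e r" if "e \<in> set (rev (tl g))" "r \<in> set p1 \<union> {w1, y1, z1}" for e r
      using that tlB t1(3) d(11) by (metis set_rev subset_iff)
  qed
  moreover have "rev (tl g) @ x1 # p1 = rev g @ p1" using gx by (metis append_Cons append_Nil append_assoc rev.simps(2))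
  moreover have "rev g @ p1 = v # rev g' @ p1" using gv by simp
  ultimately have t1': "tad (v # rev g' @ p1) w1 y1 z1" by simp
  have R1': "set (rev g' @ p1) \<union> {w1, y1, z1} = set g' \<union> R1" by (auto simp: R1_def)
  have nR': "\<not> E u u'" if "u \<in> set g' \<union> R1" "u' \<in> R2" for u u' using that nR g'n by blast
  obtain r2 where r2: "r2 \<in> R2" "E x2 r2" using R2n by blast
  \<comment> \<open>Completeness of \<open>S\<close> to \<open>A\<close> enters here:
    \<open>w1\<close> and \<open>y1\<close> have different colours, so \<open>x2\<close> sees one of
    them.\<close>
  have "\<exists>r\<in>{w1, y1}. c r \<noteq> c x2" using tadD(19)[OF t1(2)] by auto
  then obtain r1 where r1: "r1 \<in> R1" "E x2 r1" using compl[of x2] t2(1) R1 E_col by (metis insert_iff singletonD subset_iff)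
  have x2R1: "x2 \<notin> insert v (set g' \<union> R1)" using x2g' gv x2n R1 by auto
  have "(\<exists>p' w' y' z'. tad (x2 # p') w' y' z' \<and> set p' \<union> {w', y', z'} \<subseteq> set (rev g' @ p1) \<union> {w1, y1, z1}) \<or>
    (\<forall>u\<in>insert v (set (rev g' @ p1) \<union> {w1, y1, z1}). c u \<noteq> c x2 \<longrightarrow> E x2 u \<and> (\<not> Ng x2 u \<or> u = w1 \<and> rev g' @ p1 = []))"
  \<comment> \<open>This time the connected set linking \<open>x2\<close> to the end
    \<open>v\<close> is the second tadpole without its end.\<close>
  proof (rule tad_attach[OF t1', of R2 r2 x2 rv r1])
    show "conn R2" using tad_conn(1)[OF t2(2)] by (simp add: R2_def)
    show "x2 \<notin> R2" using R2 x2n by blast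
    show "x2 \<notin> insert v (set (rev g' @ p1) \<union> {w1, y1, z1})" unfolding R1' by (rule x2R1)
    show "r1 \<in> set (rev g' @ p1) \<union> {w1, y1, z1}" unfolding R1' using r1 by blast
    show "\<not> E u r" if "u \<in> R2" "r \<in> set (rev g' @ p1) \<union> {w1, y1, z1}" for u r
      using that nR' E_sym unfolding R1' by blast
  qed (use r1 r2 rv vR2 in blast)+
  then show False
  proof
    assume "\<exists>p' w' y' z'. tad (x2 # p') w' y' z' \<and> set p' \<union> {w', y', z'} \<subseteq> set (rev g' @ p1) \<union> {w1, y1, z1}"
    then obtain q w y z where q: "tad (x2 # q) w y z" "set q \<union> {w, y, z} \<subseteq> set g' \<union> R1"
      unfolding R1' by blast
    show False
      by (rule noS[OF q(1) t2(2)]) (use q(2) nR' in \<open>unfold R2_def[symmetric], blast\<close>)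
  next
    assume pos: "\<forall>u\<in>insert v (set (rev g' @ p1) \<union> {w1, y1, z1}). c u \<noteq> c x2 \<longrightarrow> E x2 u \<and> (\<not> Ng x2 u \<or> u = w1 \<and> rev g' @ p1 = [])"
    show False
    proof (rule noJ[OF t1' t2(2)])
      show "v \<noteq> x2" "x2 \<notin> set (rev g' @ p1) \<union> {w1, y1, z1}" using x2R1 unfolding R1' by blast+
      show "v \<notin> set p2 \<union> {w2, y2, z2}" using vR2 by (simp add: R2_def)
      show "\<not> E u u'" if "u \<in> set (rev g' @ p1) \<union> {w1, y1, z1}" "u' \<in> set p2 \<union> {w2, y2, z2}" for u u'
        using that nR' unfolding R1' R2_def by blast
      show "E v u \<and> (\<not> Ng v u \<or> u = w2 \<and> p2 = [])" if "u \<in> insert x2 (set p2 \<union> {w2, y2, z2})" "c u \<noteq> c v" for u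
        using that posv unfolding R2_def by blast
      show "E x2 u \<and> (\<not> Ng x2 u \<or> u = w1 \<and> rev g' @ p1 = [])" if "u \<in> insert v (set (rev g' @ p1) \<union> {w1, y1, z1})" "c u \<noteq> c x2" for u
        using that pos by blast
    qed
  qed
qed

end

subsection \<open>Chain graphs\<close>

text \<open>A \<open>2K\<^sub>2\<close>-free bipartite graph on \<open>A\<close> is described by levels: opposite vertices are adjacent iff
  their levels add up to at most \<open>r + 1\<close>. Vertices of the separator \<open>S\<close> get level \<open>0\<close>. For
  \<open>i + j = r + 1\<close>, the vertices of level at most \<open>i\<close> on one side and at most \<open>j\<close> on the other form
  a maximal biclique.\<close>
locale chain_config = sbg_free V E Ng c
  for V :: "'v set" and E Ng :: "'v \<Rightarrow> 'v \<Rightarrow> bool" and c :: "'v \<Rightarrow> bool" +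
  fixes A S :: "'v set" and l :: "'v \<Rightarrow> nat" and r :: nat
  assumes lev: "\<lbrakk>u \<in> A \<union> S; v \<in> A \<union> S; c u \<noteq> c v\<rbrakk> \<Longrightarrow> E u v \<longleftrightarrow> l u + l v \<le> r + 1"
    and lS: "s \<in> S \<Longrightarrow> l s = 0"
    and lA: "a \<in> A \<Longrightarrow> 1 \<le> l a \<and> l a \<le> r"
    and ex_level: "\<lbrakk>1 \<le> i; i \<le> r\<rbrakk> \<Longrightarrow> \<exists>a\<in>A. c a = k \<and> l a = i"
    and r1: "1 \<le> r"
    and posS: "\<lbrakk>s \<in> S; t \<in> S\<rbrakk> \<Longrightarrow> \<not> Ng s t"
    and common: "\<lbrakk>s \<in> S; t \<in> S; c s = c t\<rbrakk> \<Longrightarrow> \<exists>b. E s b \<and> E t b \<and> (\<forall>a\<in>A. \<not> E a b)"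
    and nosimp: "\<lbrakk>p \<in> A; q \<in> A; E p q\<rbrakk> \<Longrightarrow> \<exists>a b. a \<noteq> p \<and> b \<noteq> q \<and> E p b \<and> E q a \<and> (\<not> E a b \<or> Ng a b)"
    and nbA: "\<lbrakk>a \<in> A; E a v\<rbrakk> \<Longrightarrow> v \<in> A \<union> S"
    and noT1: "\<lbrakk>x \<in> S; y \<in> A; z \<in> A; w \<in> A; y \<noteq> z; Ng x y; Ng x z; E w y; E w z\<rbrakk> \<Longrightarrow> False"
    and noT2: "\<lbrakk>x \<in> S; h \<in> A; y \<in> A; z \<in> A; w \<in> A; h \<noteq> w; y \<noteq> z; Ng x w; Ng h y; Ng h z; E w y; E w z\<rbrakk>
      \<Longrightarrow> False"
begin

text \<open>Negative edges of the maximal biclique with level bounds \<open>i\<close> and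
  \<open>j\<close>, read with \<open>a\<close> on the \<open>i\<close>-side. Which colour is on
  which side stays open, so that each fact serves both.\<close>

definition NN :: "nat \<Rightarrow> nat \<Rightarrow> 'v \<Rightarrow> 'v \<Rightarrow> bool" where
  "NN i j a b \<longleftrightarrow> Ng a b \<and> a \<in> A \<union> S \<and> b \<in> A \<union> S \<and> l a \<le> i \<and> l b \<le> j"

lemma NN_sym: "NN i j a b \<longleftrightarrow> NN j i b a"
  using Ng_sym by (auto simp: NN_def)

lemma NN_col: "NN i j a b \<Longrightarrow> c a \<noteq> c b"
  using Ng_E E_col by (auto simp: NN_def)

lemma NN_cross:
  assumes "NN i j a b" "NN i j a' b'" "i + j = r + 1" "c a = c a'"
  shows "E a b'" "E b' a" "E a b" "E b a"
proof -
  have "c a \<noteq> c b'" using NN_col[OF assms(2)] assms(4) by simp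
  then show "E a b'" using assms lev[of a b'] by (auto simp: NN_def)
  then show "E b' a" by (rule E_sym)
  show "E a b" using assms Ng_E by (auto simp: NN_def)
  then show "E b a" by (rule E_sym)
qed

lemma in_S_iff: "u \<in> A \<union> S \<Longrightarrow> u \<in> S \<longleftrightarrow> l u = 0"
  using lA lS by fastforce

lemma in_A_iff: "u \<in> A \<union> S \<Longrightarrow> u \<in> A \<longleftrightarrow> 1 \<le> l u"
  using lA lS by fastforce

text \<open>Otherwise a vertex \<open>a1\<close> of level \<open>i\<close>, together with a vertex
  \<open>b3\<close> seen by \<open>a\<close> and \<open>a'\<close> but not by \<open>a1\<close>,
  completes the two negative edges to \<open>F\<^sub>5\<close>. If \<open>m\<close> is the larger of
  the two levels, \<open>b3\<close> has level \<open>r + 1 - m\<close>. If both levels are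
  \<open>0\<close>, then \<open>a\<close> and \<open>a'\<close> lie in \<open>S\<close>, and
  \<open>b3\<close> is a common neighbour that sees nothing of \<open>A\<close>.\<close>

lemma disjoint_max_level:
  assumes ij: "i + j = r + 1" "1 \<le> i" "1 \<le> j" and N: "NN i j a b" "NN i j a' b'"
    and ne: "c a = c a'" "a \<noteq> a'" "b \<noteq> b'"
  shows "l a = i \<or> l a' = i"
proof (rule ccontr)
  assume "\<not> ?thesis"
  then have lt: "l a < i" "l a' < i" using N by (auto simp: NN_def)
  note Nd = N[unfolded NN_def]
  have col: "c a \<noteq> c b" "c b' = c b" using NN_col N ne by auto
  have "i \<le> r" using ij by simp
  then obtain a1 where a1: "a1 \<in> A" "c a1 = c a" "l a1 = i" using ex_level ij by blast
  have e1: "E a1 b" "E a1 b'" using lev[of a1 b] lev[of a1 b'] a1 Nd ij col by auto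
  have e2: "E a b'" "E a' b"
    using NN_cross[OF N ij(1) ne(1)] NN_cross[OF N(2,1) ij(1) ne(1)[symmetric]] by auto
  have "\<exists>b3. E a b3 \<and> E a' b3 \<and> \<not> E a1 b3"
  proof (cases "l a = 0 \<and> l a' = 0")
    case True
    then have "a \<in> S" "a' \<in> S" using in_S_iff Nd by auto
    then show ?thesis using common[of a a'] ne a1 by blast
  next
    case False
    define m where "m = max (l a) (l a')"
    have m: "1 \<le> m" "m < i" "l a \<le> m" "l a' \<le> m" using False lt by (auto simp: m_def)
    then have "1 \<le> r + 1 - m" "r + 1 - m \<le> r" using ij by auto
    then obtain b3 where b3: "b3 \<in> A" "c b3 = c b" "l b3 = r + 1 - m"
      using ex_level by blast
    then have "E a b3" "E a' b3" "\<not> E a1 b3"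
      using lev[of a b3] lev[of a' b3] lev[of a1 b3] Nd a1 m ij col ne by auto
    then show ?thesis by blast
  qed
  then show False
    using noF5[OF e1, of a _ a'] e2 Nd ne by blast
qed

lemma disjoint_levels:
  assumes ij: "i + j = r + 1" "1 \<le> i" "1 \<le> j" and N: "NN i j a b" "NN i j a' b'"
    and ne: "c a = c a'" "a \<noteq> a'" "b \<noteq> b'"
  shows "(l a = i \<or> l a' = i) \<and> (l b = j \<or> l b' = j)"
proof
  show "l a = i \<or> l a' = i" using disjoint_max_level assms by blast
  have "c b = c b'" using NN_col N ne by blast
  moreover have "j + i = r + 1" using ij by simp
  ultimately show "l b = j \<or> l b' = j"
    using disjoint_max_level[of j i b a b' a'] N ij ne NN_sym by blast
qed

text \<open>At a corner \<open>p\<close>, \<open>q\<close> of the biclique the neighbours of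
  \<open>p\<close> and of \<open>q\<close> are exactly its two sides. The witness against
  simpliciality of \<open>pq\<close> can then not be a non-edge, so it is a negative edge of the
  biclique that misses both corners.\<close>

lemma avoiding_negative_edge:
  assumes ij: "i + j = r + 1" and p: "p \<in> A" "l p = i" and q: "q \<in> A" "l q = j" and col: "c p \<noteq> c q"
  obtains a b where "NN i j a b" "c a = c p" "c b = c q" "a \<noteq> p" "b \<noteq> q"
proof -
  have "E p q" using lev[of p q] assms by auto
  then obtain a b where ab: "a \<noteq> p" "b \<noteq> q" "E p b" "E q a" "\<not> E a b \<or> Ng a b"
    using nosimp p q by metis
  have U: "a \<in> A \<union> S" "b \<in> A \<union> S" using nbA p q ab by blast+
  have cc: "c a = c p" "c b = c q" using ab(3,4)[THEN E_col] col by auto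
  have le: "l a \<le> i" "l b \<le> j" using lev[of p b] lev[of q a] U ab p q ij cc col by auto
  then have "E a b" using lev[of a b] U cc col ij by auto
  then have "NN i j a b" using ab U le by (auto simp: NN_def)
  then show thesis using that cc ab by blast
qed

text \<open>All edges across a maximal biclique are present with some sign, so three disjoint
  negative ones are \<open>F\<^sub>4\<close>. In the same way two disjoint negative cherries are
  \<open>F\<^sub>3\<close> and a negative path on five vertices is \<open>F\<^sub>2\<close>.\<close>

lemma no_negative_3_matching:
  assumes ij: "i + j = r + 1"
    and N: "NN i j a1 b1" "NN i j a2 b2" "NN i j a3 b3" and "c a1 = c a2" "c a1 = c a3"
    and "distinct [a1, a2, a3]" "distinct [b1, b2, b3]"
  shows False
  by (rule noF4[of a1 b1 a2 b2 a3 b3])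
    (use assms N[unfolded NN_def] NN_cross[OF N(1,2) ij] NN_cross[OF N(1,3) ij] NN_cross[OF N(2,1) ij]
      NN_cross[OF N(2,3) ij] NN_cross[OF N(3,1) ij] NN_cross[OF N(3,2) ij] in auto)

lemma no_two_negative_cherries:
  assumes ij: "i + j = r + 1"
    and N: "NN i j a1 b1" "NN i j a1 b2" "NN i j a2 b3" "NN i j a2 b4" and "c a1 = c a2"
    and "a1 \<noteq> a2" "distinct [b1, b2, b3, b4]"
  shows False
  by (rule noF3[of a1 b1 b2 a2 b3 b4])
    (use assms N[unfolded NN_def] NN_cross[OF N(1,3) ij] NN_cross[OF N(1,4) ij] NN_cross[OF N(3,1) ij]
      NN_cross[OF N(3,2) ij] in auto)

lemma no_negative_path5:
  assumes ij: "i + j = r + 1"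
    and N: "NN i j a1 b1" "NN i j a1 b2" "NN i j a2 b2" "NN i j a2 b3" and "c a1 = c a2"
    and "a1 \<noteq> a2" "distinct [b1, b2, b3]"
  shows False
  by (rule noF2[of a1 b1 b2 a2 b3])
    (use assms N[unfolded NN_def] NN_cross[OF N(1,4) ij] NN_cross[OF N(3,1) ij] in auto)

text \<open>A vertex of \<open>S\<close> with two negative edges into \<open>A\<close> is the end of
  a shortest tadpole of type 1. For \<open>a\<close> in \<open>A\<close> with both edges slack,
  \<open>disjoint_levels\<close> pushes the other end of every negative edge of the biclique
  avoiding \<open>a\<close> to level \<open>j\<close>. Two such edges with distinct ends of level
  \<open>j\<close> exist. With the cherry at \<open>a\<close> they form two disjoint cherries if
  they meet, and a matching of size three otherwise.\<close>

lemma negative_cherry: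
  assumes N: "Ng a b" "Ng a b'" and ne: "b \<noteq> b'" and U: "a \<in> A \<union> S" "b \<in> A \<union> S" "b' \<in> A \<union> S"
  shows "a \<in> A \<and> (l a + l b = r + 1 \<or> l a + l b' = r + 1)"
proof -
  have E: "E a b" "E a b'" using N Ng_E by auto
  have col: "c a \<noteq> c b" "c b' = c b" using E[THEN E_col] by auto
  have aA: "a \<in> A"
  proof (rule ccontr)
    assume "a \<notin> A"
    then have aS: "a \<in> S" using U by blast
    then have bA: "b \<in> A" "b' \<in> A" using U posS N by blast+
    \<comment> \<open>A vertex of level \<open>1\<close> sees all opposite vertices of
      \<open>A\<close>, so it can serve as the head.\<close>
    obtain w where w: "w \<in> A" "c w = c a" "l w = 1" using ex_level[of 1] r1 by blast
    then have "E w b" "E w b'" using lev[of w b] lev[of w b'] U col lA bA by fastforce+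
    then show False using noT1[OF aS bA w(1) ne N] by blast
  qed
  have le: "l a + l b \<le> r + 1" "l a + l b' \<le> r + 1" using lev[of a b] lev[of a b'] U E col by auto
  have "l a + l b = r + 1 \<or> l a + l b' = r + 1"
  proof (rule ccontr)
    assume nn: "\<not> ?thesis"
    define i j where "i = l a" and "j = r + 1 - l a"
    have ij: "i + j = r + 1" "1 \<le> i" "1 \<le> j" using lA[OF aA] by (auto simp: i_def j_def)
    have lt: "l b < j" "l b' < j" using nn le by (auto simp: j_def)
    have Nab: "NN i j a b" "NN i j a b'" using N U lt by (auto simp: NN_def i_def)
    have lv: "l d = j" if d: "NN i j a1 d" "c a1 = c a" "a1 \<noteq> a" for a1 d
    proof -
      have "(d \<noteq> b \<and> (l d = j \<or> l b = j)) \<or> (d \<noteq> b' \<and> (l d = j \<or> l b' = j))"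
        using disjoint_levels[OF ij d(1) Nab(1)] disjoint_levels[OF ij d(1) Nab(2)] d ne by blast
      then show ?thesis using lt by auto
    qed
    obtain q where q: "q \<in> A" "c q = c b" "l q = j" using ex_level[of j] ij by auto
    obtain a1 d1 where d1: "NN i j a1 d1" "c a1 = c a" "c d1 = c b" "a1 \<noteq> a"
      using avoiding_negative_edge[OF ij(1) aA _ q(1,3)] q(2) col i_def by metis
    have l1: "l d1 = j" using lv d1 by blast
    then have dA: "d1 \<in> A" using in_A_iff d1(1) ij by (auto simp: NN_def)
    obtain a2 d2 where d2: "NN i j a2 d2" "c a2 = c a" "a2 \<noteq> a" "d2 \<noteq> d1"
      using avoiding_negative_edge[OF ij(1) aA _ dA l1] d1(3) col i_def by metis
    have l2: "l d2 = j" using lv d2 by blast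
    have dne: "b \<noteq> d1" "b \<noteq> d2" "b' \<noteq> d1" "b' \<noteq> d2" using l1 l2 lt by auto
    show False
    proof (cases "a1 = a2")
      case True
      show False
        by (rule no_two_negative_cherries[OF ij(1) Nab d1(1) d2(1)[folded True]])
          (use d1 d2 dne ne in auto)
    next
      case False
      show False
        by (rule no_negative_3_matching[OF ij(1) Nab(1) d1(1) d2(1)]) (use d1 d2 dne False in auto)
    qed
  qed
  then show ?thesis using aA by blast
qed

text \<open>Since \<open>a'\<close> is below level \<open>i\<close>, each negative edge missing
  \<open>b\<close> has its end on the side of \<open>a'\<close> at level \<open>i\<close>, and that
  end is not \<open>a'\<close>. Two such edges with distinct ends \<open>a1\<close>,
  \<open>a2\<close> must meet in a common \<open>b1\<close>, or they form with \<open>a'b\<close> a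
  negative matching of size three.\<close>

lemma negative_cherry_across:
  assumes ij: "i + j = r + 1" "1 \<le> i" and N: "NN i j a' b" and b: "b \<in> A" "l b = j" and lt: "l a' < i"
  obtains b1 a1 a2 where "NN i j a1 b1" "NN i j a2 b1" "a1 \<noteq> a2" "b1 \<noteq> b" "l b1 = j" "l a1 = i" "l a2 = i"
    "c a1 = c a'" "c a2 = c a'" "b1 \<in> A"
proof -
  have j: "1 \<le> j" using lA[OF b(1)] b(2) by simp
  note ij' = ij j
  have col: "c a' \<noteq> c b" using NN_col[OF N] .
  have lev1: "l a1 = i \<and> a1 \<noteq> a'" if n: "NN i j a1 b1" "c a1 = c a'" "b1 \<noteq> b" for a1 b1
  proof -
    have "a1 \<noteq> a'"
    proof
      assume "a1 = a'"
      then have "l a' + l b = r + 1 \<or> l a' + l b1 = r + 1"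
        using negative_cherry[of a' b b1] N n by (auto simp: NN_def)
      then show False using lt ij n b by (auto simp: NN_def)
    qed
    then show ?thesis using disjoint_levels[OF ij' n(1) N] n lt by auto
  qed
  obtain p where p: "p \<in> A" "c p = c a'" "l p = i" using ex_level[of i] ij' by auto
  obtain a1 b1 where 1: "NN i j a1 b1" "c a1 = c a'" "c b1 = c b" "b1 \<noteq> b"
    using avoiding_negative_edge[OF ij(1) p(1,3) b] p(2) col by metis
  have l1: "l a1 = i" "a1 \<noteq> a'" using lev1 1 by auto
  then have a1: "a1 \<in> A" using in_A_iff[of a1] 1 ij by (auto simp: NN_def)
  obtain a2 b2 where 2: "NN i j a2 b2" "c a2 = c a'" "b2 \<noteq> b" "a2 \<noteq> a1"
    using avoiding_negative_edge[OF ij(1) a1 l1(1) b] 1(2) col by metis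
  have l2: "l a2 = i" "a2 \<noteq> a'" using lev1 2 by auto
  have eq: "b1 = b2"
  proof (rule ccontr)
    assume "b1 \<noteq> b2"
    then have "distinct [b, b1, b2]" "distinct [a', a1, a2]" using 1(4) 2(3,4) l1(2) l2(2) by auto
    then show False
      by (rule no_negative_3_matching[OF ij(1) N 1(1) 2(1) 1(2)[symmetric] 2(2)[symmetric], rotated])
  qed
  have Nb: "Ng b1 a1" "Ng b1 a2" "b1 \<in> A \<union> S" "a1 \<in> A \<union> S" "a2 \<in> A \<union> S"
    using 1 2 eq Ng_sym by (auto simp: NN_def)
  have "b1 \<in> A" "l b1 = j"
    using negative_cherry[OF Nb(1,2) _ Nb(3-5)] 2(4) l1 l2 ij by auto
  then show thesis using that 1 2 eq l1 l2 by blast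
qed

text \<open>For a slack negative edge \<open>ab\<close> with \<open>a\<close> in \<open>A\<close>,
  \<open>half\<close> finds a second vertex \<open>h\<close> at the level of \<open>a\<close>
  carrying two negative edges. If \<open>b\<close> lies in \<open>S\<close>, then \<open>b\<close>,
  \<open>h\<close>, \<open>a\<close> and the two leaves are the shortest tadpole of type 2, with
  \<open>a\<close> as head \<open>w\<close>. If both ends lie in \<open>A\<close>,
  \<open>half\<close> at either end gives \<open>F\<^sub>6\<close>; the slack is exactly what makes
  the leaves of one cherry non-adjacent to those of the other.\<close>

lemma negative_edge_level:
  assumes N: "Ng a b" and U: "a \<in> A \<union> S" "b \<in> A \<union> S"
  shows "l a + l b = r + 1"
proof (rule ccontr)
  assume ne: "\<not> ?thesis"
  have Eab: "E a b" and Nba: "Ng b a" using N Ng_E Ng_sym by auto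
  have col: "c a \<noteq> c b" using E_col[OF Eab] .
  have lt: "l a + l b < r + 1" using lev[OF U col] Eab ne by simp
  have half: "\<exists>h y z. h \<in> A \<and> h \<noteq> a \<and> c h = c a \<and> l h = l a \<and> Ng h y \<and> Ng h z \<and> y \<noteq> z \<and> y \<in> A \<and> z \<in> A \<and>
      c y = c b \<and> c z = c b \<and> l y + l a = r + 1 \<and> l z + l a = r + 1"
    if N: "Ng a b" "a \<in> A" "b \<in> A \<union> S" and lt: "l a + l b < r + 1" for a b
  proof -
    define i where "i = r + 1 - l a"
    have ij: "i + l a = r + 1" "1 \<le> i" using lA[OF N(2)] by (auto simp: i_def)
    have NN: "NN i (l a) b a" using N lt Ng_sym by (auto simp: NN_def i_def)
    have "l b < i" using lt by (auto simp: i_def)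
    from negative_cherry_across[OF ij NN N(2) refl this]
    obtain h y z where h: "NN i (l a) y h" "NN i (l a) z h" "y \<noteq> z" "h \<noteq> a" "l h = l a" "l y = i" "l z = i"
      "c y = c b" "c z = c b" "h \<in> A" by metis
    have "c a \<noteq> c b" using N Ng_E E_col by blast
    then have "c h = c a" using NN_col[OF h(1)] h(8) by auto
    moreover have "y \<in> A" "z \<in> A" using h in_A_iff[of y] in_A_iff[of z] ij by (auto simp: NN_def)
    moreover have "Ng h y" "Ng h z" using h Ng_sym by (auto simp: NN_def)
    ultimately show ?thesis using h ij by (intro exI[of _ h] exI[of _ y] exI[of _ z]) auto
  qed
  have T2: False if N: "Ng a b" "a \<in> A" "b \<in> S" and lt: "l a + l b < r + 1" for a b
  proof -
    obtain h y z where h: "h \<in> A" "h \<noteq> a" "c h = c a" "l h = l a" "Ng h y" "Ng h z" "y \<noteq> z" "y \<in> A" "z \<in> A"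
      "c y = c b" "c z = c b" "l y + l a = r + 1" "l z + l a = r + 1"
      using half[OF N(1,2) _ lt] N(3) by blast
    have "c a \<noteq> c b" using N Ng_E E_col by blast
    then have "E a y" "E a z" using lev[of a y] lev[of a z] h N by auto
    then show False using noT2[OF N(3) h(1,8,9) N(2) h(2,7)] N h Ng_sym by blast
  qed
  have "a \<in> A \<or> b \<in> A" using posS U N by blast
  moreover have lt': "l b + l a < r + 1" using lt by simp
  ultimately have A: "a \<in> A" "b \<in> A" using T2[OF N _ _ lt] T2[OF Nba _ _ lt'] U by blast+
  obtain h y z where h: "h \<in> A" "h \<noteq> a" "c h = c a" "l h = l a" "Ng h y" "Ng h z" "y \<noteq> z" "y \<in> A" "z \<in> A"
      "c y = c b" "c z = c b" "l y + l a = r + 1" "l z + l a = r + 1"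
    using half[OF N A(1) U(2) lt] by blast
  obtain k u v where k: "k \<in> A" "k \<noteq> b" "c k = c b" "l k = l b" "Ng k u" "Ng k v" "u \<noteq> v" "u \<in> A" "v \<in> A"
      "c u = c a" "c v = c a" "l u + l b = r + 1" "l v + l b = r + 1"
    using half[OF Nba A(2) U(1) lt'] by blast
  show False
  proof (rule noF6[of u k b v a y z h])
    show "E u b" "E v b" "E a k" "E a y" "E a z" "E h k" "E h b" "\<not> E u y" "\<not> E u z" "\<not> E v y" "\<not> E v z"
      using lev[of u b] lev[of v b] lev[of a k] lev[of a y] lev[of a z] lev[of h k] lev[of h b]
        lev[of u y] lev[of u z] lev[of v y] lev[of v z] h k A col lt by auto
  qed (use h k N Ng_sym in auto)
qed

text \<open>With all negative edges tight, those of one biclique run between two fixed levels, and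
  no choice of one vertex from each side meets them all. There is no negative matching of size
  three, so by Koenig two vertices cover these edges; they must be on the same side and each must
  have two negative edges. Such stars contain a negative \<open>K_{2,2}\<close>, a negative path on
  five vertices or two disjoint cherries, which are \<open>F\<^sub>1\<close>,
  \<open>F\<^sub>2\<close> and \<open>F\<^sub>3\<close>. The case distinction unrolls this
  argument.\<close>

lemma contradictory: False
proof -
  define i j where "i = (1::nat)" and "j = r"
  have ij: "i + j = r + 1" "1 \<le> i" "1 \<le> j" using r1 by (auto simp: i_def j_def)
  have full: "l a = i \<and> l b = j \<and> a \<in> A \<and> b \<in> A" if "NN i j a b" for a b
  proof -
    have "l a + l b = r + 1" using negative_edge_level[of a b] that by (auto simp: NN_def)
    then have "l a = i" "l b = j" using that ij by (auto simp: NN_def)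
    then show ?thesis using in_A_iff[of a] in_A_iff[of b] that ij by (auto simp: NN_def)
  qed
  obtain p where p: "p \<in> A" "c p = True" "l p = i" using ex_level[of i True] ij by auto
  obtain q where q: "q \<in> A" "c q = False" "l q = j" using ex_level[of j False] ij by auto
  have hit: "\<exists>a' b'. NN i j a' b' \<and> c a' \<and> a' \<noteq> a \<and> b' \<noteq> b"
    if "a \<in> A" "l a = i" "b \<in> A" "l b = j" "c a" "\<not> c b" for a b
    using avoiding_negative_edge[OF ij(1) that(1-4)] that(5,6) by metis
  have hit': "\<exists>a'' b''. NN i j a'' b'' \<and> c a'' \<and> a'' \<noteq> a \<and> b'' \<noteq> b'"
    if "NN i j a b" "NN i j a' b'" "c a" "c a'" for a b a' b'
    using hit[of a b'] full[OF that(1)] full[OF that(2)] that NN_col[OF that(2)] by blast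
  \<comment> \<open>Edges 1 and 2 are disjoint, edge 3 avoids \<open>a1\<close> and
    \<open>b2\<close>, edge 4 avoids \<open>a2\<close> and \<open>b1\<close>.\<close>
  obtain a1 b1 where 1: "NN i j a1 b1" "c a1" using hit[of p q] p q by blast
  obtain a2 b2 where 2: "NN i j a2 b2" "c a2" "a2 \<noteq> a1" "b2 \<noteq> b1" using hit'[OF 1(1) 1(1) 1(2) 1(2)] by blast
  obtain a3 b3 where 3: "NN i j a3 b3" "c a3" "a3 \<noteq> a1" "b3 \<noteq> b2" using hit'[OF 1(1) 2(1) 1(2) 2(2)] by blast
  obtain a4 b4 where 4: "NN i j a4 b4" "c a4" "a4 \<noteq> a2" "b4 \<noteq> b1" using hit'[OF 2(1) 1(1) 2(2) 1(2)] by blast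
  have ji: "j + i = r + 1" using ij by simp
  note M = no_negative_3_matching[OF ij(1)]
  note P = no_negative_path5[OF ij(1)]
  \<comment> \<open>The primed facts have the sides exchanged, for stars centred on the other
    side.\<close>
  note P' = no_negative_path5[OF ji]
  note C = no_two_negative_cherries[OF ij(1)]
  note C' = no_two_negative_cherries[OF ji]
  note s = 1(1)[unfolded NN_sym[of i]] 2(1)[unfolded NN_sym[of i]] 3(1)[unfolded NN_sym[of i]] 4(1)[unfolded NN_sym[of i]]
  have cb: "\<not> c b1" "\<not> c b2" "\<not> c b3" "\<not> c b4" using NN_col 1 2 3 4 by blast+
  show False
  proof (cases "a3 = a2")
    case a3: True
    show False
    proof (cases "a4 = a1")
      case a4: True
      have N3: "NN i j a2 b3" and N4: "NN i j a1 b4" using 3 4 a3 a4 by auto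
      consider "b3 = b1" "b4 = b2" | "b3 = b1" "b4 \<noteq> b2" | "b3 \<noteq> b1" "b4 = b2"
        | "b3 \<noteq> b1" "b4 \<noteq> b2" "b3 = b4" | "b3 \<noteq> b1" "b4 \<noteq> b2" "b3 \<noteq> b4" by blast
      then show False
      proof cases
        case 1
        then show ?thesis using noF1[of a1 b1 b2 a2] \<open>NN i j a1 b1\<close> 2 N3 N4 by (auto simp: NN_def)
      next
        case c: 2
        then show ?thesis using P[OF 2(1) N3[unfolded c] 1(1) N4] 1 2 3 4 by auto
      next
        case c: 3
        then show ?thesis using P[OF N3 2(1) N4[unfolded c] 1(1)] 1 2 3 4 by auto
      next
        case c: 4
        then show ?thesis using P[OF 2(1) N3 N4[folded c(3)] 1(1)] 1 2 3 4 by auto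
      next
        case c: 5
        then show ?thesis using C[OF 1(1) N4 2(1) N3] 1 2 3 4 by auto
      qed
    next
      case a4: False
      show False
      proof (cases "b4 = b2")
        case True
        show False
        proof (cases "b3 = b1")
          case b3: True
          show False
            using P'[of b2 a4 a2 b1 a1] s a3 b3 True 1 2 3 4 a4 cb by auto
        next
          case False
          show False using M[OF 1(1) 4(1) 3(1)] 1 2 3 4 a3 a4 True False by auto
        qed
      next
        case False
        then show False using M[OF 1(1) 2(1) 4(1)] 1 2 3 4 a4 by auto
      qed
    qed
  next
    case a3: False
    have b3: "b3 = b1"
      using M[OF 1(1) 2(1) 3(1)] 1 2 3 a3 by auto
    show False
    proof (cases "a4 = a1")
      case a4: True
      show False
      proof (cases "b4 = b2")
        case b4: True
        show False using P'[of b1 a3 a1 b2 a2] s a3 b3 a4 b4 1 2 3 4 cb by auto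
      next
        case False
        show False using M[OF 4(1) 3(1) 2(1)] 1 2 3 4 a3 a4 b3 False by auto
      qed
    next
      case a4: False
      have b4: "b4 = b2" using M[OF 1(1) 2(1) 4(1)] 1 2 4 a4 by auto
      show False
      proof (cases "a3 = a4")
        case True
        show False using P'[of b1 a1 a3 b2 a2] s a3 b3 b4 True 1 2 3 4 cb by auto
      next
        case False
        show False using C'[of b1 a1 a3 b2 a2 a4] s a3 a4 b3 b4 False 1 2 3 4 cb by auto
      qed
    qed
  qed
qed

end

section \<open>Levels of a bipartite graph without \<open>2K\<^sub>2\<close>\<close>

lemma ex_rank:
  fixes D :: "'b::linorder set"
  assumes "finite D" "1 \<le> i" "i \<le> card D"
  shows "\<exists>x\<in>D. card {y\<in>D. x \<le> y} = i"
  using assms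
proof (induction D arbitrary: i rule: finite_linorder_min_induct)
  case (insert b D)
  have nb: "b \<notin> D" using insert.hyps by auto
  show ?case
  proof (cases "i = Suc (card D)")
    case True
    have "{y\<in>insert b D. b \<le> y} = insert b D" using insert.hyps by force
    then have "card {y\<in>insert b D. b \<le> y} = i" using True insert.hyps nb by simp
    then show ?thesis by blast
  next
    case False
    then obtain x where x: "x \<in> D" "card {y\<in>D. x \<le> y} = i"
      using insert.IH[of i] insert.prems insert.hyps nb by auto
    have "{y\<in>insert b D. x \<le> y} = {y\<in>D. x \<le> y}" using insert.hyps x by force
    then have "card {y\<in>insert b D. x \<le> y} = i" using x(2) by (rule arg_cong[THEN trans])
    then show ?thesis using x(1) by blast
  qed
qed simp

context sbg
begin

text \<open>On the side \<open>P\<close> the neighbourhoods form a chain, so the degree determines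
  the neighbourhood; the level is the rank of the degree counted from the top. A vertex
  \<open>q\<close> of the other side is adjacent exactly to the vertices of rank at most
  \<open>g q\<close>, and the level \<open>r + 1 - g q\<close> turns this into the additive
  rule.\<close>

lemma chain_levels:
  assumes fin: "finite A" and ne: "A \<noteq> {}" and nbr: "\<And>a. a \<in> A \<Longrightarrow> \<exists>b\<in>A. E a b"
    and no2K2: "\<And>a b d e. \<lbrakk>a \<in> A; b \<in> A; d \<in> A; e \<in> A; E a b; E d e; c a = c d\<rbrakk> \<Longrightarrow> E a e \<or> E d b"
  obtains l :: "'v \<Rightarrow> nat" and r where "1 \<le> r" "\<And>a. a \<in> A \<Longrightarrow> 1 \<le> l a \<and> l a \<le> r"
    "\<And>a b. \<lbrakk>a \<in> A; b \<in> A; c a \<noteq> c b\<rbrakk> \<Longrightarrow> E a b \<longleftrightarrow> l a + l b \<le> r + 1"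
    "\<And>k i. \<lbrakk>1 \<le> i; i \<le> r\<rbrakk> \<Longrightarrow> \<exists>a\<in>A. c a = k \<and> l a = i"
proof -
  define P where "P = {a\<in>A. c a}"
  define N where "N = (\<lambda>a. {b\<in>A. E a b})"
  define dg where "dg = (\<lambda>a. card (N a))"
  define D where "D = dg ` P"
  define r where "r = card D"
  define f where "f = (\<lambda>p. card {y\<in>D. dg p \<le> y})"
  define g where "g = (\<lambda>q. Max (f ` (N q)))"
  define l where "l = (\<lambda>a. if c a then f a else r + 1 - g a)"
  have finN: "finite (N a)" for a using fin by (simp add: N_def)
  have finD: "finite D" using fin by (simp add: D_def P_def)
  have P_sub: "p \<in> P \<Longrightarrow> p \<in> A \<and> c p" for p by (simp add: P_def)
  have chain: "N p \<subseteq> N p' \<or> N p' \<subseteq> N p" if "p \<in> P" "p' \<in> P" for p p'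
  proof (rule ccontr)
    assume "\<not> ?thesis"
    then obtain b e where "b \<in> N p" "b \<notin> N p'" "e \<in> N p'" "e \<notin> N p" by blast
    then show False using no2K2[of p b p' e] that P_sub by (auto simp: N_def)
  qed
  have f_le: "1 \<le> f p \<and> f p \<le> r" if "p \<in> P" for p
  proof -
    have "dg p \<in> {y\<in>D. dg p \<le> y}" using that by (auto simp: D_def)
    moreover have "finite {y\<in>D. dg p \<le> y}" using finD by simp
    ultimately have "f p \<noteq> 0" unfolding f_def by (metis card_0_eq empty_iff)
    moreover have "f p \<le> r" unfolding f_def r_def using finD by (intro card_mono) auto
    ultimately show ?thesis by simp
  qed
  have f_mono: "N p \<subseteq> N p'" if "p \<in> P" "p' \<in> P" "f p' \<le> f p" for p p'
  proof (cases "dg p \<le> dg p'")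
    case True
    show ?thesis
    proof (rule ccontr)
      assume n: "\<not> ?thesis"
      then have "N p' \<subset> N p" using chain[OF that(1,2)] by blast
      then have "dg p' < dg p" unfolding dg_def using finN by (rule psubset_card_mono[rotated])
      then show False using True by simp
    qed
  next
    case False
    have "{y\<in>D. dg p \<le> y} \<subset> {y\<in>D. dg p' \<le> y}"
      using False that by (auto simp: D_def)
    then have "f p < f p'" unfolding f_def using finD by (intro psubset_card_mono) auto
    then show ?thesis using that by simp
  qed
  have NP: "p \<in> P" if "p \<in> N q" "\<not> c q" for p q
    using that E_col[of q p] by (auto simp: N_def P_def)
  have Nne: "N q \<noteq> {}" if "q \<in> A" for q using nbr[OF that] by (auto simp: N_def)
  have gmax: "g q \<in> f ` N q" "\<And>p. p \<in> N q \<Longrightarrow> f p \<le> g q" if "q \<in> A" for q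
    using Nne[OF that] finN by (auto simp: g_def)
  have g_le: "1 \<le> g q \<and> g q \<le> r" if "q \<in> A" "\<not> c q" for q
    using gmax(1)[OF that(1)] NP that f_le by auto
  have Edge: "E p q \<longleftrightarrow> f p \<le> g q" if pq: "p \<in> P" "q \<in> A" "\<not> c q" for p q
  proof
    assume "E p q"
    then have "p \<in> N q" using E_sym that P_sub by (auto simp: N_def)
    then show "f p \<le> g q" using gmax that by blast
  next
    assume le: "f p \<le> g q"
    obtain p' where p': "p' \<in> N q" "g q = f p'" using gmax(1)[OF pq(2)] by blast
    then have "N p' \<subseteq> N p" using f_mono[of p' p] NP pq le by auto
    moreover have "q \<in> N p'" using p' pq E_sym by (auto simp: N_def)
    ultimately show "E p q" by (auto simp: N_def)
  qed
  obtain a b where ab: "a \<in> A" "b \<in> A" "E a b" using ne nbr by blast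
  then have Pne: "P \<noteq> {}" using E_col[of a b] by (auto simp: P_def)
  show thesis
  proof (rule that[of r l])
    show "1 \<le> r" using Pne f_le by fastforce
    show "1 \<le> l a \<and> l a \<le> r" if "a \<in> A" for a
      using that f_le[of a] g_le[of a] by (cases "c a") (auto simp: l_def P_def)
    have X: "E a b \<longleftrightarrow> l a + l b \<le> r + 1" if "a \<in> A" "b \<in> A" "c a" "\<not> c b" for a b
      using Edge[of a b] g_le[of b] that by (auto simp: l_def P_def)
    show "E a b \<longleftrightarrow> l a + l b \<le> r + 1" if "a \<in> A" "b \<in> A" "c a \<noteq> c b" for a b
      using X[of a b] X[of b a] that E_comm[of a b] by (cases "c a") (auto simp: add.commute)
    have exP: "\<exists>p\<in>P. f p = i" if i: "1 \<le> i" "i \<le> r" for i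
    proof -
      obtain x where "x \<in> D" "card {y\<in>D. x \<le> y} = i" using ex_rank[OF finD i(1)] i(2) by (auto simp: r_def)
      then show ?thesis by (auto simp: D_def f_def)
    qed
    show "\<exists>a\<in>A. c a = k \<and> l a = i" if i: "1 \<le> i" "i \<le> r" for k i
    proof (cases k)
      case True
      then show ?thesis using exP[OF i] by (auto simp: l_def P_def)
    next
      case False
      define j where "j = r + 1 - i"
      have j: "1 \<le> j" "j \<le> r" using i by (auto simp: j_def)
      obtain p where p: "p \<in> P" "f p = j" using exP[OF j] by blast
      \<comment> \<open>A vertex seen by rank \<open>j\<close> but not by rank \<open>j + 1\<close>
        has \<open>g q = j\<close>, and one exists because different degrees mean different
        neighbourhoods. For the last rank any neighbour will do.\<close>
      have "\<exists>q\<in>N p. g q = j"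
      proof (cases "j = r")
        case True
        obtain q where q: "q \<in> N p" using Nne p P_sub by blast
        then have "q \<in> A" "\<not> c q" "E p q" using E_col[of p q] p P_sub by (auto simp: N_def)
        then have "g q = j" using Edge[of p q] g_le[of q] p True by auto
        then show ?thesis using q by blast
      next
        case False
        then obtain p' where p': "p' \<in> P" "f p' = Suc j" using exP[of "Suc j"] j by auto
        have "\<not> N p \<subseteq> N p'"
        proof
          assume "N p \<subseteq> N p'"
          then have "dg p \<le> dg p'" unfolding dg_def using finN by (rule card_mono[rotated])
          then have "{y\<in>D. dg p' \<le> y} \<subseteq> {y\<in>D. dg p \<le> y}" by auto
          then have "f p' \<le> f p" unfolding f_def using finD by (intro card_mono) auto
          then show False using p p' by simp
        qed
        then obtain q where q: "q \<in> N p" "q \<notin> N p'" by blast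
        then have qq: "q \<in> A" "\<not> c q" "E p q" "\<not> E p' q" using E_col[of p q] p P_sub by (auto simp: N_def)
        then have "g q = j" using Edge[of p q] Edge[of p' q] p p' by auto
        then show ?thesis using q by blast
      qed
      then obtain q where q: "q \<in> N p" "g q = j" by blast
      then have "q \<in> A" "\<not> c q" using E_col[of p q] p P_sub by (auto simp: N_def)
      moreover have "l q = i" using \<open>\<not> c q\<close> q i by (auto simp: l_def j_def)
      ultimately show ?thesis using False by auto
    qed
  qed
qed

definition no_simplicial :: "'v set \<Rightarrow> bool" where
  "no_simplicial A \<longleftrightarrow> (\<forall>p\<in>A. \<forall>q\<in>A. E p q \<longrightarrow> (\<exists>a b. a \<noteq> p \<and> b \<noteq> q \<and> E p b \<and> E q a \<and> (\<not> E a b \<or> Ng a b)))"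

end

subsection \<open>Existence of a simplicial edge\<close>

context sbg_free
begin

text \<open>Without a tadpole everything required by \<open>chain_config\<close> holds: levels are
  extended by \<open>0\<close> to \<open>S\<close>, and its two conditions against shortest tadpoles
  are the cases \<open>tad [x]\<close> and \<open>tad [x, h]\<close>.\<close>

lemma chain_tadpole:
  assumes fin: "finite A" and ne: "A \<noteq> {}" and nbr: "\<And>a. a \<in> A \<Longrightarrow> \<exists>b\<in>A. E a b"
    and no2K2: "\<And>a b d e. \<lbrakk>a \<in> A; b \<in> A; d \<in> A; e \<in> A; E a b; E d e; c a = c d\<rbrakk> \<Longrightarrow> E a e \<or> E d b"
    and AS: "A \<inter> S = {}" and compl: "\<And>s a. \<lbrakk>s \<in> S; a \<in> A; c s \<noteq> c a\<rbrakk> \<Longrightarrow> E s a"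
    and SS: "\<And>s t. \<lbrakk>s \<in> S; t \<in> S; c s \<noteq> c t\<rbrakk> \<Longrightarrow> E s t \<and> \<not> Ng s t"
    and common: "\<And>s t. \<lbrakk>s \<in> S; t \<in> S; c s = c t\<rbrakk> \<Longrightarrow> \<exists>b. E s b \<and> E t b \<and> (\<forall>a\<in>A. \<not> E a b)"
    and nbA: "\<And>a v. \<lbrakk>a \<in> A; E a v\<rbrakk> \<Longrightarrow> v \<in> A \<union> S"
    and ns: "no_simplicial A"
  shows "tad_in A S"
proof (rule ccontr)
  assume nt: "\<not> tad_in A S"
  obtain l :: "'v \<Rightarrow> nat" and r where l: "1 \<le> r" "\<And>a. a \<in> A \<Longrightarrow> 1 \<le> l a \<and> l a \<le> r"
    "\<And>a b. \<lbrakk>a \<in> A; b \<in> A; c a \<noteq> c b\<rbrakk> \<Longrightarrow> E a b \<longleftrightarrow> l a + l b \<le> r + 1"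
    "\<And>k i. \<lbrakk>1 \<le> i; i \<le> r\<rbrakk> \<Longrightarrow> \<exists>a\<in>A. c a = k \<and> l a = i"
    by (rule chain_levels[OF fin ne nbr no2K2]) blast+
  define m where "m = (\<lambda>v. if v \<in> A then l v else 0)"
  have E3: "c u \<noteq> c v" if "E u v" for u v using that E_col by blast
  have "chain_config V E Ng c A S m r"
  proof
    show "E u v \<longleftrightarrow> m u + m v \<le> r + 1" if uv: "u \<in> A \<union> S" "v \<in> A \<union> S" "c u \<noteq> c v" for u v
    proof (cases "u \<in> A"; cases "v \<in> A")
      assume "u \<in> A" "v \<in> A"
      then show ?thesis using l(3) uv by (simp add: m_def)
    next
      assume h: "u \<in> A" "v \<notin> A"
      then have "E u v" using compl[of v u] uv E_sym by auto
      then show ?thesis using h l(2)[of u] by (simp add: m_def)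
    next
      assume h: "u \<notin> A" "v \<in> A"
      then have "E u v" using compl[of u v] uv by auto
      then show ?thesis using h l(2)[of v] by (simp add: m_def)
    next
      assume h: "u \<notin> A" "v \<notin> A"
      then have "E u v" using SS[of u v] uv by auto
      then show ?thesis using h by (simp add: m_def)
    qed
    show "m s = 0" if "s \<in> S" for s using that AS by (auto simp: m_def)
    show "1 \<le> m a \<and> m a \<le> r" if "a \<in> A" for a using that l(2) by (simp add: m_def)
    show "\<exists>a\<in>A. c a = k \<and> m a = i" if "1 \<le> i" "i \<le> r" for i k
      using l(4)[OF that, of k] by (auto simp: m_def)
    show "1 \<le> r" by fact
    show "\<not> Ng s t" if "s \<in> S" "t \<in> S" for s t
      using SS[OF that] Ng_E[of s t] E3[of s t] by blast
    show "\<exists>b. E s b \<and> E t b \<and> (\<forall>a\<in>A. \<not> E a b)" if "s \<in> S" "t \<in> S" "c s = c t" for s t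
      using common that by blast
    show "\<exists>a b. a \<noteq> p \<and> b \<noteq> q \<and> E p b \<and> E q a \<and> (\<not> E a b \<or> Ng a b)" if "p \<in> A" "q \<in> A" "E p q" for p q
      using ns that unfolding no_simplicial_def by blast
    show "v \<in> A \<union> S" if "a \<in> A" "E a v" for a v using nbA that by blast
    show False if x: "x \<in> S" "y \<in> A" "z \<in> A" "w \<in> A" "y \<noteq> z" "Ng x y" "Ng x z" "E w y" "E w z" for x y z w
    proof -
      have "x \<notin> A" using x AS by blast
      have "E x y" "E x z" using x Ng_E by auto
      then have "\<not> E x w" using E3[of x y] E3[of w y] E3[of x w] x by auto
      have t: "tad [x] w y z"
        by (rule tadI) (use x \<open>x \<notin> A\<close> \<open>\<not> E x w\<close> \<open>E x y\<close> \<open>E x z\<close> in auto)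
      show False using nt tad_inI[OF x(1) t, of A] x by simp
    qed
    show False if x: "x \<in> S" "h \<in> A" "y \<in> A" "z \<in> A" "w \<in> A" "h \<noteq> w" "y \<noteq> z" "Ng x w" "Ng h y" "Ng h z" "E w y" "E w z"
      for x h y z w
    proof -
      have xA: "x \<notin> A" using x AS by blast
      have e: "E x w" "E h y" "E h z" using x Ng_E by auto
      then have cc: "c w \<noteq> c x" "c h = c w" "c y = c x" "c z = c x" using E3[of x w] E3[of h y] E3[of h z] E3[of w y] E3[of w z] x by auto
      then have xh: "E x h" using compl[of x h] x by auto
      have n: "\<not> E x y" "\<not> E x z" "\<not> E h w" using cc E3[of x y] E3[of x z] E3[of h w] by auto
      have t: "tad [x, h] w y z"
        by (rule tadI) (use x xA xh e n in \<open>auto dest: E3\<close>)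
      show False using nt tad_inI[OF x(1) t, of A] x by simp
    qed
  qed
  then show False by (rule chain_config.contradictory)
qed

section \<open>The separator of a minimal side\<close>

lemma separator_path:
  assumes s: "sep A S B" and st: "s \<in> S" "t \<in> S"
  obtains g where "g \<noteq> []" "ipl g" "set g \<subseteq> B" "\<And>u. u \<in> set g \<Longrightarrow> E s u \<longleftrightarrow> u = hd g"
    "\<And>u. u \<in> set g \<Longrightarrow> E t u \<longleftrightarrow> u = last g" "s \<notin> set g" "t \<notin> set g"
proof -
  note d = sepD[OF s]
  obtain b1 b2 where "b1 \<in> B" "E s b1" "b2 \<in> B" "E t b2" using st d(7) E_sym unfolding nb_def by blast
  then obtain g where g: "g \<noteq> []" "ipl g" "set g \<subseteq> B" "E s (hd g)" "\<forall>u\<in>set (tl g). \<not> E s u" "E t (last g)"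
    "\<forall>u\<in>set (butlast g). \<not> E t u"
    using conn_induced_path[of B b1 "E s" b2 "E t"] d(3) by metis
  have hd: "u \<in> set g \<Longrightarrow> u = hd g \<or> u \<in> set (tl g)" for u using g(1) by (cases g) auto
  have lst: "u \<in> set g \<Longrightarrow> u = last g \<or> u \<in> set (butlast g)" for u
    using g(1) by (cases g rule: rev_cases) auto
  show thesis
  proof (rule that[OF g(1-3)])
    show "E s u \<longleftrightarrow> u = hd g" "E t u \<longleftrightarrow> u = last g" if "u \<in> set g" for u
      using hd[OF that] lst[OF that] g by blast+
    show "s \<notin> set g" "t \<notin> set g" using g(3) st d(9) by blast+
  qed
qed

text \<open>If \<open>s\<close> and \<open>t\<close> are not adjacent, a path between them through
  \<open>B\<close> and an edge \<open>aa'\<close> of \<open>A\<close> close a hole. If they are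
  adjacent and \<open>st\<close> is negative, a longer path through \<open>B\<close> would again
  close a hole, so it has just two vertices \<open>x\<close>, \<open>y\<close>; then
  \<open>a\<close>, \<open>a'\<close>, \<open>s\<close>, \<open>t\<close>, \<open>x\<close>,
  \<open>y\<close> form \<open>D\<close> with central edge \<open>st\<close>.\<close>

lemma separator_biclique:
  assumes s: "sep A S B" and compl: "\<And>s a. s \<in> S \<Longrightarrow> a \<in> A \<Longrightarrow> c s \<noteq> c a \<Longrightarrow> E s a"
    and st: "s \<in> S" "t \<in> S" "c s \<noteq> c t"
  shows "E s t \<and> \<not> Ng s t"
proof -
  note d = sepD[OF s]
  obtain g where g: "g \<noteq> []" "ipl g" "set g \<subseteq> B" "\<And>u. u \<in> set g \<Longrightarrow> E s u \<longleftrightarrow> u = hd g"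
    "\<And>u. u \<in> set g \<Longrightarrow> E t u \<longleftrightarrow> u = last g" "s \<notin> set g" "t \<notin> set g"
    using separator_path[OF s st(1,2)] by metis
  obtain a where a: "a \<in> A" "c a = c t" using has_edge_colours[OF d(4)] by blast
  obtain a' where a': "a' \<in> A" "E a a'" using conn_nbr[OF d(2,4) a(1)] by blast
  have ca': "c a' = c s" using E_col[OF a'(2)] a st by auto
  have sa: "E s a" "E t a'" using compl[of s a] compl[of t a'] a a' ca' st by auto
  have nab: "\<not> E a u" "\<not> E a' u" "\<not> E u a'" "u \<noteq> a" "u \<noteq> a'" if "u \<in> set g" for u
    using that g(3) d(1) d(10)[of a u] d(10)[of a' u] d(11)[of a' u] a a' by auto
  have n: "\<not> E a t" "\<not> E s a'" "s \<noteq> t" using a ca' E_col[of a t] E_col[of s a'] st by auto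
  have nin: "s \<notin> A" "t \<notin> A" using st d(8) by auto
  have gt: "E u t \<longleftrightarrow> u = last g" if "u \<in> set g" for u using g(5)[OF that] E_comm[of u t] by simp
  have Est: "E s t"
  proof (rule ccontr)
    assume nst: "\<not> E s t"
    have hl: "hd (g @ [t, a']) = hd g" using g(1) by simp
    have g2: "ipl (g @ [t, a'])"
      using g gt sa nab nin a' by (auto simp: ipl_append)
    have ti: "t \<noteq> hd g" "a' \<noteq> hd g" using g(1,7) nab[of "hd g"] by auto
    have ip: "ipl (s # g @ [t, a'])"
      unfolding ipl.simps(2) hl using g2 g(4,6) nst n nin a' ti by auto
    show False
    proof (rule noC[OF ip, of a])
      show "4 \<le> length (s # g @ [t, a'])" using g(1) by (cases g) auto
      show "a \<notin> set (s # g @ [t, a'])" using nab a nin a' E_irrefl[of a] by auto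
      show "E a u \<longleftrightarrow> u = hd (s # g @ [t, a']) \<or> u = last (s # g @ [t, a'])" if "u \<in> set (s # g @ [t, a'])" for u
        using that nab n a' sa(1) E_sym[OF sa(1)] g(6) nin a(1) by auto
    qed
  qed
  moreover have "\<not> Ng s t"
  proof
    assume N: "Ng s t"
    have g2: "ipl (g @ [t])" using g gt by (auto simp: ipl_append)
    have "\<not> 4 \<le> length (g @ [t])"
    proof
      assume "4 \<le> length (g @ [t])"
      then show False
      proof (rule noC[OF g2, of s])
        show "s \<notin> set (g @ [t])" using g n by auto
        show "E s u \<longleftrightarrow> u = hd (g @ [t]) \<or> u = last (g @ [t])" if "u \<in> set (g @ [t])" for u
          using that g Est by auto
      qed
    qed
    then have len: "length g < 3" by simp
    have hdl: "E s (hd g)" "E (last g) t" using g(1) g(4)[of "hd g"] gt[of "last g"] by auto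
    have "c (hd g) = c t" "c (last g) = c s" using hdl[THEN E_col] st by auto
    then obtain x y where xy: "g = [x, y]" using len g(1) st(3) by (cases g; cases "tl g"; auto)
    then have "E x y" using g(2) by simp
    then show False
      by (intro noD[of a' a t s x y])
        (use E_sym[OF a'(2)] E_sym[OF sa(2)] E_sym[OF \<open>E x y\<close>] sa(1) N hdl xy nab[of x] nab[of y] E_comm[of y a] in auto)
  qed
  ultimately show ?thesis by blast
qed

text \<open>A path through \<open>B\<close> with more than one vertex would form a hole with
  distinct \<open>s\<close>, \<open>t\<close> and a vertex \<open>a\<close> of \<open>A\<close>. So
  \<open>s\<close> and \<open>t\<close> share a neighbour in \<open>B\<close>, and it sees nothing
  of \<open>A\<close>.\<close>

lemma separator_common_nbr:
  assumes s: "sep A S B" and compl: "\<And>s a. s \<in> S \<Longrightarrow> a \<in> A \<Longrightarrow> c s \<noteq> c a \<Longrightarrow> E s a"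
    and st: "s \<in> S" "t \<in> S" "c s = c t"
  shows "\<exists>b. E s b \<and> E t b \<and> (\<forall>a\<in>A. \<not> E a b)"
proof -
  note d = sepD[OF s]
  obtain g where g: "g \<noteq> []" "ipl g" "set g \<subseteq> B" "\<And>u. u \<in> set g \<Longrightarrow> E s u \<longleftrightarrow> u = hd g"
    "\<And>u. u \<in> set g \<Longrightarrow> E t u \<longleftrightarrow> u = last g" "s \<notin> set g" "t \<notin> set g"
    using separator_path[OF s st(1,2)] by metis
  have gt: "E u t \<longleftrightarrow> u = last g" if "u \<in> set g" for u using g(5)[OF that] E_comm[of u t] by simp
  obtain a where a: "a \<in> A" "c a \<noteq> c s" using has_edge_colours[OF d(4)] by metis
  have sa: "E a s" "E a t" using compl[of s a] compl[of t a] a st E_sym by auto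
  have nin: "s \<notin> A" "t \<notin> A" using st d(8) by auto
  have nab: "\<not> E a u" "u \<noteq> a" if "u \<in> set g" for u
    using that g(3) d(1) d(10)[of a u] a by auto
  have hB: "hd g \<in> B" using g(1,3) by auto
  show ?thesis
  proof (cases "s = t \<or> hd g = last g")
    case True
    then have "E s (hd g) \<and> E t (hd g)" using g(1) g(4)[of "hd g"] g(5)[of "hd g"] by auto
    then show ?thesis using d(10) hB by blast
  next
    case False
    have ns: "\<not> E s t" using st E_col by blast
    have g2: "ipl (g @ [t])" using g gt by (auto simp: ipl_append)
    have hl: "hd (g @ [t]) = hd g" using g(1) by simp
    have th: "t \<noteq> hd g" using g(1,7) by auto
    have ip: "ipl (s # g @ [t])" unfolding ipl.simps(2) hl using g2 g(4,6) ns False th by auto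
    have False
    proof (rule noC[OF ip, of a])
      show "4 \<le> length (s # g @ [t])" using g(1) False by (cases g; cases "tl g") auto
      show "a \<notin> set (s # g @ [t])" using nab a nin by auto
      show "E a u \<longleftrightarrow> u = hd (s # g @ [t]) \<or> u = last (s # g @ [t])" if "u \<in> set (s # g @ [t])" for u
        using that nab sa g(6,7) by auto
    qed
    then show ?thesis ..
  qed
qed

lemma sep_tad_in:
  assumes "sep A S B" "no_simplicial A"
  shows "tad_in A S \<and> \<not> tad_in B S"
  using assms
proof (induction "card A" arbitrary: A S B rule: less_induct)
  case less
  \<comment> \<open>Candidates shrink \<open>A\<close> while the opposite side keeps containing
    \<open>B\<close>, so that \<open>tad_in_extend_sep\<close> transfers tadpoles from
    \<open>A1\<close> to \<open>A\<close> and from \<open>B\<close> to \<open>B1\<close>.\<close>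
  define W where "W = {A1. \<exists>S1 B1. A1 \<subseteq> A \<and> B \<subseteq> B1 \<and> sep A1 S1 B1}"
  have "A \<in> W" using less.prems by (auto simp: W_def)
  then obtain A1 where A1: "A1 \<in> W" "\<And>A2. A2 \<in> W \<Longrightarrow> card A1 \<le> card A2"
    using ex_has_least_nat[of "\<lambda>X. X \<in> W" A card] by auto
  then obtain S1 B1 where s1: "A1 \<subseteq> A" "B \<subseteq> B1" "sep A1 S1 B1" by (auto simp: W_def)
  note d = sepD[OF less.prems(1)] and d1 = sepD[OF s1(3)]
  have AV: "A \<subseteq> V" using has_edge_subset_V d by blast
  have finA: "finite A" using AV finV finite_subset by blast
  have finA1: "finite A1" using finA s1 finite_subset by blast
  have nsub: "no_simplicial A'" if "A' \<subseteq> A" for A' using less.prems(2) that unfolding no_simplicial_def by blast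
  have compl: "E s a" if sa: "s \<in> S1" "a \<in> A1" "c s \<noteq> c a" for s a
  proof (rule ccontr)
    assume "\<not> E s a"
    then obtain A' S' B' where A': "A' \<subset> A1" "B1 \<subseteq> B'" "sep A' S' B'"
      using sep_shrink[OF s1(3) sa] by metis
    moreover have "A' \<subseteq> A" "B \<subseteq> B'" using A' s1 by blast+
    ultimately have "A' \<in> W" unfolding W_def by blast
    then have "card A1 \<le> card A'" by (rule A1(2))
    moreover have "card A' < card A1" using finA1 A'(1) by (rule psubset_card_mono)
    ultimately show False by simp
  qed
  have no2K2: "E a e \<or> E d' b" if h: "a \<in> A1" "b \<in> A1" "d' \<in> A1" "e \<in> A1" "E a b" "E d' e" "c a = c d'" for a b d' e
  proof (rule ccontr)
    assume "\<not> ?thesis"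
    then obtain C S' D where C: "sep C S' D" "a \<in> C" "b \<in> C" "d' \<in> D" "e \<in> D"
      using sep_of_2K2[OF h(5-7)] by metis
    note dC = sepD[OF C(1)]
    have cab: "c a \<noteq> c b" "c d' \<noteq> c e" using h E_col by auto
    \<comment> \<open>By completeness each \<open>s\<close> in \<open>S1\<close> sees an end of
      either edge, so it has neighbours in both \<open>C\<close> and \<open>D\<close> and must lie
      in \<open>S'\<close>. Hence neither \<open>C\<close> nor \<open>D\<close> can cross
      \<open>S1\<close>, and both stay inside \<open>A1\<close>.\<close>
    have SS: "S1 \<subseteq> S'"
    proof
      fix s assume s: "s \<in> S1"
      obtain u where u: "u \<in> C" "E u s" using compl[OF s h(1)] compl[OF s h(2)] cab C E_sym by metis
      obtain u' where u': "u' \<in> D" "E s u'" using compl[OF s h(3)] compl[OF s h(4)] cab C by metis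
      have "s \<notin> C" using dC(10) u' by blast
      then show "s \<in> S'" using u dC(6) unfolding nb_def by blast
    qed
    have CA: "C \<subseteq> A1"
      by (rule conn_subset[OF dC(2) _ C(2) h(1)]) (use SS dC d1 in blast)
    have DA: "D \<subseteq> A1"
      by (rule conn_subset[OF dC(3) _ C(4) h(3)]) (use SS dC d1 in blast)
    have "C \<subset> A1" "D \<subset> A1" using CA DA dC(1) C by blast+
    then have "card C < card A1" "card D < card A1" using finA1 psubset_card_mono by blast+
    moreover have "card A1 \<le> card A" using finA s1 card_mono by blast
    ultimately have "card C < card A" "card D < card A" by auto
    \<comment> \<open>The induction hypothesis for \<open>(C, S', D)\<close> excludes a tadpole in
      \<open>D\<close>; the one for \<open>(D, S', C)\<close> demands it.\<close>
    then have "\<not> tad_in D S'" "tad_in D S'"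
      using less.hyps[of C S' D] less.hyps[of D S' C] C(1) sep_sym[OF C(1)] nsub CA DA s1 by blast+
    then show False by blast
  qed
  have t1: "tad_in A1 S1"
  proof (rule chain_tadpole[OF finA1 _ _ no2K2 d1(8) compl])
    show "A1 \<noteq> {}" using d1(4) unfolding has_edge_def by blast
    show "\<exists>b\<in>A1. E a b" if "a \<in> A1" for a using conn_nbr[OF d1(2,4) that] .
    show "E s t \<and> \<not> Ng s t" if "s \<in> S1" "t \<in> S1" "c s \<noteq> c t" for s t
      using separator_biclique[OF s1(3) compl that] by blast
    show "\<exists>b. E s b \<and> E t b \<and> (\<forall>a\<in>A1. \<not> E a b)" if "s \<in> S1" "t \<in> S1" "c s = c t" for s t
      using separator_common_nbr[OF s1(3) compl that] by blast
    show "v \<in> A1 \<union> S1" if "a \<in> A1" "E a v" for a v using that d1(6) unfolding nb_def by blast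
    show "no_simplicial A1" using nsub s1 by blast
  qed
  have "tad_in A S"
    by (rule tad_in_extend_sep[OF sep_sym[OF s1(3)] sep_sym[OF less.prems(1)] s1(2,1) t1])
  moreover have "\<not> tad_in B S"
  proof
    assume "tad_in B S"
    then have "tad_in B1 S1" using tad_in_extend_sep[OF less.prems(1) s1(3,1,2)] by blast
    then show False using sep_complete_not_both_tad_in[OF s1(3) compl t1] by blast
  qed
  ultimately show ?case by blast
qed

theorem ex_simplicial:
  assumes "E u v"
  shows "\<exists>p q. E p q \<and> (\<forall>a b. a \<noteq> p \<and> b \<noteq> q \<and> E p b \<and> E q a \<longrightarrow> E a b \<and> \<not> Ng a b)"
proof (rule ccontr)
  assume "\<not> ?thesis"
  then have ns: "no_simplicial A" for A unfolding no_simplicial_def by blast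
  define A where "A = {a. \<exists>b. E a b}"
  have "A \<subseteq> V" using E_V by (auto simp: A_def)
  then have fin: "finite A" using finV finite_subset by blast
  have no2K2: "E a e \<or> E d b" if h: "E a b" "E d e" "c a = c d" for a b d e
  proof (rule ccontr)
    assume "\<not> ?thesis"
    then obtain C S D where C: "sep C S D" using sep_of_2K2[OF h] by metis
    then show False using sep_tad_in[OF C ns] sep_tad_in[OF sep_sym[OF C] ns] by blast
  qed
  have "tad_in A {}"
  proof (rule chain_tadpole[OF fin])
    show "A \<noteq> {}" using assms by (auto simp: A_def)
    show "\<exists>b\<in>A. E a b" if "a \<in> A" for a using that E_sym unfolding A_def by blast
    show "E a e \<or> E d b" if "E a b" "E d e" "c a = c d" for a b d e using no2K2 that by blast
    show "v \<in> A \<union> {}" if "E a v" for a v using E_sym[OF that] by (auto simp: A_def)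
    show "no_simplicial A" by (rule ns)
  qed auto
  then show False unfolding tad_in_def by blast
qed

end

subsection \<open>Stuck vertex sets\<close>

context sbg
begin

text \<open>Non-adjacent pairs must be included: in a copy that arises only by deleting
  \<open>uv\<close>, the vertices \<open>u\<close> and \<open>v\<close> are such a pair, and their
  witnesses are what contradicts simpliciality of \<open>uv\<close>.\<close>

definition stuck :: "'v set \<Rightarrow> bool" where
  "stuck W \<longleftrightarrow> has_edge W \<and> (\<forall>u\<in>W. \<forall>v\<in>W. c u \<noteq> c v \<longrightarrow>
     (\<exists>p\<in>W. \<exists>q\<in>W. E u p \<and> E v q \<and> p \<noteq> v \<and> q \<noteq> u \<and> (\<not> E p q \<or> Ng p q)))"

lemma stuckE:
  assumes "stuck W" "u \<in> W" "v \<in> W" "c u \<noteq> c v"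
  obtains p q where "p \<in> W" "q \<in> W" "E u p" "E v q" "p \<noteq> v" "q \<noteq> u" "\<not> E p q \<or> Ng p q"
  using assms unfolding stuck_def by blast

text \<open>A path vertex uses its predecessor towards the end, which exists because the end is not
  in \<open>R\<close>; its partner uses its successor, or \<open>y\<close>, or \<open>w\<close>. The
  witnesses can be adjacent only along the chord at \<open>w\<close> and, for the pair of
  \<open>w\<close> with \<open>y\<close> or \<open>z\<close>, along an edge from the last path
  vertex to \<open>z\<close> or \<open>y\<close>; these edges are negative in a tadpole.\<close>

lemma tad_stuck_aux:
  assumes t: "tad (x # p) w y z" and R: "R = set p \<union> {w, y, z}" and uv: "u \<in> R" "v \<in> R" "c u \<noteq> c v"
  shows "\<exists>p\<in>insert x R. \<exists>q\<in>insert x R. E u p \<and> E v q \<and> p \<noteq> v \<and> q \<noteq> u \<and> (\<not> E p q \<or> Ng p q)"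
proof -
  define L where "L = x # p"
  define m where "m = length p"
  note d = tadD[OF t, folded L_def]
  have len: "length L = Suc m" by (simp add: L_def m_def)
  have dist: "distinct L" using ipl_distinct[OF d(2)] .
  have ix: "L ! i = L ! j \<longleftrightarrow> i = j" if "i \<le> m" "j \<le> m" for i j
    using nth_eq_iff_index_eq[OF dist] that len by simp
  have lL: "last L = L ! m" by (simp add: L_def m_def last_conv_nth)
  have inL: "L ! i \<in> set L" if "i \<le> m" for i using that len by simp
  have inR: "L ! i \<in> insert x R" if "i \<le> m" for i using inL[OF that] by (auto simp: L_def R)
  have Ey: "E (L ! i) y \<longleftrightarrow> i = m" if "i \<le> m" for i using d(7)[OF inL[OF that]] lL ix that by auto
  have Ep: "E (L ! i) (L ! j) \<longleftrightarrow> j = Suc i \<or> i = Suc j" if "i \<le> m" "j \<le> m" for i j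
    using ipl_nth[OF d(2)] that len by simp
  have wE: "E (L ! i) w \<Longrightarrow> Ng (L ! i) w" if "i \<le> m" for i using d(15) inL that by blast
  have ne: "L ! i \<noteq> w" "L ! i \<noteq> y" "L ! i \<noteq> z" if "i \<le> m" for i using inL[OF that] d(4-6) by auto
  have setp: "\<exists>i. 1 \<le> i \<and> i \<le> m \<and> a = L ! i" if a: "a \<in> set p" for a
  proof -
    obtain j where "j < length p" "p ! j = a" using a by (auto simp: in_set_conv_nth)
    then show ?thesis by (intro exI[of _ "Suc j"]) (auto simp: L_def m_def)
  qed
  define Q where "Q = (\<lambda>u v. \<exists>p\<in>insert x R. \<exists>q\<in>insert x R. E u p \<and> E v q \<and> p \<noteq> v \<and> q \<noteq> u \<and> (\<not> E p q \<or> Ng p q))"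
  have QI: "Q u v" if "p \<in> insert x R" "q \<in> insert x R" "E u p" "E v q" "p \<noteq> v" "q \<noteq> u" "\<not> E p q \<or> Ng p q"
    for u v p q using that unfolding Q_def by blast
  have Qsym: "Q u v \<Longrightarrow> Q v u" for u v unfolding Q_def using E_comm Ng_comm by metis
  have RR: "w \<in> insert x R" "y \<in> insert x R" "z \<in> insert x R" by (auto simp: R)
  have lt: "Q (L ! i) (L ! j)" if "1 \<le> i" "i < j" "j \<le> m" for i j
  proof (cases "j = m")
    case True
    show ?thesis
      by (rule QI[of "L ! (i - 1)" y]) (use that True inR RR Ep Ey ix ne[of i] in auto)
  next
    case False
    show ?thesis
      by (rule QI[of "L ! (i - 1)" "L ! Suc j"]) (use that False inR Ep ix in auto)
  qed
  have pw: "Q (L ! i) w" if "1 \<le> i" "i \<le> m" for i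
    by (rule QI[of "L ! (i - 1)" y]) (use that inR RR Ep Ey ix ne[of i] ne[of "i - 1"] d(11) in auto)
  have py: "Q (L ! i) y'" if "1 \<le> i" "i \<le> m" "y' \<in> {y, z}" for i y'
  proof -
    have i1: "i - 1 \<le> m" using that by simp
    have yw: "E y' w" using that(3) d(11,12) E_sym by blast
    have "E (L ! i) (L ! (i - 1))" using Ep[OF that(2) i1] that by auto
    moreover have "L ! (i - 1) \<noteq> y'" using ne[OF i1] that(3) by blast
    ultimately show ?thesis
      using QI[OF inR[OF i1] RR(1), of "L ! i" y'] yw ne(1)[OF that(2)] wE[OF i1] by blast
  qed
  have wy: "Q w y" "Q w z"
  proof -
    have "E y (L ! m)" "E z (L ! m)" "Ng z (L ! m)" "Ng y (L ! m)"
      using d(9,10,13,14) lL E_sym Ng_sym by auto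
    then show "Q w y" "Q w z"
      using QI[of z "L ! m" w y] QI[of y "L ! m" w z] inR[of m] RR ne[of m] d(3,11,12) by auto
  qed
  have "Q u v"
  proof -
    have cuv: "c u \<noteq> c v" by (rule uv)
    consider "u \<in> set p" "v \<in> set p" | "u \<in> set p" "v \<in> {w, y, z}" | "u \<in> {w, y, z}" "v \<in> set p"
      | "u \<in> {w, y, z}" "v \<in> {w, y, z}" using uv R by blast
    then show ?thesis
    proof cases
      case 1
      then obtain i j where ij: "1 \<le> i" "i \<le> m" "u = L ! i" "1 \<le> j" "j \<le> m" "v = L ! j" using setp by meson
      then have "i \<noteq> j" using cuv by auto
      then show ?thesis using ij lt[of i j] lt[of j i] Qsym by (cases "i < j") auto
    next
      case 2
      then show ?thesis using setp pw py by blast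
    next
      case 3
      then show ?thesis using setp pw py Qsym by blast
    next
      case 4
      then show ?thesis using cuv wy Qsym d(18) by auto
    qed
  qed
  then show ?thesis unfolding Q_def .
qed

text \<open>In a pair that is not inside \<open>R\<close> or inside \<open>R'\<close>, one vertex
  has a neighbour in \<open>R\<close> and the other one in \<open>R'\<close>, and these neighbours
  are not adjacent. Equal ends are allowed, so sums and joins are covered together.\<close>

lemma two_tads_stuck:
  assumes t: "tad (x # p) w y z" "tad (x' # p') w' y' z'"
    and R: "R = set p \<union> {w, y, z}" "R' = set p' \<union> {w', y', z'}"
    and n: "\<And>u v. u \<in> R \<Longrightarrow> v \<in> R' \<Longrightarrow> \<not> E u v"
    and x: "\<exists>a\<in>R'. E x a" and x': "\<exists>a\<in>R. E x' a"
  shows "stuck (R \<union> R' \<union> {x, x'})"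
proof -
  have n': "\<not> E v u" if "u \<in> R" "v \<in> R'" for u v using n that E_sym by blast
  have nR: "\<exists>b\<in>R. E a b" if "a \<in> insert x R" for a using tad_nbr[OF t(1), of a] that R by auto
  have nR': "\<exists>b\<in>R'. E a b" if "a \<in> insert x' R'" for a using tad_nbr[OF t(2), of a] that R by auto
  have disj: "a \<notin> R'" if "a \<in> R" for a
    using nR[of a] n'[of _ a] that by blast
  define Q where "Q = (\<lambda>u v. \<exists>p\<in>R \<union> R' \<union> {x, x'}. \<exists>q\<in>R \<union> R' \<union> {x, x'}.
    E u p \<and> E v q \<and> p \<noteq> v \<and> q \<noteq> u \<and> (\<not> E p q \<or> Ng p q))"
  have Qsym: "Q u v \<Longrightarrow> Q v u" for u v unfolding Q_def using E_comm Ng_comm by metis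
  have across: "Q u v" if "p \<in> R" "q \<in> R'" "E u p" "E v q" "v \<notin> R" "u \<notin> R'" for u v p q
    unfolding Q_def using that n[of p q] by (intro bexI[of _ p] bexI[of _ q]) auto
  have xn: "z \<notin> R \<union> R'" if z: "z = x \<or> z = x'" for z
  proof -
    obtain a b where "a \<in> R" "E z a" "b \<in> R'" "E z b" using z nR[of x] nR'[of x'] x x' by blast
    then show ?thesis using n[of z b] n'[of a z] by blast
  qed
  have nz: "(\<exists>a\<in>R. E z a) \<and> (\<exists>a\<in>R'. E z a)" if "z = x \<or> z = x'" for z
    using that nR[of x] nR'[of x'] x x' by blast
  have key: "Q u v" if uv: "u \<in> R \<union> R' \<union> {x, x'}" "v \<in> R \<union> R' \<union> {x, x'}" "c u \<noteq> c v" for u v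
  proof -
    have inner: "Q u v" if "u \<in> R" "v \<in> R"
      using tad_stuck_aux[OF t(1) R(1) that uv(3)] unfolding Q_def by blast
    have inner': "Q u v" if "u \<in> R'" "v \<in> R'"
      using tad_stuck_aux[OF t(2) R(2) that uv(3)] unfolding Q_def by blast
    have c1: "Q a b" if ab: "a \<in> R \<union> {x, x'}" "b \<in> R' \<union> {x, x'}" for a b
    proof -
      obtain p where p: "p \<in> R" "E a p" using ab(1) nR[of a] nz[of a] by blast
      obtain q where q: "q \<in> R'" "E b q" using ab(2) nR'[of b] nz[of b] by blast
      have "b \<notin> R" "a \<notin> R'" using ab disj[of b] disj[of a] xn[of a] xn[of b] by blast+
      then show ?thesis using across p q by blast
    qed
    show ?thesis using uv(1,2) inner inner' c1[of u v] c1[of v u] Qsym[of v u] by blast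
  qed
  have "has_edge (R \<union> R' \<union> {x, x'})"
    using tad_conn(2)[OF t(1)] has_edge_mono R by (metis Un_upper1 Un_assoc)
  then show ?thesis using key unfolding stuck_def Q_def by blast
qed

end

subsection \<open>Simplicial edges and chordality\<close>

definition adj :: "'a sgraph \<Rightarrow> 'a \<Rightarrow> 'a \<Rightarrow> bool" where
  "adj G u v \<longleftrightarrow> {u, v} \<in> edges G"

definition neg :: "'a sgraph \<Rightarrow> 'a \<Rightarrow> 'a \<Rightarrow> bool" where
  "neg G u v \<longleftrightarrow> {u, v} \<in> edges G \<and> \<not> pos G {u, v}"

locale bigraph =
  fixes G :: "'a sgraph" and X :: "'a set"
  assumes sg: "signed_graph G" and bp: "is_bipartition G X"

sublocale bigraph \<subseteq> sbg "verts G" "adj G" "neg G" "\<lambda>u. u \<in> X"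
proof
  show "finite (verts G)" using sg by (simp add: signed_graph_def)
  show "adj G v u" if "adj G u v" for u v using that by (simp add: adj_def insert_commute)
  show "neg G v u" if "neg G u v" for u v using that by (simp add: neg_def insert_commute)
  show "adj G u v" if "neg G u v" for u v using that by (simp add: adj_def neg_def)
  show "u \<in> verts G" if "adj G u v" for u v
    using that sg unfolding adj_def signed_graph_def by (metis insertI1 insertE singletonD)
  show "(u \<in> X) \<noteq> (v \<in> X)" if uv: "adj G u v" for u v
  proof -
    have 1: "card ({u, v} \<inter> X) = 1" using uv bp by (simp add: adj_def is_bipartition_def)
    have "\<exists>a b. {u, v} = {a, b} \<and> a \<noteq> b" using uv sg unfolding adj_def signed_graph_def by blast
    then have "u \<noteq> v" by (auto simp: doubleton_eq_iff)
    then show ?thesis using 1 by (cases "u \<in> X"; cases "v \<in> X") auto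
  qed
qed

definition embeds :: "'a sgraph \<Rightarrow> 'b sgraph \<Rightarrow> ('b \<Rightarrow> 'a) \<Rightarrow> bool" where
  "embeds G H f \<longleftrightarrow> inj_on f (verts H) \<and> f ` verts H \<subseteq> verts G \<and>
     (\<forall>a\<in>verts H. \<forall>b\<in>verts H.
        ({a, b} \<in> edges H \<longleftrightarrow> {f a, f b} \<in> edges G) \<and>
        ({a, b} \<in> edges H \<longrightarrow> pos H {a, b} = pos G {f a, f b}))"

lemma contains_induced_embeds: "contains_induced G H \<longleftrightarrow> (\<exists>f. embeds G H f)"
  by (simp add: contains_induced_def embeds_def)

text \<open>A family lives on its own vertex type and does not determine that of the host graph;
  hence the \<open>itself\<close> argument.\<close>

definition stuck_family :: "'a itself \<Rightarrow> 'b sgraph set \<Rightarrow> bool" where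
  "stuck_family (_ :: 'a itself) Fam \<longleftrightarrow> (\<forall>(G :: 'a sgraph) X. \<forall>H\<in>Fam. \<forall>f. bigraph G X \<longrightarrow> embeds G H f \<longrightarrow>
     sbg.stuck (adj G) (neg G) (\<lambda>u. u \<in> X) (f ` verts H))"

context bigraph
begin

text \<open>By colour, \<open>N(uv)\<close> splits into the other neighbours of \<open>u\<close> and
  the other neighbours of \<open>v\<close>, so the biclique condition only concerns the ends of
  paths \<open>b u v a\<close>.\<close>

lemma signed_simplicial_iff:
  "signed_simplicial G X u v \<longleftrightarrow> adj G u v \<and>
     (\<forall>a b. a \<noteq> u \<and> b \<noteq> v \<and> adj G u b \<and> adj G v a \<longrightarrow> adj G a b \<and> \<not> neg G a b)"
proof -
  have nbr: "a \<in> edge_nbhd G u v \<longleftrightarrow> a \<noteq> u \<and> a \<noteq> v \<and> (adj G u a \<or> adj G v a)" for a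
    by (auto simp: edge_nbhd_def nbhd_def adj_def)
  have pos: "{a, b} \<in> edges G \<longrightarrow> pos G {a, b} \<longleftrightarrow> \<not> neg G a b" for a b
    by (auto simp: neg_def)
  show ?thesis
  proof
    assume s: "signed_simplicial G X u v"
    then have uv: "adj G u v" by (simp add: signed_simplicial_def adj_def)
    have pb: "\<not> neg G a b" "a \<in> X \<Longrightarrow> b \<in> verts G - X \<Longrightarrow> adj G a b"
      if "a \<in> edge_nbhd G u v" "b \<in> edge_nbhd G u v" for a b
      using s that unfolding signed_simplicial_def positive_biclique_def neg_def adj_def by blast+
    have "adj G a b \<and> \<not> neg G a b" if h: "a \<noteq> u" "b \<noteq> v" "adj G u b" "adj G v a" for a b
    proof -
      have "a \<noteq> v" "b \<noteq> u" using h E_irrefl by blast+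
      then have n: "a \<in> edge_nbhd G u v" "b \<in> edge_nbhd G u v" using h nbr by auto
      have "(a \<in> X) \<noteq> (b \<in> X)" using E_col[OF h(3)] E_col[OF h(4)] E_col[OF uv] by blast
      moreover have "a \<in> verts G" "b \<in> verts G" using h E_V2 by blast+
      ultimately have "adj G a b" using pb(2)[OF n] pb(2)[OF n(2,1)] E_sym by blast
      then show ?thesis using pb(1)[OF n] by blast
    qed
    then show "adj G u v \<and> (\<forall>a b. a \<noteq> u \<and> b \<noteq> v \<and> adj G u b \<and> adj G v a \<longrightarrow> adj G a b \<and> \<not> neg G a b)"
      using uv by blast
  next
    assume h: "adj G u v \<and> (\<forall>a b. a \<noteq> u \<and> b \<noteq> v \<and> adj G u b \<and> adj G v a \<longrightarrow> adj G a b \<and> \<not> neg G a b)"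
    have key: "adj G a b \<and> \<not> neg G a b" if n: "a \<in> edge_nbhd G u v" "b \<in> edge_nbhd G u v" "(a \<in> X) \<noteq> (b \<in> X)" for a b
    proof -
      have "(adj G u a \<and> adj G v b) \<or> (adj G u b \<and> adj G v a)"
        using n(1,2)[unfolded nbr] n(3) conjunct1[OF h, THEN E_col]
          E_col[of u a] E_col[of v a] E_col[of u b] E_col[of v b] by blast
      moreover have "a \<noteq> u" "a \<noteq> v" "b \<noteq> u" "b \<noteq> v" using n(1,2)[unfolded nbr] by blast+
      ultimately have "adj G a b \<and> \<not> neg G a b \<or> adj G b a \<and> \<not> neg G b a" using conjunct2[OF h] by blast
      then show ?thesis using E_comm[of a b] Ng_comm[of a b] by blast
    qed
    have "positive_biclique G X (edge_nbhd G u v)"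
      unfolding positive_biclique_def
    proof (intro conjI ballI impI)
      fix a b assume ab: "a \<in> edge_nbhd G u v" "b \<in> edge_nbhd G u v" "{a, b} \<in> edges G"
      then have "(a \<in> X) \<noteq> (b \<in> X)" using E_col[of a b] by (simp add: adj_def)
      then show "pos G {a, b}" using key[OF ab(1,2)] ab(3) by (simp add: neg_def)
    next
      fix a b assume "a \<in> edge_nbhd G u v \<inter> X" "b \<in> edge_nbhd G u v \<inter> (verts G - X)"
      then show "{a, b} \<in> edges G" using key[of a b] by (simp add: adj_def)
    qed
    then show "signed_simplicial G X u v" using h by (simp add: signed_simplicial_def adj_def)
  qed
qed

lemma bigraph_delete: "bigraph (delete_edges G S) X"
  using sg bp by unfold_locales (auto simp: delete_edges_def signed_graph_def is_bipartition_def)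

lemma adj_delete: "adj (delete_edges G S) u v \<longleftrightarrow> adj G u v \<and> {u, v} \<notin> S"
  by (auto simp: adj_def delete_edges_def)

lemma neg_delete: "neg (delete_edges G S) u v \<longleftrightarrow> neg G u v \<and> {u, v} \<notin> S"
  by (auto simp: neg_def delete_edges_def)

text \<open>Consider the first edge inside \<open>W\<close> to be removed. All other edges inside
  \<open>W\<close> are then still present, and stuckness at its two ends contradicts
  simpliciality.\<close>

lemma stuck_not_chordal:
  assumes "stuck W"
  shows "\<not> chordal G X"
proof
  assume "chordal G X"
  then obtain es where es: "distinct es" "set es = edges G"
    "\<And>i. i < length es \<Longrightarrow> \<exists>u v. es ! i = {u, v} \<and> signed_simplicial (delete_edges G (set (take i es))) X u v"
    unfolding chordal_def by blast
  obtain a b where "a \<in> W" "b \<in> W" "adj G a b" using assms unfolding stuck_def has_edge_def by blast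
  then have ab: "{a, b} \<in> set es" "{a, b} \<subseteq> W" using es by (auto simp: adj_def)
  then obtain i0 where "i0 < length es" "es ! i0 \<subseteq> W" by (metis in_set_conv_nth)
  then obtain i where i: "i < length es" "es ! i \<subseteq> W" "\<And>j. j < i \<Longrightarrow> \<not> (es ! j \<subseteq> W)"
    using exists_least_iff[of "\<lambda>i. i < length es \<and> es ! i \<subseteq> W"] by (metis order.strict_trans)
  define S where "S = set (take i es)"
  interpret D: bigraph "delete_edges G S" X by (rule bigraph_delete)
  have nS: "e \<notin> S" if "e \<subseteq> W" for e
    using that i unfolding S_def by (auto simp: in_set_conv_nth)
  obtain u v where uv: "es ! i = {u, v}" "signed_simplicial (delete_edges G S) X u v"
    using es(3)[OF i(1)] unfolding S_def by blast
  then have W: "u \<in> W" "v \<in> W" using i(2) by auto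
  note s = uv(2)[unfolded D.signed_simplicial_iff adj_delete neg_delete]
  have "adj G u v" using s by blast
  then have col: "(u \<in> X) \<noteq> (v \<in> X)" by (rule E_col)
  obtain p q where pq: "p \<in> W" "q \<in> W" "adj G u p" "adj G v q" "p \<noteq> v" "q \<noteq> u" "\<not> adj G p q \<or> neg G p q"
    by (rule stuckE[OF assms W col])
  have "{u, p} \<notin> S" "{v, q} \<notin> S" "{q, p} \<notin> S" using nS pq W by auto
  then have "adj G q p \<and> \<not> neg G q p" using s pq by blast
  then show False using pq(7) E_sym Ng_sym by blast
qed

text \<open>A copy in the smaller graph that misses \<open>u\<close> or \<open>v\<close> is already
  a copy in \<open>G\<close>. Otherwise stuckness at \<open>u\<close>, \<open>v\<close> gives a path
  \<open>p u v q\<close> in \<open>G\<close> whose ends are non-adjacent or negatively joined, as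
  \<open>pq\<close> is not the deleted edge; this contradicts simpliciality.\<close>

lemma free_of_delete:
  fixes Fam :: "'b sgraph set"
  assumes st: "stuck_family TYPE('a) Fam" and free: "free_of G Fam" and s: "signed_simplicial G X u v"
  shows "free_of (delete_edges G {{u, v}}) Fam"
  unfolding free_of_def
proof (intro ballI notI)
  fix H assume H: "H \<in> Fam" "contains_induced (delete_edges G {{u, v}}) H"
  let ?D = "delete_edges G {{u, v}}"
  interpret D: bigraph ?D X by (rule bigraph_delete)
  obtain f where f: "embeds ?D H f" using H(2) contains_induced_embeds by blast
  define W where "W = f ` verts H"
  have W: "D.stuck W" using st H(1) f D.bigraph_axioms unfolding stuck_family_def W_def by blast
  show False
  proof (cases "u \<in> W \<and> v \<in> W")
    case False
    have "embeds G H f"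
      unfolding embeds_def
    proof (intro conjI ballI)
      show "inj_on f (verts H)" "f ` verts H \<subseteq> verts G"
        using f by (auto simp: embeds_def delete_edges_def)
      fix a b assume ab: "a \<in> verts H" "b \<in> verts H"
      then have "{f a, f b} \<noteq> {u, v}" using False by (auto simp: W_def doubleton_eq_iff)
      then show "({a, b} \<in> edges H) = ({f a, f b} \<in> edges G)"
        "{a, b} \<in> edges H \<longrightarrow> pos H {a, b} = pos G {f a, f b}"
        using f ab by (auto simp: embeds_def delete_edges_def)
    qed
    then show False using free H(1) contains_induced_embeds unfolding free_of_def by blast
  next
    case True
    note s' = s[unfolded signed_simplicial_iff]
    have col: "(u \<in> X) \<noteq> (v \<in> X)" using s' E_col by blast
    obtain p q where pq: "adj ?D u p" "adj ?D v q" "p \<noteq> v" "q \<noteq> u" "\<not> adj ?D p q \<or> neg ?D p q"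
      by (rule D.stuckE[OF W _ _ col]) (use True in blast)+
    then have pq': "adj G u p" "adj G v q" using adj_delete by blast+
    then have "p \<noteq> u" using E_irrefl by blast
    then have "{p, q} \<noteq> {u, v}" using pq by (auto simp: doubleton_eq_iff)
    then have "\<not> adj G p q \<or> neg G p q" using pq adj_delete[of "{{u, v}}"] neg_delete[of "{{u, v}}"] by auto
    then show False using s' pq pq' E_sym Ng_sym by blast
  qed
qed

lemma chordal_free_of:
  fixes Fam :: "'b sgraph set"
  assumes "stuck_family TYPE('a) Fam" "chordal G X"
  shows "free_of G Fam"
  using assms stuck_not_chordal bigraph_axioms contains_induced_embeds
  unfolding free_of_def stuck_family_def by metis

end

text \<open>An embedding constrained on the forced signs only. It works with the three edge sets of
  a family and needs no sign function on the pattern.\<close>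

definition emb :: "'a sgraph \<Rightarrow> 'b set \<Rightarrow> 'b set set \<Rightarrow> 'b set set \<Rightarrow> 'b set set \<Rightarrow> ('b \<Rightarrow> 'a) \<Rightarrow> bool" where
  "emb G W N P Fr f \<longleftrightarrow> inj_on f W \<and> f ` W \<subseteq> verts G \<and>
     (\<forall>a\<in>W. \<forall>b\<in>W. {a, b} \<in> N \<union> P \<union> Fr \<longleftrightarrow> adj G (f a) (f b)) \<and>
     (\<forall>a\<in>W. \<forall>b\<in>W. {a, b} \<in> N \<longrightarrow> \<not> pos G {f a, f b}) \<and> (\<forall>a\<in>W. \<forall>b\<in>W. {a, b} \<in> P \<longrightarrow> pos G {f a, f b})"

lemma emb_of_embeds:
  assumes "H \<in> sfam W N P Fr" "embeds G H f"
  shows "emb G W N P Fr f" "verts H = W"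
  using assms unfolding sfam_def embeds_def emb_def adj_def by auto

text \<open>The free signs are read off from \<open>G\<close>, which selects the member of the
  family.\<close>

lemma contains_of_emb:
  assumes e: "emb G W N P Fr f" and wf: "\<And>e. e \<in> N \<union> P \<Longrightarrow> \<exists>a\<in>W. \<exists>b\<in>W. e = {a, b}"
  shows "\<exists>H\<in>sfam W N P Fr. contains_induced G H"
proof -
  define H where "H = \<lparr>verts = W, edges = N \<union> P \<union> Fr, pos = (\<lambda>e. pos G (f ` e))\<rparr>"
  have "\<not> pos G (f ` d)" if d: "d \<in> N" for d
  proof -
    obtain a b where ab: "a \<in> W" "b \<in> W" "d = {a, b}" using wf[of d] d by blast
    then show ?thesis using e d unfolding emb_def by simp
  qed
  moreover have "pos G (f ` d)" if d: "d \<in> P" for d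
  proof -
    obtain a b where ab: "a \<in> W" "b \<in> W" "d = {a, b}" using wf[of d] d by blast
    then show ?thesis using e d unfolding emb_def by simp
  qed
  ultimately have "H \<in> sfam W N P Fr" by (simp add: sfam_def H_def)
  moreover have "embeds G H f"
    using e unfolding embeds_def H_def emb_def adj_def by simp
  ultimately show ?thesis using contains_induced_embeds by blast
qed

lemma not_emb_of_free_of:
  assumes "free_of G Fam" "sfam W N P Fr \<subseteq> Fam" "\<And>e. e \<in> N \<union> P \<Longrightarrow> \<exists>a\<in>W. \<exists>b\<in>W. e = {a, b}"
  shows "\<not> emb G W N P Fr f"
  using contains_of_emb[OF _ assms(3)] assms(1,2) unfolding free_of_def by blast

lemma stuck_family_sfam:
  assumes "\<And>(G :: 'a sgraph) X f. bigraph G X \<Longrightarrow> emb G W N P Fr f \<Longrightarrow>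
    sbg.stuck (adj G) (neg G) (\<lambda>u. u \<in> X) (f ` W)"
  shows "stuck_family TYPE('a) (sfam W N P Fr)"
  unfolding stuck_family_def using assms emb_of_embeds by metis

lemma embD:
  assumes "emb G W N P Fr f"
  shows "inj_on f W" "\<And>a. a \<in> W \<Longrightarrow> f a \<in> verts G"
    "\<And>a b. \<lbrakk>a \<in> W; b \<in> W\<rbrakk> \<Longrightarrow> {a, b} \<in> N \<union> P \<union> Fr \<longleftrightarrow> adj G (f a) (f b)"
    "\<And>a b. \<lbrakk>a \<in> W; b \<in> W; {a, b} \<in> N\<rbrakk> \<Longrightarrow> neg G (f a) (f b)"
proof -
  show "inj_on f W" "\<And>a. a \<in> W \<Longrightarrow> f a \<in> verts G"
    and 1: "\<And>a b. \<lbrakk>a \<in> W; b \<in> W\<rbrakk> \<Longrightarrow> {a, b} \<in> N \<union> P \<union> Fr \<longleftrightarrow> adj G (f a) (f b)"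
    using assms unfolding emb_def by blast+
  show "neg G (f a) (f b)" if ab: "a \<in> W" "b \<in> W" "{a, b} \<in> N" for a b
  proof -
    have "adj G (f a) (f b)" using 1[OF ab(1,2)] ab(3) by blast
    moreover have "\<not> pos G {f a, f b}" using assms ab unfolding emb_def by blast
    ultimately show ?thesis by (simp add: adj_def neg_def)
  qed
qed

subsection \<open>The families of bounded size\<close>

definition dbl :: "(nat \<times> nat) list \<Rightarrow> nat set set" where
  "dbl L = (\<lambda>(a, b). {a, b}) ` set L"

lemma dbl_iff: "{a, b} \<in> dbl L \<longleftrightarrow> (a, b) \<in> set L \<or> (b, a) \<in> set L"
  unfolding dbl_def by (force simp: doubleton_eq_iff)

text \<open>The third condition says that the bipartition is determined by the edges.\<close>
definition small_config :: "nat list \<Rightarrow> nat list \<Rightarrow> (nat \<times> nat) list \<Rightarrow> (nat \<times> nat) list \<Rightarrow> bool" where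
  "small_config A B NL FL \<longleftrightarrow> NL \<noteq> [] \<and> (\<forall>(a, b)\<in>set (NL @ FL). a \<in> set A \<and> b \<in> set B) \<and>
     (\<forall>k::nat \<Rightarrow> bool. (\<forall>(a, b)\<in>set (NL @ FL). k a \<noteq> k b) \<longrightarrow>
        (\<exists>d. (\<forall>a\<in>set A. k a = d) \<and> (\<forall>b\<in>set B. k b \<noteq> d))) \<and>
     set A \<inter> set B = {} \<and>
     (\<forall>a\<in>set A. \<forall>b\<in>set B. \<exists>p\<in>set B. \<exists>q\<in>set A. (a, p) \<in> set (NL @ FL) \<and> (q, b) \<in> set (NL @ FL) \<and>
        p \<noteq> b \<and> q \<noteq> a \<and> ((q, p) \<notin> set (NL @ FL) \<or> (q, p) \<in> set NL))"

lemma small_configD: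
  assumes sc: "small_config A B NL FL"
  shows "NL \<noteq> []" "set A \<inter> set B = {}"
    "\<And>a b. (a, b) \<in> set (NL @ FL) \<Longrightarrow> a \<in> set A \<and> b \<in> set B"
    "\<And>k :: nat \<Rightarrow> bool. (\<And>a b. (a, b) \<in> set (NL @ FL) \<Longrightarrow> k a \<noteq> k b) \<Longrightarrow> \<exists>d. (\<forall>a\<in>set A. k a = d) \<and> (\<forall>b\<in>set B. k b \<noteq> d)"
    "\<And>a b. a \<in> set A \<Longrightarrow> b \<in> set B \<Longrightarrow> \<exists>p q. p \<in> set B \<and> q \<in> set A \<and> (a, p) \<in> set (NL @ FL) \<and>
      (q, b) \<in> set (NL @ FL) \<and> p \<noteq> b \<and> q \<noteq> a \<and> ((q, p) \<notin> set (NL @ FL) \<or> (q, p) \<in> set NL)"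
proof -
  note d = sc[unfolded small_config_def]
  show "NL \<noteq> []" "set A \<inter> set B = {}" using d by blast+
  show "a \<in> set A \<and> b \<in> set B" if "(a, b) \<in> set (NL @ FL)" for a b
    using d[THEN conjunct2, THEN conjunct1] that by blast
  show "\<exists>d. (\<forall>a\<in>set A. k a = d) \<and> (\<forall>b\<in>set B. k b \<noteq> d)"
    if k: "\<And>a b. (a, b) \<in> set (NL @ FL) \<Longrightarrow> k a \<noteq> k b" for k :: "nat \<Rightarrow> bool"
  proof -
    have "\<forall>(a, b)\<in>set (NL @ FL). k a \<noteq> k b" using k by blast
    then show ?thesis
      using spec[OF d[THEN conjunct2, THEN conjunct2, THEN conjunct1], of k] by simp
  qed
  show "\<exists>p q. p \<in> set B \<and> q \<in> set A \<and> (a, p) \<in> set (NL @ FL) \<and>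
      (q, b) \<in> set (NL @ FL) \<and> p \<noteq> b \<and> q \<noteq> a \<and> ((q, p) \<notin> set (NL @ FL) \<or> (q, p) \<in> set NL)"
    if "a \<in> set A" "b \<in> set B" for a b
    using bspec[OF bspec[OF d[THEN conjunct2, THEN conjunct2, THEN conjunct2, THEN conjunct2] that(1)] that(2)]
    by blast
qed

lemma small_config_edge_iff:
  assumes "small_config A B NL FL" "a \<in> set A" "b \<in> set B"
  shows "{a, b} \<in> dbl NL \<union> {} \<union> dbl FL \<longleftrightarrow> (a, b) \<in> set (NL @ FL)" "{a, b} \<in> dbl NL \<longleftrightarrow> (a, b) \<in> set NL"
proof -
  have "(b, a) \<notin> set (NL @ FL)" using small_configD(2,3)[OF assms(1)] assms(3) by blast
  then show "{a, b} \<in> dbl NL \<union> {} \<union> dbl FL \<longleftrightarrow> (a, b) \<in> set (NL @ FL)" "{a, b} \<in> dbl NL \<longleftrightarrow> (a, b) \<in> set NL"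
    by (auto simp: dbl_iff)
qed

lemma stuck_small_config:
  assumes sc: "small_config A B NL FL"
  shows "stuck_family TYPE('a) (sfam (set A \<union> set B) (dbl NL) {} (dbl FL))"
proof (rule stuck_family_sfam)
  fix G :: "'a sgraph" and X f
  assume "bigraph G X" and e: "emb G (set A \<union> set B) (dbl NL) {} (dbl FL) f"
  then interpret bigraph G X by simp
  note d = embD[OF e]
  have Ed: "adj G (f a) (f b) \<longleftrightarrow> (a, b) \<in> set (NL @ FL)" if "a \<in> set A" "b \<in> set B" for a b
    using d(3)[of a b] small_config_edge_iff(1)[OF sc that] that by simp
  have Nd: "neg G (f a) (f b)" if "a \<in> set A" "b \<in> set B" "(a, b) \<in> set NL" for a b
    using d(4)[of a b] small_config_edge_iff(2)[OF sc that(1,2)] that by simp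
  have wf: "a \<in> set A \<and> b \<in> set B" if "(a, b) \<in> set (NL @ FL)" for a b
    using small_configD(3)[OF sc that] .
  have "(f a \<in> X) \<noteq> (f b \<in> X)" if "(a, b) \<in> set (NL @ FL)" for a b
    using wf[OF that] Ed that E_col by blast
  then obtain k where k: "\<And>a. a \<in> set A \<Longrightarrow> (f a \<in> X) = k" "\<And>b. b \<in> set B \<Longrightarrow> (f b \<in> X) \<noteq> k"
    using small_configD(4)[OF sc, of "\<lambda>i. f i \<in> X"] by blast
  have inj: "f a = f b \<longleftrightarrow> a = b" if "a \<in> set A \<union> set B" "b \<in> set A \<union> set B" for a b
    using inj_on_eq_iff[OF d(1) that] .
  define Q where "Q = (\<lambda>u v. \<exists>p\<in>f ` (set A \<union> set B). \<exists>q\<in>f ` (set A \<union> set B).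
    adj G u p \<and> adj G v q \<and> p \<noteq> v \<and> q \<noteq> u \<and> (\<not> adj G p q \<or> neg G p q))"
  have Qsym: "Q u v \<Longrightarrow> Q v u" for u v unfolding Q_def using E_comm Ng_comm by metis
  have Q: "Q (f a) (f b)" if ab: "a \<in> set A" "b \<in> set B" for a b
  proof -
    obtain p q where pq: "p \<in> set B" "q \<in> set A" "(a, p) \<in> set (NL @ FL)" "(q, b) \<in> set (NL @ FL)"
      "p \<noteq> b" "q \<noteq> a" "(q, p) \<notin> set (NL @ FL) \<or> (q, p) \<in> set NL"
      using small_configD(5)[OF sc ab] by blast
    have "adj G (f a) (f p)" "adj G (f q) (f b)" "\<not> adj G (f q) (f p) \<or> neg G (f q) (f p)"
      using pq ab Ed Nd by blast+
    then have "adj G (f a) (f p)" "adj G (f b) (f q)" "\<not> adj G (f p) (f q) \<or> neg G (f p) (f q)"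
      using E_sym Ng_sym by blast+
    then show ?thesis unfolding Q_def
      using pq ab inj[of p b] inj[of q a]
      by (intro bexI[of _ "f p"] bexI[of _ "f q"] conjI) auto
  qed
  have "Q u v" if uv: "u \<in> f ` (set A \<union> set B)" "v \<in> f ` (set A \<union> set B)" "(u \<in> X) \<noteq> (v \<in> X)" for u v
  proof -
    obtain a b where ab: "a \<in> set A \<union> set B" "b \<in> set A \<union> set B" "u = f a" "v = f b" using uv by blast
    then consider "a \<in> set A" "b \<in> set B" | "b \<in> set A" "a \<in> set B" using uv(3) k by blast
    then show ?thesis using Q Qsym ab by cases auto
  qed
  moreover have "has_edge (f ` (set A \<union> set B))"
  proof -
    obtain a b where "(a, b) \<in> set NL" using small_configD(1)[OF sc] by (cases NL) auto
    then have "a \<in> set A" "b \<in> set B" "adj G (f a) (f b)" using wf[of a b] Ed by auto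
    then show ?thesis unfolding has_edge_def by blast
  qed
  ultimately show "stuck (f ` (set A \<union> set B))" unfolding stuck_def Q_def by blast
qed

text \<open>Injectivity and adjacency are asked only within and between the two given sides,
  respectively. The rest follows from colours: the bipartition of the pattern is forced, so the two
  sides are mapped to different colours.\<close>

lemma (in bigraph) free_of_small_config:
  assumes sc: "small_config A B NL FL" and free: "free_of G (sfam (set A \<union> set B) (dbl NL) {} (dbl FL))"
    and dist: "inj_on f (set A)" "inj_on f (set B)"
    and Ed: "\<forall>a\<in>set A. \<forall>b\<in>set B. adj G (f a) (f b) \<longleftrightarrow> (a, b) \<in> set (NL @ FL)"
    and Nd: "\<forall>(a, b)\<in>set NL. neg G (f a) (f b)"
  shows False
proof -
  have wf: "a \<in> set A \<and> b \<in> set B" if "(a, b) \<in> set (NL @ FL)" for a b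
    using small_configD(3)[OF sc that] .
  have "(f a \<in> X) \<noteq> (f b \<in> X)" if "(a, b) \<in> set (NL @ FL)" for a b
    using wf[OF that] Ed that E_col by blast
  then obtain k where k: "\<And>a. a \<in> set A \<Longrightarrow> (f a \<in> X) = k" "\<And>b. b \<in> set B \<Longrightarrow> (f b \<in> X) \<noteq> k"
    using small_configD(4)[OF sc, of "\<lambda>i. f i \<in> X"] by blast
  have disj: "set A \<inter> set B = {}" using small_configD(2)[OF sc] .
  obtain a0 b0 where "(a0, b0) \<in> set NL" using small_configD(1)[OF sc] by (cases NL) auto
  then have ab0: "a0 \<in> set A" "b0 \<in> set B" using wf[of a0 b0] by auto
  have V: "f a \<in> verts G" if a: "a \<in> set A" for a
  proof -
    obtain p where "p \<in> set B" "(a, p) \<in> set (NL @ FL)" using small_configD(5)[OF sc a ab0(2)] by blast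
    then have "adj G (f a) (f p)" using Ed a by blast
    then show ?thesis by (rule E_V)
  qed
  have V': "f b \<in> verts G" if b: "b \<in> set B" for b
  proof -
    obtain q where "q \<in> set A" "(q, b) \<in> set (NL @ FL)" using small_configD(5)[OF sc ab0(1) b] by blast
    then have "adj G (f q) (f b)" using Ed b by blast
    then show ?thesis by (rule E_V2)
  qed
  have nA: "(a, b) \<notin> set NL \<and> (a, b) \<notin> set FL" if "a \<in> set A \<and> b \<in> set A \<or> a \<in> set B" for a b
    using wf[of a b] that disj by auto
  have nE: "\<not> adj G (f a) (f b)" if "a \<in> set A \<and> b \<in> set A \<or> a \<in> set B \<and> b \<in> set B" for a b
    using E_col[of "f a" "f b"] k that by blast
  have "emb G (set A \<union> set B) (dbl NL) {} (dbl FL) f"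
    unfolding emb_def
  proof (intro conjI ballI impI)
    show "inj_on f (set A \<union> set B)"
    proof (rule inj_onI)
      fix a b assume ab: "a \<in> set A \<union> set B" "b \<in> set A \<union> set B" "f a = f b"
      then have "a \<in> set A \<and> b \<in> set A \<or> a \<in> set B \<and> b \<in> set B"
        using k(1)[of a] k(2)[of a] k(1)[of b] k(2)[of b] by auto
      then show "a = b" using inj_onD[OF dist(1) ab(3)] inj_onD[OF dist(2) ab(3)] by blast
    qed
    show "f ` (set A \<union> set B) \<subseteq> verts G" using V V' by blast
    fix a b assume ab: "a \<in> set A \<union> set B" "b \<in> set A \<union> set B"
    then consider "a \<in> set A" "b \<in> set B" | "b \<in> set A" "a \<in> set B" | "a \<in> set A \<and> b \<in> set A \<or> a \<in> set B \<and> b \<in> set B"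
      by blast
    then show "({a, b} \<in> dbl NL \<union> {} \<union> dbl FL) = adj G (f a) (f b)"
    proof cases
      case 1
      then show ?thesis using small_config_edge_iff(1)[OF sc 1] Ed by simp
    next
      case 2
      then show ?thesis using small_config_edge_iff(1)[OF sc 2] Ed E_comm[of "f a"] by (simp add: insert_commute)
    next
      case 3
      then have "{a, b} \<notin> dbl NL \<union> {} \<union> dbl FL" using nA[of a b] nA[of b a] by (auto simp: dbl_iff)
      then show ?thesis using nE[OF 3] by simp
    qed
    assume "{a, b} \<in> dbl NL"
    then have "(a, b) \<in> set NL \<or> (b, a) \<in> set NL" by (simp add: dbl_iff)
    then have "neg G (f a) (f b)" using Nd Ng_sym by blast
    then show "\<not> pos G {f a, f b}" by (simp add: neg_def)
  qed simp
  moreover have "\<exists>a\<in>set A \<union> set B. \<exists>b\<in>set A \<union> set B. e = {a, b}" if e: "e \<in> dbl NL \<union> {}" for e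
  proof -
    obtain a b where "(a, b) \<in> set NL" "e = {a, b}" using e unfolding dbl_def by auto
    then show ?thesis using wf[of a b] by auto
  qed
  ultimately show False using not_emb_of_free_of[OF free order.refl] by blast
qed

text \<open>In the order \<open>F\<^sub>1\<close> to \<open>F\<^sub>6\<close>, then
  \<open>D\<close>. All clauses are finite checks except the one about all colourings
  \<open>k\<close>, which follows by propagation along edges.\<close>

lemma small_config_F:
  "small_config [0,1] [2,3] [(0,2),(0,3),(1,2),(1,3)] []"
  "small_config [0,1] [2,3,4] [(0,2),(0,3),(1,3),(1,4)] [(0,4),(1,2)]"
  "small_config [0,1] [2,3,4,5] [(0,2),(0,3),(1,4),(1,5)] [(0,4),(0,5),(1,2),(1,3)]"
  "small_config [0,1,2] [3,4,5] [(0,3),(1,4),(2,5)] [(0,4),(0,5),(1,3),(1,5),(2,3),(2,4)]"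
  "small_config [0,1,2] [3,4,5] [(1,3),(2,4)] [(0,3),(0,4),(1,4),(1,5),(2,3),(2,5)]"
  "small_config [0,1,2,3] [4,5,6,7] [(0,4),(1,4),(2,5),(3,6),(3,7)]
     [(0,5),(1,5),(2,4),(2,6),(2,7),(3,4),(3,5)]"
  "small_config [0,1,2] [3,4,5] [(1,4)] [(0,3),(0,4),(1,3),(1,5),(2,4),(2,5)]"
  by (simp_all add: small_config_def) (intro allI impI; elim conjE; simp)+

lemma interval_nat_explicit:
  "{0..3::nat} = {0,1,2,3}" "{0..4::nat} = {0,1,2,3,4}" "{0..5::nat} = {0,1,2,3,4,5}"
  "{0..7::nat} = {0,1,2,3,4,5,6,7}"
  by auto

lemma fam_small_config:
  "famF1 = sfam (set [0,1] \<union> set [2,3]) (dbl [(0,2),(0,3),(1,2),(1,3)]) {} (dbl [])"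
  "famF2 = sfam (set [0,1] \<union> set [2,3,4]) (dbl [(0,2),(0,3),(1,3),(1,4)]) {} (dbl [(0,4),(1,2)])"
  "famF3 = sfam (set [0,1] \<union> set [2,3,4,5]) (dbl [(0,2),(0,3),(1,4),(1,5)]) {} (dbl [(0,4),(0,5),(1,2),(1,3)])"
  "famF4 = sfam (set [0,1,2] \<union> set [3,4,5]) (dbl [(0,3),(1,4),(2,5)]) {} (dbl [(0,4),(0,5),(1,3),(1,5),(2,3),(2,4)])"
  "famF5 = sfam (set [0,1,2] \<union> set [3,4,5]) (dbl [(1,3),(2,4)]) {} (dbl [(0,3),(0,4),(1,4),(1,5),(2,3),(2,5)])"
  "famF6 = sfam (set [0,1,2,3] \<union> set [4,5,6,7]) (dbl [(0,4),(1,4),(2,5),(3,6),(3,7)]) {}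
     (dbl [(0,5),(1,5),(2,4),(2,6),(2,7),(3,4),(3,5)])"
  "famD = sfam (set [0,1,2] \<union> set [3,4,5]) (dbl [(1,4)]) {} (dbl [(0,3),(0,4),(1,3),(1,5),(2,4),(2,5)])"
  unfolding famF1_def famF2_def famF3_def famF4_def famF5_def famF6_def famD_def interval_nat_explicit dbl_def
  by (simp_all add: insert_commute)

lemma stuck_family_F:
  "stuck_family TYPE('a) famF1" "stuck_family TYPE('a) famF2" "stuck_family TYPE('a) famF3"
  "stuck_family TYPE('a) famF4" "stuck_family TYPE('a) famF5" "stuck_family TYPE('a) famF6"
  "stuck_family TYPE('a) famD"
  unfolding fam_small_config by (intro stuck_small_config small_config_F)+

context bigraph
begin

lemma free_of_F1:
  assumes "free_of G famF1" "neg G a1 b1" "neg G a1 b2" "neg G a2 b1" "neg G a2 b2" "a1 \<noteq> a2" "b1 \<noteq> b2"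
  shows False
  by (rule free_of_small_config[OF small_config_F(1) assms(1)[unfolded fam_small_config],
        where f = "\<lambda>i. [a1, a2, b1, b2] ! i"])
    (use assms Ng_E in \<open>simp_all\<close>)

lemma free_of_F2:
  assumes "free_of G famF2" "neg G a1 b1" "neg G a1 b2" "neg G a2 b2" "neg G a2 b3" "adj G a1 b3" "adj G a2 b1"
    "a1 \<noteq> a2" "b1 \<noteq> b2" "b1 \<noteq> b3" "b2 \<noteq> b3"
  shows False
  by (rule free_of_small_config[OF small_config_F(2) assms(1)[unfolded fam_small_config],
        where f = "\<lambda>i. [a1, a2, b1, b2, b3] ! i"])
    (use assms Ng_E in \<open>simp_all\<close>)

lemma free_of_F3:
  assumes "free_of G famF3" "neg G a1 b1" "neg G a1 b2" "neg G a2 b3" "neg G a2 b4"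
    "adj G a1 b3" "adj G a1 b4" "adj G a2 b1" "adj G a2 b2" "a1 \<noteq> a2" "distinct [b1, b2, b3, b4]"
  shows False
  by (rule free_of_small_config[OF small_config_F(3) assms(1)[unfolded fam_small_config],
        where f = "\<lambda>i. [a1, a2, b1, b2, b3, b4] ! i"])
    (use assms Ng_E in \<open>simp_all\<close>)

lemma free_of_F4:
  assumes "free_of G famF4" "neg G a1 b1" "neg G a2 b2" "neg G a3 b3" "adj G a1 b2" "adj G a1 b3"
    "adj G a2 b1" "adj G a2 b3" "adj G a3 b1" "adj G a3 b2" "distinct [a1, a2, a3]" "distinct [b1, b2, b3]"
  shows False
  by (rule free_of_small_config[OF small_config_F(4) assms(1)[unfolded fam_small_config],
        where f = "\<lambda>i. [a1, a2, a3, b1, b2, b3] ! i"])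
    (use assms Ng_E in \<open>simp_all\<close>)

lemma free_of_F5:
  assumes "free_of G famF5" "adj G a1 b1" "adj G a1 b2" "neg G a2 b1" "adj G a2 b2" "adj G a2 b3"
    "adj G a3 b1" "neg G a3 b2" "adj G a3 b3" "\<not> adj G a1 b3" "a2 \<noteq> a3" "b1 \<noteq> b2"
  shows False
proof -
  \<comment> \<open>The remaining vertices are distinct because their neighbourhoods differ at the
    non-edge \<open>a1 b3\<close>.\<close>
  have "a1 \<noteq> a2" "a1 \<noteq> a3" "b1 \<noteq> b3" "b2 \<noteq> b3" using assms by auto
  then show False
    by (intro free_of_small_config[OF small_config_F(5) assms(1)[unfolded fam_small_config],
          where f = "\<lambda>i. [a1, a2, a3, b1, b2, b3] ! i"])
      (use assms Ng_E in \<open>simp_all\<close>)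
qed

lemma free_of_F6:
  assumes "free_of G famF6" "neg G a1 b1" "adj G a1 b2" "neg G a2 b1" "adj G a2 b2" "adj G a3 b1"
    "neg G a3 b2" "adj G a3 b3" "adj G a3 b4" "adj G a4 b1" "adj G a4 b2" "neg G a4 b3" "neg G a4 b4"
    "\<not> adj G a1 b3" "\<not> adj G a1 b4" "\<not> adj G a2 b3" "\<not> adj G a2 b4"
    "a1 \<noteq> a2" "a3 \<noteq> a4" "b1 \<noteq> b2" "b3 \<noteq> b4"
  shows False
proof -
  have "adj G a4 b3" "adj G a1 b1" "adj G a4 b4" using assms Ng_E by blast+
  then have "a1 \<noteq> a3" "a1 \<noteq> a4" "a2 \<noteq> a3" "a2 \<noteq> a4" "b1 \<noteq> b3" "b2 \<noteq> b3" "b1 \<noteq> b4" "b2 \<noteq> b4"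
    using assms by auto
  then show False
    by (intro free_of_small_config[OF small_config_F(6) assms(1)[unfolded fam_small_config],
          where f = "\<lambda>i. [a1, a2, a3, a4, b1, b2, b3, b4] ! i"])
      (use assms Ng_E in \<open>simp_all\<close>)
qed

lemma free_of_D:
  assumes "free_of G famD" "adj G a1 b1" "adj G a1 b2" "adj G a2 b1" "neg G a2 b2" "adj G a2 b3"
    "adj G a3 b2" "adj G a3 b3" "\<not> adj G a1 b3" "\<not> adj G a3 b1"
  shows False
proof -
  have "a1 \<noteq> a2" "a1 \<noteq> a3" "a2 \<noteq> a3" "b1 \<noteq> b2" "b1 \<noteq> b3" "b2 \<noteq> b3" using assms by auto
  then show False
    by (intro free_of_small_config[OF small_config_F(7) assms(1)[unfolded fam_small_config],
          where f = "\<lambda>i. [a1, a2, a3, b1, b2, b3] ! i"])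
      (use assms Ng_E in \<open>simp_all\<close>)
qed

end

subsection \<open>Holes\<close>

definition cyc_adj :: "nat \<Rightarrow> nat \<Rightarrow> nat \<Rightarrow> bool" where
  "cyc_adj n a b \<longleftrightarrow> b = Suc a \<or> a = Suc b \<or> (a = 0 \<and> b = n - 1) \<or> (b = 0 \<and> a = n - 1)"

lemma cyc_edge_iff:
  assumes "a < n" "b < n" "2 \<le> n"
  shows "{a, b} \<in> {{i, Suc i mod n} | i. i < n} \<longleftrightarrow> cyc_adj n a b"
proof -
  have m: "Suc i mod n = (if i = n - 1 then 0 else Suc i)" if "i < n" for i
    using that by (auto simp: mod_if)
  have "{a, b} \<in> {{i, Suc i mod n} | i. i < n} \<longleftrightarrow> b = Suc a mod n \<or> a = Suc b mod n"
    using assms by (auto simp: doubleton_eq_iff)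
  also have "\<dots> \<longleftrightarrow> cyc_adj n a b"
    unfolding m[OF assms(1)] m[OF assms(2)] cyc_adj_def using assms by auto
  finally show ?thesis .
qed

lemma cyc_adj_sym: "cyc_adj n a b \<longleftrightarrow> cyc_adj n b a"
  by (auto simp: cyc_adj_def)

text \<open>Consecutive vertices step away from each other, to distance three, which is no adjacency
  in a cycle of length at least six. For any other pair both vertices move one step in the same
  direction; their distance, and so non-adjacency, is kept.\<close>

lemma cyc_stuck:
  assumes n: "6 \<le> n" and ij: "i < j" "j < n"
  shows "\<exists>p<n. \<exists>q<n. cyc_adj n i p \<and> cyc_adj n j q \<and> p \<noteq> j \<and> q \<noteq> i \<and> \<not> cyc_adj n p q"
proof -
  define q where "q = (if j = n - 1 then 0 else Suc j)"
  consider "j = Suc i" | "i = 0" "j = n - 1" | "j \<noteq> Suc i" "\<not> (i = 0 \<and> j = n - 1)" by blast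
  then show ?thesis
  proof cases
    case 1
    define p where "p = (if i = 0 then n - 1 else i - 1)"
    show ?thesis
      by (rule exI[of _ p], rule conjI[OF _ exI[of _ q]])
        (use assms 1 in \<open>auto simp: p_def q_def cyc_adj_def split: if_splits\<close>)
  next
    case 2
    show ?thesis
      by (rule exI[of _ 1], rule conjI[OF _ exI[of _ "n - 2"]])
        (use assms 2 in \<open>auto simp: cyc_adj_def\<close>)
  next
    case 3
    show ?thesis
      by (rule exI[of _ "Suc i"], rule conjI[OF _ exI[of _ q]])
        (use assms 3 in \<open>auto simp: q_def cyc_adj_def split: if_splits\<close>)
  qed
qed

lemma stuck_family_C: "stuck_family TYPE('a) famC"
proof -
  have st: "stuck_family TYPE('a) (sfam {0..<2 * k} {} {} {{i, Suc i mod (2 * k)} | i. i < 2 * k})" if k: "3 \<le> k" for k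
  proof (rule stuck_family_sfam)
    fix G :: "'a sgraph" and X f
    assume "bigraph G X" and e: "emb G {0..<2 * k} {} {} {{i, Suc i mod (2 * k)} | i. i < 2 * k} f"
    then interpret bigraph G X by simp
    define n where "n = 2 * k"
    note d = embD[OF e, folded n_def]
    have n6: "6 \<le> n" using k by (simp add: n_def)
    have Ed: "adj G (f a) (f b) \<longleftrightarrow> cyc_adj n a b" if "a < n" "b < n" for a b
      using d(3)[of a b] cyc_edge_iff[OF that] that n6 by simp
    have inj: "f a = f b \<longleftrightarrow> a = b" if "a < n" "b < n" for a b
      using inj_on_eq_iff[OF d(1)] that by simp
    have main: "\<exists>p<n. \<exists>q<n. cyc_adj n i p \<and> cyc_adj n j q \<and> p \<noteq> j \<and> q \<noteq> i \<and> \<not> cyc_adj n p q"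
      if "i \<noteq> j" "i < n" "j < n" for i j
      using cyc_stuck[OF n6, of i j] cyc_stuck[OF n6, of j i] that cyc_adj_sym
      by (cases "i < j") (blast, metis linorder_neqE_nat)
    have "has_edge (f ` {0..<n})"
    proof -
      have "adj G (f 0) (f 1)" using Ed[of 0 1] n6 by (simp add: cyc_adj_def)
      then show ?thesis using n6 unfolding has_edge_def by (intro bexI[of _ "f 0"] bexI[of _ "f 1"]) auto
    qed
    then show "stuck (f ` {0..<2 * k})"
      unfolding stuck_def n_def[symmetric]
    proof (intro conjI ballI impI)
      fix u v assume uv: "u \<in> f ` {0..<n}" "v \<in> f ` {0..<n}" and col: "(u \<in> X) \<noteq> (v \<in> X)"
      obtain i where i: "i \<in> {0..<n}" "u = f i" using uv(1) by blast
      obtain j where j: "j \<in> {0..<n}" "v = f j" using uv(2) by blast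
      have ij: "i < n" "j < n" "u = f i" "v = f j" using i j by auto
      then have "i \<noteq> j" using col by auto
      then obtain p q where pq: "p < n" "q < n" "cyc_adj n i p" "cyc_adj n j q" "p \<noteq> j" "q \<noteq> i" "\<not> cyc_adj n p q"
        using main ij by blast
      then show "\<exists>p\<in>f ` {0..<n}. \<exists>q\<in>f ` {0..<n}. adj G u p \<and> adj G v q \<and> p \<noteq> v \<and> q \<noteq> u \<and> (\<not> adj G p q \<or> neg G p q)"
        using ij Ed inj by (intro bexI[of _ "f p"] bexI[of _ "f q"]) auto
    qed
  qed
  show ?thesis
    unfolding stuck_family_def
  proof (intro allI ballI impI)
    fix G :: "'a sgraph" and X H f
    assume H: "H \<in> famC" and GX: "bigraph G X" "embeds G H f"
    obtain k where "3 \<le> k" "H \<in> sfam {0..<2 * k} {} {} {{i, Suc i mod (2 * k)} | i. i < 2 * k}"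
      using H unfolding famC_def by auto
    then show "sbg.stuck (adj G) (neg G) (\<lambda>u. u \<in> X) (f ` verts H)"
      using st[of k] GX unfolding stuck_family_def by blast
  qed
qed

lemma (in bigraph) free_of_C:
  assumes free: "free_of G famC" and q: "ipl q" "length q \<ge> 4" "v \<notin> set q"
    and v: "\<And>u. u \<in> set q \<Longrightarrow> adj G v u \<longleftrightarrow> u = hd q \<or> u = last q"
  shows False
proof -
  define m where "m = length q"
  have qne: "q \<noteq> []" using q by auto
  have hd: "hd q = q ! 0" "last q = q ! (m - 1)" using qne by (auto simp: hd_conv_nth last_conv_nth m_def)
  have ends: "adj G v (q ! 0)" "adj G v (q ! (m - 1))" using v[of "hd q"] v[of "last q"] hd_in_set[OF qne] last_in_set[OF qne] hd by metis+
  have "(q ! (m - 1) \<in> X) = ((q ! 0 \<in> X) = even (m - 1))"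
    using ipl_colour[OF q(1), of "m - 1"] qne by (simp add: m_def)
  \<comment> \<open>Both ends of \<open>q\<close> have the colour opposite to \<open>v\<close>, so
    \<open>q\<close> has an odd number of vertices and the cycle an even one.\<close>
  then have ev: "even (m - 1)" using E_col[OF ends(1)] E_col[OF ends(2)] by blast
  define k where "k = (m + 1) div 2"
  have m: "m = 2 * k - 1" "3 \<le> k" using ev q(2) unfolding k_def m_def by presburger+
  define n where "n = 2 * k"
  have mn: "n = Suc m" "6 \<le> n" using m by (auto simp: n_def)
  define f where "f = (\<lambda>i. (v # q) ! i)"
  have f0: "f 0 = v" "\<And>i. f (Suc i) = q ! i" by (auto simp: f_def)
  have dist: "distinct (v # q)" using ipl_distinct[OF q(1)] q(3) by simp
  have inj: "inj_on f {0..<n}"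
    unfolding f_def by (rule inj_on_nth[OF dist]) (auto simp: mn m_def)
  have ix: "q ! i = q ! j \<longleftrightarrow> i = j" if "i < m" "j < m" for i j
    using nth_eq_iff_index_eq ipl_distinct[OF q(1)] that by (simp add: m_def)
  have vq: "adj G v (q ! i) \<longleftrightarrow> i = 0 \<or> i = m - 1" if "i < m" for i
    using v[of "q ! i"] hd ix[of i 0] ix[of i "m - 1"] that nth_mem[of i q] qne by (simp add: m_def)
  have "emb G {0..<n} {} {} {{i, Suc i mod n} | i. i < n} f"
    unfolding emb_def
  proof (intro conjI ballI)
    show "inj_on f {0..<n}" by (rule inj)
    have "v \<in> verts G" using ends E_V by blast
    moreover have "q ! i \<in> verts G" if "i < m" for i
    proof (cases i)
      case 0
      then show ?thesis using E_V2[OF ends(1)] by simp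
    next
      case (Suc j)
      then have "adj G (q ! j) (q ! i)" using ipl_nth[OF q(1), of j i] that by (simp add: m_def)
      then show ?thesis by (rule E_V2)
    qed
    ultimately show "f ` {0..<n} \<subseteq> verts G"
      using mn by (auto simp: f_def nth_Cons split: nat.splits)
    fix a b assume "a \<in> {0..<n}" "b \<in> {0..<n}"
    then have ab: "a < n" "b < n" by auto
    have "cyc_adj n a b \<longleftrightarrow> adj G (f a) (f b)"
    proof (cases a; cases b)
      assume "a = 0" "b = 0"
      then show ?thesis using mn by (auto simp: cyc_adj_def f0)
    next
      fix j assume "a = 0" "b = Suc j"
      then show ?thesis using ab mn vq[of j] by (auto simp: cyc_adj_def f0)
    next
      fix i assume "a = Suc i" "b = 0"
      then show ?thesis using ab mn vq[of i] E_comm[of v] by (auto simp: cyc_adj_def f0)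
    next
      fix i j assume "a = Suc i" "b = Suc j"
      then show ?thesis using ab mn ipl_nth[OF q(1), of i j] by (auto simp: cyc_adj_def f0 m_def)
    qed
    then show "({a, b} \<in> {} \<union> {} \<union> {{i, Suc i mod n} | i. i < n}) = adj G (f a) (f b)"
      using cyc_edge_iff[OF ab] mn by simp
  qed auto
  moreover have "sfam {0..<n} {} {} {{i, Suc i mod n} | i. i < n} \<subseteq> famC"
    unfolding famC_def n_def using m(2) by auto
  ultimately show False using not_emb_of_free_of[OF free] by blast
qed

subsection \<open>Sums and joins of tadpoles\<close>

definition tp_E :: "bool \<Rightarrow> nat \<Rightarrow> nat \<Rightarrow> tv set set" where
  "tp_E b t k = tp_Neg b t k \<union> tp_Free b k"

lemma tp_V_cases:
  assumes "u \<in> tp_V b k"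
  obtains "u = TW b" | "u = TY b" | "u = TZ b" | i where "u = TX b i" "1 \<le> i" "i \<le> k"
  using assms unfolding tp_V_def by auto

lemma tp_V_mem:
  "TW b \<in> tp_V b k" "TY b \<in> tp_V b k" "TZ b \<in> tp_V b k" "TX b i \<in> tp_V b k \<longleftrightarrow> 1 \<le> i \<and> i \<le> k"
  unfolding tp_V_def by auto

lemma tp_E_mem:
  "{TX b i, TX b j} \<in> tp_E b t k \<longleftrightarrow> (1 \<le> i \<and> i < k \<and> j = Suc i) \<or> (1 \<le> j \<and> j < k \<and> i = Suc j)"
  "{TX b i, TY b} \<in> tp_E b t k \<longleftrightarrow> i = k" "{TX b i, TZ b} \<in> tp_E b t k \<longleftrightarrow> i = k"
  "{TX b i, TW b} \<in> tp_E b t k \<longleftrightarrow> t = 2 \<and> i = k - 1"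
  "{TW b, TY b} \<in> tp_E b t k" "{TW b, TZ b} \<in> tp_E b t k" "{TY b, TZ b} \<notin> tp_E b t k"
  "{u} \<notin> tp_E b t k"
  "{TX b i, TX b j} \<notin> tp_Neg b t k"
  "{TX b i, TY b} \<in> tp_Neg b t k \<longleftrightarrow> i = k" "{TX b i, TZ b} \<in> tp_Neg b t k \<longleftrightarrow> i = k"
  "{TX b i, TW b} \<in> tp_Neg b t k \<longleftrightarrow> t = 2 \<and> i = k - 1"
  "{TW b, TY b} \<notin> tp_Neg b t k" "{TW b, TZ b} \<notin> tp_Neg b t k" "{TY b, TZ b} \<notin> tp_Neg b t k"
  "{u} \<notin> tp_Neg b t k"
  by (auto simp: tp_E_def tp_Neg_def tp_Free_def doubleton_eq_iff split: if_splits)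

lemma tp_E_wf:
  assumes "e \<in> tp_E b t k" "valid_tp t k"
  shows "\<exists>u\<in>tp_V b k. \<exists>v\<in>tp_V b k. u \<noteq> v \<and> e = {u, v}"
proof -
  consider "e = {TX b k, TY b}" | "e = {TX b k, TZ b}" | "t = 2" "e = {TW b, TX b (k - 1)}"
    | "e = {TW b, TY b}" | "e = {TW b, TZ b}" | i where "e = {TX b i, TX b (Suc i)}" "1 \<le> i" "i < k"
    using assms(1) unfolding tp_E_def tp_Neg_def tp_Free_def by (auto split: if_splits)
  then show ?thesis
  proof cases
    case 1
    show ?thesis by (rule bexI[of _ "TX b k"], rule bexI[of _ "TY b"])
      (use 1 assms(2) in \<open>auto simp: tp_V_mem valid_tp_def\<close>)
  next
    case 2
    show ?thesis by (rule bexI[of _ "TX b k"], rule bexI[of _ "TZ b"])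
      (use 2 assms(2) in \<open>auto simp: tp_V_mem valid_tp_def\<close>)
  next
    case 3
    show ?thesis by (rule bexI[of _ "TW b"], rule bexI[of _ "TX b (k - 1)"])
      (use 3 assms(2) in \<open>auto simp: tp_V_mem valid_tp_def\<close>)
  next
    case 4
    show ?thesis by (rule bexI[of _ "TW b"], rule bexI[of _ "TY b"]) (use 4 in \<open>auto simp: tp_V_mem\<close>)
  next
    case 5
    show ?thesis by (rule bexI[of _ "TW b"], rule bexI[of _ "TZ b"]) (use 5 in \<open>auto simp: tp_V_mem\<close>)
  next
    case (6 i)
    show ?thesis by (rule bexI[of _ "TX b i"], rule bexI[of _ "TX b (Suc i)"]) (use 6 in \<open>auto simp: tp_V_mem\<close>)
  qed
qed

lemma doubleton_swap: "{u, v} = {v, u}"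
  by (rule insert_commute)

lemma tp_Neg_subset: "tp_Neg b t k \<subseteq> tp_E b t k"
  by (auto simp: tp_E_def)

section \<open>Tagged tadpoles and vertex lists\<close>

context bigraph
begin

definition tp_emb :: "bool \<Rightarrow> nat \<Rightarrow> nat \<Rightarrow> (tv \<Rightarrow> 'a) \<Rightarrow> bool" where
  "tp_emb b t k f \<longleftrightarrow> inj_on f (tp_V b k) \<and>
     (\<forall>u\<in>tp_V b k. \<forall>v\<in>tp_V b k. {u, v} \<in> tp_E b t k \<longleftrightarrow> adj G (f u) (f v)) \<and>
     (\<forall>u\<in>tp_V b k. \<forall>v\<in>tp_V b k. {u, v} \<in> tp_Neg b t k \<longrightarrow> neg G (f u) (f v))"

lemma tp_emb_tad:
  assumes e: "tp_emb b t k f" and val: "valid_tp t k"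
  obtains p where "tad (f (TX b 1) # p) (f (TW b)) (f (TY b)) (f (TZ b))"
    "set p \<union> {f (TW b), f (TY b), f (TZ b)} = f ` (tp_V b k - {TX b 1})"
proof -
  have inj: "f u = f v \<longleftrightarrow> u = v" if "u \<in> tp_V b k" "v \<in> tp_V b k" for u v
    using e inj_on_eq_iff[OF _ that] unfolding tp_emb_def by blast
  have Ed: "adj G (f u) (f v) \<longleftrightarrow> {u, v} \<in> tp_E b t k" if "u \<in> tp_V b k" "v \<in> tp_V b k" for u v
    using e that unfolding tp_emb_def by blast
  have Nd: "neg G (f u) (f v)" if "u \<in> tp_V b k" "v \<in> tp_V b k" "{u, v} \<in> tp_Neg b t k" for u v
    using e that unfolding tp_emb_def by blast
  have k1: "1 \<le> k" using val by (auto simp: valid_tp_def)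
  define L where "L = map (\<lambda>i. f (TX b (Suc i))) [0..<k]"
  have len: "length L = k" by (simp add: L_def)
  have nth: "L ! i = f (TX b (Suc i))" if "i < k" for i using that by (simp add: L_def)
  have setL: "set L = (\<lambda>i. f (TX b i)) ` {1..k}"
    unfolding L_def by (auto simp: image_iff) (metis Suc_le_D Suc_le_eq One_nat_def atLeastLessThan_iff zero_le Suc_le_mono)
  have Lne: "L \<noteq> []" using k1 len by auto
  have lastL: "last L = f (TX b k)" using Lne nth[of "k - 1"] k1 by (simp add: last_conv_nth len)
  have mem: "TX b i \<in> tp_V b k" if "1 \<le> i" "i \<le> k" for i using that by (simp add: tp_V_mem)
  note tv = tp_V_mem(1-3)
  have dist: "distinct L"
    unfolding distinct_conv_nth len using nth inj mem by simp
  have "tad L (f (TW b)) (f (TY b)) (f (TZ b))"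
  proof (rule tadI)
    show "L \<noteq> []" by (rule Lne)
    show "ipl L"
      by (rule ipl_by_nth[OF dist]) (use len nth Ed mem in \<open>auto simp: tp_E_mem\<close>)
    show "f (TY b) \<noteq> f (TZ b)" using inj[OF tv(2,3)] by simp
    show "f (TW b) \<notin> set L" "f (TY b) \<notin> set L" "f (TZ b) \<notin> set L"
    proof -
      have "f (TW b) \<noteq> f (TX b i)" "f (TY b) \<noteq> f (TX b i)" "f (TZ b) \<noteq> f (TX b i)" if "1 \<le> i" "i \<le> k" for i
        using inj[OF tv(1) mem[OF that]] inj[OF tv(2) mem[OF that]] inj[OF tv(3) mem[OF that]] by simp_all
      then show "f (TW b) \<notin> set L" "f (TY b) \<notin> set L" "f (TZ b) \<notin> set L"
        unfolding setL image_iff Bex_def atLeastAtMost_iff by blast+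
    qed
    show "adj G u (f (TY b)) \<longleftrightarrow> u = last L" "adj G u (f (TZ b)) \<longleftrightarrow> u = last L" if u: "u \<in> set L" for u
    proof -
      obtain i where i: "1 \<le> i" "i \<le> k" "u = f (TX b i)" using u setL by auto
      have "u = last L \<longleftrightarrow> i = k" unfolding lastL i(3) using inj[OF mem mem] i k1 by auto
      then show "adj G u (f (TY b)) \<longleftrightarrow> u = last L" "adj G u (f (TZ b)) \<longleftrightarrow> u = last L"
        using Ed[OF mem tv(2)] Ed[OF mem tv(3)] i by (auto simp: tp_E_mem)
    qed
    show "neg G (last L) (f (TY b))" "neg G (last L) (f (TZ b))"
      unfolding lastL using Nd[OF mem tv(2)] Nd[OF mem tv(3)] k1 by (auto simp: tp_E_mem)
    show "adj G (f (TW b)) (f (TY b))" "adj G (f (TW b)) (f (TZ b))"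
      using Ed[OF tv(1,2)] Ed[OF tv(1,3)] by (auto simp: tp_E_mem)
    show "neg G u (f (TW b)) \<and> u = last (butlast L)" if u: "u \<in> set L" "adj G u (f (TW b))" for u
    proof -
      obtain i where i: "1 \<le> i" "i \<le> k" "u = f (TX b i)" using u setL by auto
      then have t2: "t = 2" "i = k - 1" using Ed[OF mem[OF i(1,2)] tv(1)] u by (auto simp: tp_E_mem)
      have "k \<ge> 2" using i t2 by simp
      then have "butlast L \<noteq> []" using len by (metis One_nat_def diff_is_0_eq length_butlast list.size(3) not_less_eq_eq numeral_2_eq_2)
      then have "last (butlast L) = L ! (k - 2)" using len \<open>k \<ge> 2\<close> by (simp add: last_conv_nth nth_butlast numeral_2_eq_2)
      also have "\<dots> = u" using nth[of "k - 2"] i t2 \<open>k \<ge> 2\<close> by (simp add: numeral_2_eq_2 Suc_diff_Suc)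
      finally have "u = last (butlast L)" by simp
      moreover have "neg G u (f (TW b))" using Nd[OF mem[OF i(1,2)] tv(1)] i t2 by (simp add: tp_E_mem)
      ultimately show ?thesis by blast
    qed
  qed
  moreover have Lc: "L = f (TX b 1) # tl L"
    using Lne nth[of 0] k1 by (cases L) auto
  ultimately have t: "tad (f (TX b 1) # tl L) (f (TW b)) (f (TY b)) (f (TZ b))" by simp
  have "set (tl L) = (\<lambda>i. f (TX b i)) ` {2..k}"
  proof -
    have "set (tl L) = set L - {f (TX b 1)}" using dist Lc by (metis Diff_insert_absorb distinct.simps(2) list.simps(15))
    also have "\<dots> = (\<lambda>i. f (TX b i)) ` {2..k}"
    proof -
      have "{1..k} = insert 1 {2..k}" using k1 by auto
      moreover have "f (TX b 1) \<notin> (\<lambda>i. f (TX b i)) ` {2..k}" using inj[OF mem mem] k1 by fastforce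
      ultimately show ?thesis unfolding setL by auto
    qed
    finally show ?thesis .
  qed
  moreover have "tp_V b k - {TX b 1} = {TW b, TY b, TZ b} \<union> TX b ` {2..k}"
    unfolding tp_V_def by (auto simp: image_iff)
  ultimately have "set (tl L) \<union> {f (TW b), f (TY b), f (TZ b)} = f ` (tp_V b k - {TX b 1})" by auto
  then show thesis using that t by blast
qed

text \<open>\<open>tad\<close> does not record the type; it is recovered from the presence of the
  chord at \<open>w\<close>.\<close>

definition tad_type :: "'a list \<Rightarrow> 'a \<Rightarrow> nat" where
  "tad_type p w = (if \<exists>u\<in>set p. adj G u w then 2 else 1)"

text \<open>Path vertices are numbered from \<open>1\<close> as \<open>TX b i\<close> and from
  \<open>0\<close> in the list, hence \<open>i - 1\<close> throughout. The chord of type 2 sits at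
  \<open>TX b (k - 1)\<close>, which is list position \<open>k - 2\<close>.\<close>

lemma tad_tp_emb:
  assumes t: "tad p w y z" and f: "\<And>i. i < length p \<Longrightarrow> f (TX b (Suc i)) = p ! i"
    "f (TW b) = w" "f (TY b) = y" "f (TZ b) = z"
  shows "valid_tp (tad_type p w) (length p)" "tp_emb b (tad_type p w) (length p) f"
    "f ` tp_V b (length p) = set p \<union> {w, y, z}"
proof -
  note d = tadD[OF t]
  define k where "k = length p"
  have k1: "1 \<le> k" using d(1) by (cases p) (auto simp: k_def)
  have lastp: "last p = p ! (k - 1)" using d(1) by (simp add: last_conv_nth k_def)
  have fx: "f (TX b i) = p ! (i - 1)" if "1 \<le> i" "i \<le> k" for i
    using f(1)[of "i - 1"] that by (simp add: k_def)
  have ix: "p ! (i - 1) = p ! (j - 1) \<longleftrightarrow> i = j" if "1 \<le> i" "i \<le> k" "1 \<le> j" "j \<le> k" for i j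
  proof -
    have "i - 1 = j - 1 \<longleftrightarrow> i = j" using that by auto
    then show ?thesis using nth_eq_iff_index_eq[OF ipl_distinct[OF d(2)], of "i - 1" "j - 1"] that by (auto simp: k_def)
  qed
  have inp: "p ! (i - 1) \<in> set p" if "1 \<le> i" "i \<le> k" for i using that by (simp add: k_def)
  have nw: "\<not> adj G (last p) w" using d(17) E_col by blast
  have k2: "2 \<le> k \<and> u = p ! (k - 2)" if u: "u \<in> set p" "adj G u w" for u
  proof -
    have "k \<noteq> 1"
    proof
      assume "k = 1"
      then have "u = last p" using u by (cases p) (auto simp: k_def)
      then show False using nw u by blast
    qed
    then have k: "2 \<le> k" using k1 by simp
    then have "butlast p \<noteq> []" by (cases p; cases "tl p") (auto simp: k_def)
    then have "last (butlast p) = p ! (k - 2)" using k by (simp add: last_conv_nth nth_butlast k_def numeral_2_eq_2)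
    then show ?thesis using d(16)[OF u] k by simp
  qed
  have E_w: "adj G (p ! (i - 1)) w \<longleftrightarrow> tad_type p w = 2 \<and> i = k - 1" if "1 \<le> i" "i \<le> k" for i
  proof
    assume a: "adj G (p ! (i - 1)) w"
    then have kk: "2 \<le> k" "p ! (i - 1) = p ! (k - 1 - 1)" using k2[OF inp[OF that]] by (auto simp: numeral_2_eq_2)
    then have "i = k - 1" using ix[of i "k - 1"] that by auto
    then show "tad_type p w = 2 \<and> i = k - 1" using a inp[OF that] by (auto simp: tad_type_def)
  next
    assume a: "tad_type p w = 2 \<and> i = k - 1"
    then obtain u where "u \<in> set p" "adj G u w" by (auto simp: tad_type_def split: if_splits)
    then show "adj G (p ! (i - 1)) w" using k2[of u] a by (auto simp: numeral_2_eq_2)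
  qed
  show "valid_tp (tad_type p w) (length p)"
    using k1 k2 by (auto simp: tad_type_def valid_tp_def k_def[symmetric])
  have setp: "set p = (\<lambda>i. p ! (i - 1)) ` {1..k}"
  proof -
    have "u \<in> (\<lambda>i. p ! (i - 1)) ` {1..k}" if u: "u \<in> set p" for u
    proof -
      obtain i where "i < k" "p ! i = u" using u by (auto simp: in_set_conv_nth k_def)
      then show ?thesis by (intro image_eqI[of _ _ "Suc i"]) auto
    qed
    then show ?thesis using inp by auto
  qed
  show "f ` tp_V b (length p) = set p \<union> {w, y, z}"
    unfolding tp_V_def setp k_def[symmetric] using fx f(2-4) by (auto simp: image_image)
  have e: "adj G (p ! (i - 1)) (p ! (j - 1)) \<longleftrightarrow> (i < k \<and> j = Suc i) \<or> (j < k \<and> i = Suc j)"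
    if "1 \<le> i" "i \<le> k" "1 \<le> j" "j \<le> k" for i j
    using ipl_nth[OF d(2), of "i - 1" "j - 1"] that by (auto simp: k_def)
  have ey: "adj G (p ! (i - 1)) y \<longleftrightarrow> i = k" "adj G (p ! (i - 1)) z \<longleftrightarrow> i = k" if "1 \<le> i" "i \<le> k" for i
    using d(7,8)[OF inp[OF that]] ix[OF that k1] lastp by auto
  have nyz: "\<not> adj G y z" "\<not> adj G z y" using d(18) E_col by auto
  have wyz: "adj G w y" "adj G w z" "adj G y w" "adj G z w" using d(11,12) E_sym by auto
  have ne: "w \<noteq> y" "w \<noteq> z" "y \<noteq> z" using d(3) wyz by auto
  have np: "p ! (i - 1) \<noteq> w" "p ! (i - 1) \<noteq> y" "p ! (i - 1) \<noteq> z" if "1 \<le> i" "i \<le> k" for i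
    using inp[OF that] d(4-6) by auto
  have sw: "{TY b, TW b} = {TW b, TY b}" "{TZ b, TW b} = {TW b, TZ b}" "{TZ b, TY b} = {TY b, TZ b}"
    by (rule doubleton_swap)+
  show "tp_emb b (tad_type p w) (length p) f"
    unfolding tp_emb_def k_def[symmetric]
  proof (intro conjI ballI impI)
    show "inj_on f (tp_V b k)"
    proof (rule inj_onI)
      fix u v assume u: "u \<in> tp_V b k" and v: "v \<in> tp_V b k" and eq: "f u = f v"
      show "u = v"
        using u
      proof (cases rule: tp_V_cases)
        case 1
        show ?thesis using v by (cases rule: tp_V_cases) (use 1 eq f(2-4) ne np fx in metis)+
      next
        case 2
        show ?thesis using v by (cases rule: tp_V_cases) (use 2 eq f(2-4) ne np fx in metis)+
      next
        case 3
        show ?thesis using v by (cases rule: tp_V_cases) (use 3 eq f(2-4) ne np fx in metis)+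
      next
        case (4 i)
        show ?thesis using v by (cases rule: tp_V_cases) (use 4 eq f(2-4) ne np fx ix in metis)+
      qed
    qed
    have half: "{u, v} \<in> tp_E b (tad_type p w) k \<longleftrightarrow> adj G (f u) (f v)"
      if "u = TX b i" "1 \<le> i" "i \<le> k" "v \<in> tp_V b k" for u v i
      using that(4)
    proof (cases rule: tp_V_cases)
      case 1
      then show ?thesis using that f(2) fx E_w by (simp add: tp_E_mem)
    next
      case 2
      then show ?thesis using that f(3) fx ey by (simp add: tp_E_mem)
    next
      case 3
      then show ?thesis using that f(4) fx ey by (simp add: tp_E_mem)
    next
      case (4 j)
      then show ?thesis using that fx e by (simp add: tp_E_mem)
    qed
    fix u v assume u: "u \<in> tp_V b k" and v: "v \<in> tp_V b k"
    show "{u, v} \<in> tp_E b (tad_type p w) k \<longleftrightarrow> adj G (f u) (f v)"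
    proof (cases "(\<exists>i. u = TX b i) \<or> (\<exists>j. v = TX b j)")
      case True
      then consider i where "u = TX b i" "1 \<le> i" "i \<le> k" | i where "v = TX b i" "1 \<le> i" "i \<le> k"
        using u v by (auto simp: tp_V_mem)
      then show ?thesis
      proof cases
        case (1 i)
        show ?thesis by (rule half[OF 1 v])
      next
        case (2 i)
        show ?thesis using half[OF 2 u] E_comm[of "f u" "f v"] doubleton_swap[of u v] by simp
      qed
    next
      case False
      then have "u \<in> {TW b, TY b, TZ b}" "v \<in> {TW b, TY b, TZ b}" using u v unfolding tp_V_def by auto
      then show ?thesis
        using wyz nyz f(2-4) by (auto simp: tp_E_mem sw)
    qed
    assume N: "{u, v} \<in> tp_Neg b (tad_type p w) k"
    have n1: "neg G (f u) (f v)" if u: "u = TX b i" "1 \<le> i" "i \<le> k" and v: "v \<in> tp_V b k"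
      and N: "{u, v} \<in> tp_Neg b (tad_type p w) k" for u v i
      using v
    proof (cases rule: tp_V_cases)
      case 1
      then have "tad_type p w = 2 \<and> i = k - 1" using N u(1) by (simp add: tp_E_mem)
      then have "adj G (p ! (i - 1)) w" using E_w[OF u(2,3)] by blast
      then have "neg G (p ! (i - 1)) w" by (rule d(15)[OF inp[OF u(2,3)]])
      then show ?thesis using 1 u(1) f(2) fx[OF u(2,3)] by simp
    next
      case 2
      then show ?thesis using d(9) lastp N u f(3) fx by (simp add: tp_E_mem)
    next
      case 3
      then show ?thesis using d(10) lastp N u f(4) fx by (simp add: tp_E_mem)
    next
      case (4 j)
      then show ?thesis using N u by (simp add: tp_E_mem)
    qed
    show "neg G (f u) (f v)"
    proof (cases "(\<exists>i. u = TX b i) \<or> (\<exists>j. v = TX b j)")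
      case True
      then consider i where "u = TX b i" "1 \<le> i" "i \<le> k" | i where "v = TX b i" "1 \<le> i" "i \<le> k"
        using u v by (auto simp: tp_V_mem)
      then show ?thesis
      proof cases
        case (1 i)
        show ?thesis by (rule n1[OF 1 v N])
      next
        case (2 i)
        have "{v, u} \<in> tp_Neg b (tad_type p w) k" using N doubleton_swap[of u v] by simp
        then show ?thesis using n1[OF 2 u] Ng_sym by blast
      qed
    next
      case False
      then have "u \<in> {TW b, TY b, TZ b}" "v \<in> {TW b, TY b, TZ b}" using u v unfolding tp_V_def by auto
      then show ?thesis
        using N by (auto simp: tp_E_mem sw)
    qed
  qed
qed

end

section \<open>Edges of a sum of tadpoles\<close>

lemma rename_edge_iff:
  assumes inj: "inj_on s V1" "inj_on s V2" and meet: "s ` V1 \<inter> s ` V2 \<subseteq> {x}"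
    and wf: "\<And>e. e \<in> M1 \<Longrightarrow> \<exists>a\<in>V1. \<exists>d\<in>V1. a \<noteq> d \<and> e = {a, d}"
      "\<And>e. e \<in> M2 \<Longrightarrow> \<exists>a\<in>V2. \<exists>d\<in>V2. a \<noteq> d \<and> e = {a, d}"
    and uv: "u \<in> V1" "v \<in> V1"
  shows "{s u, s v} \<in> (`) s ` (M1 \<union> M2) \<longleftrightarrow> {u, v} \<in> M1"
proof
  assume "{s u, s v} \<in> (`) s ` (M1 \<union> M2)"
  then obtain e where e: "e \<in> M1 \<union> M2" "s ` e = {s u, s v}" by auto
  show "{u, v} \<in> M1"
  proof (cases "e \<in> M1")
    case True
    then obtain a d where ad: "a \<in> V1" "d \<in> V1" "e = {a, d}" using wf(1) by blast
    then have "{s a, s d} = {s u, s v}" using e(2) by simp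
    then have "a = u \<and> d = v \<or> a = v \<and> d = u"
      using inj_on_eq_iff[OF inj(1)] ad(1,2) uv unfolding doubleton_eq_iff by blast
    then show ?thesis using True ad(3) by (auto simp: insert_commute)
  next
    case False
    \<comment> \<open>An edge of the second graph whose image lies in the image of \<open>V1\<close>
      has both ends mapped to \<open>x\<close>, against injectivity on \<open>V2\<close>.\<close>
    then obtain a d where ad: "a \<in> V2" "d \<in> V2" "a \<noteq> d" "e = {a, d}" using e wf(2) by blast
    then have "s a \<in> {s u, s v}" "s d \<in> {s u, s v}" using e(2) by auto
    then have "s a = x" "s d = x" using meet ad uv by blast+
    then show ?thesis using inj_onD[OF inj(2), of a d] ad by simp
  qed
next
  assume "{u, v} \<in> M1"
  then show "{s u, s v} \<in> (`) s ` (M1 \<union> M2)" by (intro image_eqI[of _ _ "{u, v}"]) auto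
qed

lemma rename_edge_cross:
  assumes meet: "s ` V1 \<inter> s ` V2 \<subseteq> {x}"
    and wf: "\<And>e. e \<in> M1 \<Longrightarrow> \<exists>a\<in>V1. \<exists>d\<in>V1. a \<noteq> d \<and> e = {a, d}"
      "\<And>e. e \<in> M2 \<Longrightarrow> \<exists>a\<in>V2. \<exists>d\<in>V2. a \<noteq> d \<and> e = {a, d}"
    and uv: "u \<in> V1" "v \<in> V2" and m: "{s u, s v} \<in> (`) s ` (M1 \<union> M2)"
  shows "s u = x \<or> s v = x"
proof -
  obtain e where e: "e \<in> M1 \<union> M2" "s ` e = {s u, s v}" using m by auto
  show ?thesis
  proof (cases "e \<in> M1")
    case True
    then have "e \<subseteq> V1" using wf(1) by blast
    then have "s v \<in> s ` V1" using image_mono[of e V1 s] e(2) by auto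
    then have "s v \<in> {x}" using meet imageI[OF uv(2), of s] by (intro subsetD[OF meet]) simp
    then show ?thesis by simp
  next
    case False
    then have "e \<subseteq> V2" using wf(2) e(1) by blast
    then have "s u \<in> s ` V2" using image_mono[of e V2 s] e(2) by auto
    then have "s u \<in> {x}" using meet imageI[OF uv(1), of s] by (intro subsetD[OF meet]) simp
    then show ?thesis by simp
  qed
qed

lemma sum_ren_props:
  "inj_on sum_ren (tp_V True k)" "inj_on sum_ren (tp_V False k)"
  "sum_ren ` tp_V True k \<inter> sum_ren ` tp_V False k' \<subseteq> {TX True 1}"
  "sum_ren ` tp_V False k' \<inter> sum_ren ` tp_V True k \<subseteq> {TX True 1}"
  "sum_ren (TX True 1) = TX True 1" "sum_ren (TX False 1) = TX True 1"
  by (auto simp: sum_ren_def inj_on_def tp_V_def split: if_splits)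

lemma sum_ren_eq:
  "u \<in> tp_V True k \<Longrightarrow> sum_ren u = TX True 1 \<longleftrightarrow> u = TX True 1"
  "u \<in> tp_V False k \<Longrightarrow> sum_ren u = TX True 1 \<longleftrightarrow> u = TX False 1"
  by (auto simp: sum_ren_def tp_V_def split: if_splits)

lemma sum_edges: "(`) sum_ren ` (N1 \<union> N2) \<union> {} \<union> (`) sum_ren ` (F1 \<union> F2) = (`) sum_ren ` ((N1 \<union> F1) \<union> (N2 \<union> F2))"
  by auto

lemma tp_Neg_wf:
  "e \<in> tp_Neg b t k \<Longrightarrow> valid_tp t k \<Longrightarrow> \<exists>u\<in>tp_V b k. \<exists>v\<in>tp_V b k. u \<noteq> v \<and> e = {u, v}"
  using tp_E_wf tp_Neg_subset by blast

lemma sum_edge_iff: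
  assumes val: "valid_tp t k" "valid_tp t' k'"
  defines "Ed \<equiv> (`) sum_ren ` (tp_Neg True t k \<union> tp_Neg False t' k') \<union> {} \<union> (`) sum_ren ` (tp_Free True k \<union> tp_Free False k')"
    and "Nd \<equiv> (`) sum_ren ` (tp_Neg True t k \<union> tp_Neg False t' k')"
  shows "\<lbrakk>u \<in> tp_V True k; v \<in> tp_V True k\<rbrakk> \<Longrightarrow> {sum_ren u, sum_ren v} \<in> Ed \<longleftrightarrow> {u, v} \<in> tp_E True t k"
    "\<lbrakk>u \<in> tp_V False k'; v \<in> tp_V False k'\<rbrakk> \<Longrightarrow> {sum_ren u, sum_ren v} \<in> Ed \<longleftrightarrow> {u, v} \<in> tp_E False t' k'"
    "\<lbrakk>u \<in> tp_V True k; v \<in> tp_V False k'; u \<noteq> TX True 1; v \<noteq> TX False 1\<rbrakk> \<Longrightarrow> {sum_ren u, sum_ren v} \<notin> Ed"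
    "\<lbrakk>u \<in> tp_V True k; v \<in> tp_V True k\<rbrakk> \<Longrightarrow> {sum_ren u, sum_ren v} \<in> Nd \<longleftrightarrow> {u, v} \<in> tp_Neg True t k"
    "\<lbrakk>u \<in> tp_V False k'; v \<in> tp_V False k'\<rbrakk> \<Longrightarrow> {sum_ren u, sum_ren v} \<in> Nd \<longleftrightarrow> {u, v} \<in> tp_Neg False t' k'"
proof -
  have Ed: "Ed = (`) sum_ren ` (tp_E True t k \<union> tp_E False t' k')"
    unfolding Ed_def sum_edges tp_E_def ..
  have wfE: "\<exists>a\<in>tp_V True k. \<exists>d\<in>tp_V True k. a \<noteq> d \<and> e = {a, d}" if "e \<in> tp_E True t k" for e
    using tp_E_wf[OF that val(1)] .
  have wfE': "\<exists>a\<in>tp_V False k'. \<exists>d\<in>tp_V False k'. a \<noteq> d \<and> e = {a, d}" if "e \<in> tp_E False t' k'" for e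
    using tp_E_wf[OF that val(2)] .
  have wfN: "\<exists>a\<in>tp_V True k. \<exists>d\<in>tp_V True k. a \<noteq> d \<and> e = {a, d}" if "e \<in> tp_Neg True t k" for e
    using tp_Neg_wf[OF that val(1)] .
  have wfN': "\<exists>a\<in>tp_V False k'. \<exists>d\<in>tp_V False k'. a \<noteq> d \<and> e = {a, d}" if "e \<in> tp_Neg False t' k'" for e
    using tp_Neg_wf[OF that val(2)] .
  show "{sum_ren u, sum_ren v} \<in> Ed \<longleftrightarrow> {u, v} \<in> tp_E True t k" if "u \<in> tp_V True k" "v \<in> tp_V True k"
    unfolding Ed by (rule rename_edge_iff[OF sum_ren_props(1-3) wfE wfE' that])
  show "{sum_ren u, sum_ren v} \<in> Ed \<longleftrightarrow> {u, v} \<in> tp_E False t' k'" if "u \<in> tp_V False k'" "v \<in> tp_V False k'"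
    unfolding Ed by (subst Un_commute) (rule rename_edge_iff[OF sum_ren_props(2,1,4) wfE' wfE that])
  show "{sum_ren u, sum_ren v} \<notin> Ed" if uv: "u \<in> tp_V True k" "v \<in> tp_V False k'" "u \<noteq> TX True 1" "v \<noteq> TX False 1"
  proof
    assume m: "{sum_ren u, sum_ren v} \<in> Ed"
    have "sum_ren u = TX True 1 \<or> sum_ren v = TX True 1"
      by (rule rename_edge_cross[OF sum_ren_props(3) wfE wfE' uv(1,2) m[unfolded Ed]])
    then show False using sum_ren_eq uv by blast
  qed
  show "{sum_ren u, sum_ren v} \<in> Nd \<longleftrightarrow> {u, v} \<in> tp_Neg True t k" if "u \<in> tp_V True k" "v \<in> tp_V True k"
    unfolding Nd_def by (rule rename_edge_iff[OF sum_ren_props(1-3) wfN wfN' that])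
  show "{sum_ren u, sum_ren v} \<in> Nd \<longleftrightarrow> {u, v} \<in> tp_Neg False t' k'" if "u \<in> tp_V False k'" "v \<in> tp_V False k'"
    unfolding Nd_def by (subst Un_commute) (rule rename_edge_iff[OF sum_ren_props(2,1,4) wfN' wfN that])
qed

lemma (in bigraph) tp_emb_stuck:
  assumes e: "tp_emb True t k f" "tp_emb False t' k' f" and val: "valid_tp t k" "valid_tp t' k'"
    and n: "\<And>u v. \<lbrakk>u \<in> tp_V True k - {TX True 1}; v \<in> tp_V False k' - {TX False 1}\<rbrakk> \<Longrightarrow> \<not> adj G (f u) (f v)"
    and x: "\<exists>a\<in>tp_V False k' - {TX False 1}. adj G (f (TX True 1)) (f a)"
    and x': "\<exists>a\<in>tp_V True k - {TX True 1}. adj G (f (TX False 1)) (f a)"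
  shows "stuck (f ` (tp_V True k \<union> tp_V False k'))"
proof -
  obtain p where p: "tad (f (TX True 1) # p) (f (TW True)) (f (TY True)) (f (TZ True))"
    "set p \<union> {f (TW True), f (TY True), f (TZ True)} = f ` (tp_V True k - {TX True 1})"
    by (rule tp_emb_tad[OF e(1) val(1)])
  obtain p' where p': "tad (f (TX False 1) # p') (f (TW False)) (f (TY False)) (f (TZ False))"
    "set p' \<union> {f (TW False), f (TY False), f (TZ False)} = f ` (tp_V False k' - {TX False 1})"
    by (rule tp_emb_tad[OF e(2) val(2)])
  have "stuck (f ` (tp_V True k - {TX True 1}) \<union> f ` (tp_V False k' - {TX False 1}) \<union> {f (TX True 1), f (TX False 1)})"
    by (rule two_tads_stuck[OF p(1) p'(1) p(2)[symmetric] p'(2)[symmetric]]) (use n x x' in blast)+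
  moreover have "TX True 1 \<in> tp_V True k" "TX False 1 \<in> tp_V False k'"
    using val by (auto simp: tp_V_mem valid_tp_def)
  then have "f ` (tp_V True k - {TX True 1}) \<union> f ` (tp_V False k' - {TX False 1}) \<union> {f (TX True 1), f (TX False 1)} =
    f ` (tp_V True k \<union> tp_V False k')" by blast
  ultimately show ?thesis by simp
qed

lemma (in bigraph) tp_emb_nbr:
  assumes e: "tp_emb b t k f" and val: "valid_tp t k"
  shows "\<exists>a\<in>tp_V b k - {TX b 1}. adj G (f (TX b 1)) (f a)"
proof -
  obtain p where p: "tad (f (TX b 1) # p) (f (TW b)) (f (TY b)) (f (TZ b))"
    "set p \<union> {f (TW b), f (TY b), f (TZ b)} = f ` (tp_V b k - {TX b 1})"
    by (rule tp_emb_tad[OF e val])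
  obtain v where "v \<in> set p \<union> {f (TW b), f (TY b), f (TZ b)}" "adj G (f (TX b 1)) v"
    using tad_nbr[OF p(1), of "f (TX b 1)"] by auto
  then show ?thesis unfolding p(2) by blast
qed

lemma stuck_family_S: "stuck_family TYPE('a) famS"
proof -
  have st: "stuck_family TYPE('a) (sfam (sum_ren ` (tp_V True k \<union> tp_V False k'))
          ((`) sum_ren ` (tp_Neg True t k \<union> tp_Neg False t' k')) {}
          ((`) sum_ren ` (tp_Free True k \<union> tp_Free False k')))"
    if val: "valid_tp t k" "valid_tp t' k'" for t k t' k'
  proof (rule stuck_family_sfam)
    fix G :: "'a sgraph" and X f
    assume "bigraph G X" and e: "emb G (sum_ren ` (tp_V True k \<union> tp_V False k'))
          ((`) sum_ren ` (tp_Neg True t k \<union> tp_Neg False t' k')) {}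
          ((`) sum_ren ` (tp_Free True k \<union> tp_Free False k')) f"
    then interpret bigraph G X by simp
    note d = embD[OF e]
    \<comment> \<open>Composed with the renaming, \<open>f\<close> becomes a map on the disjoint
      union that embeds both tadpoles and identifies their ends.\<close>
    define g where "g = f \<circ> sum_ren"
    have W: "sum_ren u \<in> sum_ren ` (tp_V True k \<union> tp_V False k')" if "u \<in> tp_V True k \<or> u \<in> tp_V False k'" for u
      using that by blast
    note S = sum_edge_iff[OF val]
    have inj1: "inj_on g (tp_V True k)" "inj_on g (tp_V False k')"
      unfolding g_def
      by (rule comp_inj_on[OF sum_ren_props(1) inj_on_subset[OF d(1)]], blast,
          rule comp_inj_on[OF sum_ren_props(2) inj_on_subset[OF d(1)]], blast)
    have e1: "tp_emb True t k g"
      unfolding tp_emb_def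
    proof (intro conjI ballI impI)
      show "inj_on g (tp_V True k)" by (rule inj1(1))
      fix u v assume uv: "u \<in> tp_V True k" "v \<in> tp_V True k"
      show "{u, v} \<in> tp_E True t k \<longleftrightarrow> adj G (g u) (g v)"
        using d(3)[OF W W, of u v] S(1)[OF uv] uv by (simp add: g_def)
      assume "{u, v} \<in> tp_Neg True t k"
      then show "neg G (g u) (g v)"
        using d(4)[OF W W, of u v] S(4)[OF uv] uv by (simp add: g_def)
    qed
    have e2: "tp_emb False t' k' g"
      unfolding tp_emb_def
    proof (intro conjI ballI impI)
      show "inj_on g (tp_V False k')" by (rule inj1(2))
      fix u v assume uv: "u \<in> tp_V False k'" "v \<in> tp_V False k'"
      show "{u, v} \<in> tp_E False t' k' \<longleftrightarrow> adj G (g u) (g v)"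
        using d(3)[OF W W, of u v] S(2)[OF uv] uv by (simp add: g_def)
      assume "{u, v} \<in> tp_Neg False t' k'"
      then show "neg G (g u) (g v)"
        using d(4)[OF W W, of u v] S(5)[OF uv] uv by (simp add: g_def)
    qed
    have g1: "g (TX True 1) = g (TX False 1)" by (simp add: g_def sum_ren_def)
    have "stuck (g ` (tp_V True k \<union> tp_V False k'))"
    proof (rule tp_emb_stuck[OF e1 e2 val])
      show "\<not> adj G (g u) (g v)" if "u \<in> tp_V True k - {TX True 1}" "v \<in> tp_V False k' - {TX False 1}" for u v
        using d(3)[OF W W, of u v] S(3)[of u v] that by (simp add: g_def)
      show "\<exists>a\<in>tp_V False k' - {TX False 1}. adj G (g (TX True 1)) (g a)"
        unfolding g1 by (rule tp_emb_nbr[OF e2 val(2)])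
      show "\<exists>a\<in>tp_V True k - {TX True 1}. adj G (g (TX False 1)) (g a)"
        unfolding g1[symmetric] by (rule tp_emb_nbr[OF e1 val(1)])
    qed
    then show "stuck (f ` sum_ren ` (tp_V True k \<union> tp_V False k'))"
      by (simp add: g_def image_comp)
  qed
  show ?thesis
    unfolding stuck_family_def
  proof (intro allI ballI impI)
    fix G :: "'a sgraph" and X H f
    assume H: "H \<in> famS" and GX: "bigraph G X" "embeds G H f"
    obtain t k t' k' where "valid_tp t k" "valid_tp t' k'" "H \<in> sfam (sum_ren ` (tp_V True k \<union> tp_V False k'))
          ((`) sum_ren ` (tp_Neg True t k \<union> tp_Neg False t' k')) {}
          ((`) sum_ren ` (tp_Free True k \<union> tp_Free False k'))"
      using H unfolding famS_def by (auto split: if_splits)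
    then show "sbg.stuck (adj G) (neg G) (\<lambda>u. u \<in> X) (f ` verts H)"
      using st GX unfolding stuck_family_def by blast
  qed
qed

fun tad_pair :: "'a list \<Rightarrow> 'a \<Rightarrow> 'a \<Rightarrow> 'a \<Rightarrow> 'a list \<Rightarrow> 'a \<Rightarrow> 'a \<Rightarrow> 'a \<Rightarrow> tv \<Rightarrow> 'a" where
  "tad_pair p w y z p' w' y' z' (TX b i) = (if b then p else p') ! (i - 1)"
| "tad_pair p w y z p' w' y' z' (TW b) = (if b then w else w')"
| "tad_pair p w y z p' w' y' z' (TY b) = (if b then y else y')"
| "tad_pair p w y z p' w' y' z' (TZ b) = (if b then z else z')"

lemma (in bigraph) free_of_S:
  assumes free: "free_of G famS" and t: "tad (x # p) w y z" "tad (x # p') w' y' z'"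
    and n: "\<And>u u'. u \<in> set p \<union> {w, y, z} \<Longrightarrow> u' \<in> set p' \<union> {w', y', z'} \<Longrightarrow> \<not> adj G u u'"
  shows False
proof -
  define f where "f = tad_pair (x # p) w y z (x # p') w' y' z'"
  define k k' T T' where "k = length (x # p)" and "k' = length (x # p')"
    and "T = tad_type (x # p) w" and "T' = tad_type (x # p') w'"
  have e1: "valid_tp T k" "tp_emb True T k f" "f ` tp_V True k = set (x # p) \<union> {w, y, z}"
  proof -
    note tp = tad_tp_emb[OF t(1), where f = f and b = True]
    show "valid_tp T k" unfolding T_def k_def by (rule tp(1)) (simp_all add: f_def)
    show "tp_emb True T k f" unfolding T_def k_def by (rule tp(2)) (simp_all add: f_def)
    show "f ` tp_V True k = set (x # p) \<union> {w, y, z}" unfolding k_def by (rule tp(3)) (simp_all add: f_def)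
  qed
  have e2: "valid_tp T' k'" "tp_emb False T' k' f" "f ` tp_V False k' = set (x # p') \<union> {w', y', z'}"
  proof -
    note tp = tad_tp_emb[OF t(2), where f = f and b = False]
    show "valid_tp T' k'" unfolding T'_def k'_def by (rule tp(1)) (simp_all add: f_def)
    show "tp_emb False T' k' f" unfolding T'_def k'_def by (rule tp(2)) (simp_all add: f_def)
    show "f ` tp_V False k' = set (x # p') \<union> {w', y', z'}" unfolding k'_def by (rule tp(3)) (simp_all add: f_def)
  qed
  have fx: "f (TX True 1) = x" "f (TX False 1) = x" by (auto simp: f_def)
  \<comment> \<open>Both tagged ends go to \<open>x\<close>, so \<open>f\<close> does not notice the
    renaming, and claims about the sum can be checked on the two tadpoles.\<close>
  have fren: "f (sum_ren u) = f u" for u using fx by (simp add: sum_ren_def)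
  have mem1: "TX True 1 \<in> tp_V True k" "TX False 1 \<in> tp_V False k'" by (auto simp: tp_V_mem k_def k'_def)
  note i1 = inj_on_eq_iff[OF e1(2)[unfolded tp_emb_def, THEN conjunct1]]
  note i2 = inj_on_eq_iff[OF e2(2)[unfolded tp_emb_def, THEN conjunct1]]
  have R1: "f u \<in> set p \<union> {w, y, z}" if "u \<in> tp_V True k" "u \<noteq> TX True 1" for u
  proof -
    have "f u \<noteq> x" using i1[OF that(1) mem1(1)] that(2) fx by simp
    then show ?thesis using imageI[OF that(1), of f] unfolding e1(3) by auto
  qed
  have R2: "f u \<in> set p' \<union> {w', y', z'}" if "u \<in> tp_V False k'" "u \<noteq> TX False 1" for u
  proof -
    have "f u \<noteq> x" using i2[OF that(1) mem1(2)] that(2) fx by simp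
    then show ?thesis using imageI[OF that(1), of f] unfolding e2(3) by auto
  qed
  have disj: "a \<notin> set p' \<union> {w', y', z'}" if "a \<in> set p \<union> {w, y, z}" for a
    using tad_nbr[OF t(1), of a] n[of _ a] that E_sym by auto
  have xn: "x \<notin> set p \<union> {w, y, z}" "x \<notin> set p' \<union> {w', y', z'}"
    using tadD(2,4-6)[OF t(1)] tadD(2,4-6)[OF t(2)] by auto
  note S = sum_edge_iff[OF e1(1) e2(1)]
  define W where "W = sum_ren ` (tp_V True k \<union> tp_V False k')"
  define Nd where "Nd = (`) sum_ren ` (tp_Neg True T k \<union> tp_Neg False T' k')"
  define Fd where "Fd = (`) sum_ren ` (tp_Free True k \<union> tp_Free False k')"
  have fcross: "sum_ren u = sum_ren v" if "u \<in> tp_V True k" "v \<in> tp_V False k'" "f u = f v" for u v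
  proof -
    have "u = TX True 1 \<and> v = TX False 1"
      using R1[OF that(1)] R2[OF that(2)] disj[of "f u"] that(3) xn fx by metis
    then show ?thesis by (simp add: sum_ren_def)
  qed
  have Ncase: "\<exists>c d. e = {f c, f d} \<and> neg G (f c) (f d)" if e: "e \<in> (`) f ` Nd" for e
  proof -
    obtain e0 where e0: "e0 \<in> tp_Neg True T k \<union> tp_Neg False T' k'" "e = f ` sum_ren ` e0"
      using e unfolding Nd_def by auto
    then have e': "e = f ` e0" using fren by (simp add: image_image)
    from e0(1) show ?thesis
    proof
      assume N: "e0 \<in> tp_Neg True T k"
      then obtain c d where cd: "c \<in> tp_V True k" "d \<in> tp_V True k" "e0 = {c, d}" using tp_Neg_wf e1(1) by blast
      then show ?thesis using N e' e1(2) unfolding tp_emb_def by (intro exI[of _ c] exI[of _ d]) auto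
    next
      assume N: "e0 \<in> tp_Neg False T' k'"
      then obtain c d where cd: "c \<in> tp_V False k'" "d \<in> tp_V False k'" "e0 = {c, d}" using tp_Neg_wf e2(1) by blast
      then show ?thesis using N e' e2(2) unfolding tp_emb_def by (intro exI[of _ c] exI[of _ d]) auto
    qed
  qed
  have A1: "{sum_ren u, sum_ren v} \<in> Nd \<union> {} \<union> Fd \<longleftrightarrow> adj G (f u) (f v)"
    if "u \<in> tp_V True k" "v \<in> tp_V True k" for u v
    using S(1)[OF that] e1(2)[unfolded tp_emb_def, THEN conjunct2, THEN conjunct1] that
    unfolding Nd_def[symmetric] Fd_def[symmetric] by simp
  have A2: "{sum_ren u, sum_ren v} \<in> Nd \<union> {} \<union> Fd \<longleftrightarrow> adj G (f u) (f v)"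
    if "u \<in> tp_V False k'" "v \<in> tp_V False k'" for u v
    using S(2)[OF that] e2(2)[unfolded tp_emb_def, THEN conjunct2, THEN conjunct1] that
    unfolding Nd_def[symmetric] Fd_def[symmetric] by simp
  have A3: "{sum_ren u, sum_ren v} \<in> Nd \<union> {} \<union> Fd \<longleftrightarrow> adj G (f u) (f v)"
    if "u \<in> tp_V True k" "v \<in> tp_V False k'" for u v
  proof -
    consider "u = TX True 1" | "v = TX False 1" | "u \<noteq> TX True 1" "v \<noteq> TX False 1" by blast
    then show ?thesis
    proof cases
      case 1
      then show ?thesis using A2[OF mem1(2) that(2)] unfolding \<open>u = TX True 1\<close> sum_ren_props(5,6) fx by simp
    next
      case 2
      then show ?thesis using A1[OF that(1) mem1(1)] unfolding \<open>v = TX False 1\<close> sum_ren_props(5,6) fx by simp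
    next
      case 3
      then have "\<not> adj G (f u) (f v)" using n R1 R2 that by blast
      then show ?thesis using S(3)[OF that 3] unfolding Nd_def Fd_def by blast
    qed
  qed
  have "emb G W Nd {} Fd f"
    unfolding emb_def
  proof (intro conjI ballI impI)
    show "inj_on f W"
    proof (rule inj_onI)
      fix a b assume "a \<in> W" "b \<in> W" and eq: "f a = f b"
      then obtain u v where uv: "a = sum_ren u" "b = sum_ren v" "u \<in> tp_V True k \<union> tp_V False k'" "v \<in> tp_V True k \<union> tp_V False k'"
        unfolding W_def by blast
      have fuv: "f u = f v" using eq fren unfolding uv(1,2) by simp
      consider "u \<in> tp_V True k" "v \<in> tp_V True k" | "u \<in> tp_V False k'" "v \<in> tp_V False k'"
        | "u \<in> tp_V True k" "v \<in> tp_V False k'" | "v \<in> tp_V True k" "u \<in> tp_V False k'"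
        using uv(3,4) by blast
      then show "a = b"
      proof cases
        case 1
        then show ?thesis using i1[OF 1] fuv uv(1,2) by simp
      next
        case 2
        then show ?thesis using i2[OF 2] fuv uv(1,2) by simp
      next
        case 3
        then show ?thesis using fcross[OF 3 fuv] uv(1,2) by simp
      next
        case 4
        then show ?thesis using fcross[OF 4 fuv[symmetric]] uv(1,2) by simp
      qed
    qed
    show "f ` W \<subseteq> verts G"
    proof -
      have "\<exists>b. adj G a b" if "a \<in> f ` tp_V True k \<union> f ` tp_V False k'" for a
        using that tad_nbr[OF t(1), of a] tad_nbr[OF t(2), of a] unfolding e1(3) e2(3) by blast
      then have "f ` tp_V True k \<union> f ` tp_V False k' \<subseteq> verts G" using E_V by blast
      moreover have "f ` W = f ` tp_V True k \<union> f ` tp_V False k'"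
        unfolding W_def image_image fren image_Un ..
      ultimately show ?thesis by simp
    qed
    fix a b assume "a \<in> W" "b \<in> W"
    then obtain u v where uv: "a = sum_ren u" "b = sum_ren v" "u \<in> tp_V True k \<union> tp_V False k'" "v \<in> tp_V True k \<union> tp_V False k'"
      unfolding W_def by blast
    have A4: "{sum_ren u, sum_ren v} \<in> Nd \<union> {} \<union> Fd \<longleftrightarrow> adj G (f u) (f v)"
      if "u \<in> tp_V False k'" "v \<in> tp_V True k"
      using A3[OF that(2,1)] E_comm[of "f u" "f v"] doubleton_swap[of "sum_ren u" "sum_ren v"] by simp
    show "{a, b} \<in> Nd \<union> {} \<union> Fd \<longleftrightarrow> adj G (f a) (f b)"
      unfolding uv(1,2) fren using uv(3,4) A1 A2 A3 A4 by blast
    assume "{a, b} \<in> Nd"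
    then have "f ` {a, b} \<in> (`) f ` Nd" by (rule imageI)
    from Ncase[OF this] obtain c d where "f ` {a, b} = {f c, f d}" "neg G (f c) (f d)" by blast
    then have "{f a, f b} = {f c, f d}" "neg G (f c) (f d)" by simp_all
    then show "\<not> pos G {f a, f b}" by (simp add: neg_def)
  qed simp
  moreover have "sfam W Nd {} Fd \<subseteq> famS"
    unfolding famS_def W_def Nd_def Fd_def using e1(1) e2(1)
    by (intro subsetI UN_I[of T] UN_I[of k] UN_I[of T'] UN_I[of k']) auto
  moreover have "\<exists>a\<in>W. \<exists>b\<in>W. e = {a, b}" if e: "e \<in> Nd \<union> {}" for e
  proof -
    obtain e0 where e0: "e0 \<in> tp_Neg True T k \<union> tp_Neg False T' k'" "e = sum_ren ` e0"
      using e unfolding Nd_def by auto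
    then obtain c d where "c \<in> tp_V True k \<union> tp_V False k'" "d \<in> tp_V True k \<union> tp_V False k'" "e0 = {c, d}"
      using tp_Neg_wf e1(1) e2(1) by blast
    then show ?thesis using e0(2) unfolding W_def by auto
  qed
  ultimately show False using not_emb_of_free_of[OF free] by blast
qed

section \<open>Edges of a join of tadpoles\<close>

definition opp :: "tv set \<Rightarrow> tv \<Rightarrow> tv \<Rightarrow> bool" where
  "opp P a b \<longleftrightarrow> (a \<in> P) \<noteq> (b \<in> P)"

definition join_added :: "nat \<Rightarrow> nat \<Rightarrow> tv set \<Rightarrow> tv set set" where
  "join_added k k' P = {{TX True 1, v} | v. v \<in> tp_V False k' \<and> opp P (TX True 1) v} \<union>
     {{TX False 1, u} | u. u \<in> tp_V True k \<and> opp P (TX False 1) u}"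

definition join_exc :: "nat \<Rightarrow> nat \<Rightarrow> nat \<Rightarrow> nat \<Rightarrow> tv set \<Rightarrow> tv set set" where
  "join_exc t k t' k' P =
     (if opp P (TX True 1) (TX False 1) \<and> t = 1 \<and> k = 1 then {{TX False 1, TW True}} else {}) \<union>
     (if opp P (TX True 1) (TX False 1) \<and> t' = 1 \<and> k' = 1 then {{TX True 1, TW False}} else {})"

lemma join_fam_alt:
  "join_fam t k t' k' P = sfam (tp_V True k \<union> tp_V False k') (tp_Neg True t k \<union> tp_Neg False t' k')
     (join_added k k' P - join_exc t k t' k' P) (tp_Free True k \<union> tp_Free False k' \<union> join_exc t k t' k' P)"
  by (simp add: join_fam_def Let_def join_added_def join_exc_def opp_def)

fun tag :: "tv \<Rightarrow> bool" where
  "tag (TX b i) = b"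
| "tag (TW b) = b"
| "tag (TY b) = b"
| "tag (TZ b) = b"

lemma tag_tp_V: "u \<in> tp_V b k \<Longrightarrow> tag u = b"
  by (auto simp: tp_V_def)

lemma tag_tp_E: "{u, v} \<in> tp_E b t k \<Longrightarrow> valid_tp t k \<Longrightarrow> tag u = b \<and> tag v = b"
  using tp_E_wf[of "{u, v}" b t k] tag_tp_V by (auto simp: doubleton_eq_iff)

definition join_bip :: "nat \<Rightarrow> nat \<Rightarrow> nat \<Rightarrow> nat \<Rightarrow> tv set \<Rightarrow> bool" where
  "join_bip t k t' k' P \<longleftrightarrow> (\<forall>e\<in>tp_Neg True t k \<union> tp_Neg False t' k' \<union> tp_Free True k \<union> tp_Free False k'.
     card (e \<inter> P) = 1)"

lemma card_doubleton_opp: "a \<noteq> b \<Longrightarrow> card ({a, b} \<inter> P) = 1 \<longleftrightarrow> opp P a b"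
  by (cases "a \<in> P"; cases "b \<in> P") (auto simp: opp_def)

lemma join_bip_opp:
  assumes "join_bip t k t' k' P" "{a, b} \<in> tp_E True t k \<or> {a, b} \<in> tp_E False t' k'" "a \<noteq> b"
  shows "opp P a b"
proof -
  have "{a, b} \<in> tp_Neg True t k \<union> tp_Neg False t' k' \<union> tp_Free True k \<union> tp_Free False k'"
    using assms(2) unfolding tp_E_def by blast
  then have "card ({a, b} \<inter> P) = 1" using assms(1) unfolding join_bip_def by blast
  then show ?thesis using card_doubleton_opp[OF assms(3)] by blast
qed

text \<open>For \<open>k = 1\<close> the end \<open>x\<close> and the head \<open>w\<close> are both
  adjacent to \<open>y\<close>, so they are on the same side. If \<open>x'\<close> is opposite to
  \<open>x\<close>, it is opposite to \<open>w\<close>, and the exceptional edge is one of the added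
  edges.\<close>

lemma join_exc_added:
  assumes P: "join_bip t k t' k' P"
  shows "join_exc t k t' k' P \<subseteq> join_added k k' P"
proof -
  have 1: "opp P (TX False 1) (TW True)" if "opp P (TX True 1) (TX False 1)" "k = 1"
  proof -
    have "opp P (TX True 1) (TY True)" "opp P (TW True) (TY True)"
      using that(2) by (auto intro!: join_bip_opp[OF P] simp: tp_E_mem)
    then show ?thesis using that(1) by (auto simp: opp_def)
  qed
  have 2: "opp P (TX True 1) (TW False)" if "opp P (TX True 1) (TX False 1)" "k' = 1"
  proof -
    have "opp P (TX False 1) (TY False)" "opp P (TW False) (TY False)"
      using that(2) by (auto intro!: join_bip_opp[OF P] simp: tp_E_mem)
    then show ?thesis using that(1) by (auto simp: opp_def)
  qed
  show ?thesis
    unfolding join_exc_def join_added_def using 1 2 tp_V_mem(1) by (auto split: if_splits)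
qed

lemma join_edge_iff:
  assumes val: "valid_tp t k" "valid_tp t' k'" and P: "join_bip t k t' k' P"
  defines "Ed \<equiv> (tp_Neg True t k \<union> tp_Neg False t' k') \<union> (join_added k k' P - join_exc t k t' k' P) \<union>
    (tp_Free True k \<union> tp_Free False k' \<union> join_exc t k t' k' P)"
  shows "\<lbrakk>u \<in> tp_V True k; v \<in> tp_V True k\<rbrakk> \<Longrightarrow> {u, v} \<in> Ed \<longleftrightarrow> {u, v} \<in> tp_E True t k"
    "\<lbrakk>u \<in> tp_V False k'; v \<in> tp_V False k'\<rbrakk> \<Longrightarrow> {u, v} \<in> Ed \<longleftrightarrow> {u, v} \<in> tp_E False t' k'"
    "\<lbrakk>u \<in> tp_V True k; v \<in> tp_V False k'\<rbrakk> \<Longrightarrow> {u, v} \<in> Ed \<longleftrightarrow> opp P u v \<and> (u = TX True 1 \<or> v = TX False 1)"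
    "\<lbrakk>u \<in> tp_V True k; v \<in> tp_V False k'\<rbrakk> \<Longrightarrow> {u, v} \<in> join_added k k' P \<longleftrightarrow> opp P u v \<and> (u = TX True 1 \<or> v = TX False 1)"
    "{u, v} \<in> join_added k k' P \<Longrightarrow> tag u \<noteq> tag v"
proof -
  have Ed: "Ed = tp_E True t k \<union> tp_E False t' k' \<union> join_added k k' P"
    using join_exc_added[OF P] unfolding Ed_def tp_E_def by blast
  have tagA: "tag u \<noteq> tag v" if "{u, v} \<in> join_added k k' P" for u v
    using that tag_tp_V unfolding join_added_def by (auto simp: doubleton_eq_iff)
  then show "{u, v} \<in> join_added k k' P \<Longrightarrow> tag u \<noteq> tag v" by blast
  show "{u, v} \<in> Ed \<longleftrightarrow> {u, v} \<in> tp_E True t k" if "u \<in> tp_V True k" "v \<in> tp_V True k"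
    using tagA[of u v] tag_tp_E[of u v False t' k'] val(2) that[THEN tag_tp_V] unfolding Ed by auto
  show "{u, v} \<in> Ed \<longleftrightarrow> {u, v} \<in> tp_E False t' k'" if "u \<in> tp_V False k'" "v \<in> tp_V False k'"
    using tagA[of u v] tag_tp_E[of u v True t k] val(1) that[THEN tag_tp_V] unfolding Ed by auto
  have A: "{u, v} \<in> join_added k k' P \<longleftrightarrow> opp P u v \<and> (u = TX True 1 \<or> v = TX False 1)"
    if "u \<in> tp_V True k" "v \<in> tp_V False k'"
  proof -
    have tg: "tag u" "\<not> tag v" using that tag_tp_V by blast+
    have "{u, v} \<in> join_added k k' P \<longleftrightarrow> (u = TX True 1 \<and> opp P u v) \<or> (v = TX False 1 \<and> opp P v u)"
      unfolding join_added_def using that tg by (auto simp: doubleton_eq_iff)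
    then show ?thesis by (auto simp: opp_def)
  qed
  then show "\<lbrakk>u \<in> tp_V True k; v \<in> tp_V False k'\<rbrakk> \<Longrightarrow> {u, v} \<in> join_added k k' P \<longleftrightarrow> opp P u v \<and> (u = TX True 1 \<or> v = TX False 1)"
    by blast
  show "{u, v} \<in> Ed \<longleftrightarrow> opp P u v \<and> (u = TX True 1 \<or> v = TX False 1)" if "u \<in> tp_V True k" "v \<in> tp_V False k'"
  proof -
    have "{u, v} \<notin> tp_E True t k" "{u, v} \<notin> tp_E False t' k'"
      using tag_tp_E[of u v True t k] tag_tp_E[of u v False t' k'] val that[THEN tag_tp_V] by auto
    then show ?thesis using A[OF that] unfolding Ed by blast
  qed
qed

lemma tp_Neg_tag:
  assumes "{u, v} \<in> tp_Neg True t k \<union> tp_Neg False t' k'" "valid_tp t k" "valid_tp t' k'"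
  shows "tag u \<Longrightarrow> {u, v} \<in> tp_Neg True t k" "\<not> tag u \<Longrightarrow> {u, v} \<in> tp_Neg False t' k'"
  using assms tag_tp_E[of u v] tp_Neg_subset by blast+

lemma stuck_family_J: "stuck_family TYPE('a) famJ"
proof -
  have st: "stuck_family TYPE('a) (join_fam t k t' k' P)"
    if val: "valid_tp t k" "valid_tp t' k'" and P: "join_bip t k t' k' P" for t k t' k' P
    unfolding join_fam_alt
  proof (rule stuck_family_sfam)
    fix G :: "'a sgraph" and X f
    assume "bigraph G X" and e: "emb G (tp_V True k \<union> tp_V False k') (tp_Neg True t k \<union> tp_Neg False t' k')
     (join_added k k' P - join_exc t k t' k' P) (tp_Free True k \<union> tp_Free False k' \<union> join_exc t k t' k' P) f"
    then interpret bigraph G X by simp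
    note d = embD[OF e]
    note J = join_edge_iff[OF val P]
    have e1: "tp_emb True t k f"
      unfolding tp_emb_def
    proof (intro conjI ballI impI)
      show "inj_on f (tp_V True k)" by (rule inj_on_subset[OF d(1)]) blast
      fix u v assume uv: "u \<in> tp_V True k" "v \<in> tp_V True k"
      show "{u, v} \<in> tp_E True t k \<longleftrightarrow> adj G (f u) (f v)"
        using d(3)[of u v] J(1)[OF uv] uv by simp
      assume "{u, v} \<in> tp_Neg True t k"
      then show "neg G (f u) (f v)" using d(4)[of u v] uv by simp
    qed
    have e2: "tp_emb False t' k' f"
      unfolding tp_emb_def
    proof (intro conjI ballI impI)
      show "inj_on f (tp_V False k')" by (rule inj_on_subset[OF d(1)]) blast
      fix u v assume uv: "u \<in> tp_V False k'" "v \<in> tp_V False k'"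
      show "{u, v} \<in> tp_E False t' k' \<longleftrightarrow> adj G (f u) (f v)"
        using d(3)[of u v] J(2)[OF uv] uv by simp
      assume "{u, v} \<in> tp_Neg False t' k'"
      then show "neg G (f u) (f v)" using d(4)[of u v] uv by simp
    qed
    have cross: "adj G (f u) (f v) \<longleftrightarrow> opp P u v \<and> (u = TX True 1 \<or> v = TX False 1)"
      if "u \<in> tp_V True k" "v \<in> tp_V False k'" for u v
      using d(3)[of u v] J(3)[OF that] that by simp
    have ends: "TX True 1 \<in> tp_V True k" "TX False 1 \<in> tp_V False k'"
      using val by (auto simp: tp_V_mem valid_tp_def)
    have wy: "opp P (TW True) (TY True)" "opp P (TW False) (TY False)"
      by (auto intro!: join_bip_opp[OF P] simp: tp_E_mem)
    show "stuck (f ` (tp_V True k \<union> tp_V False k'))"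
    proof (rule tp_emb_stuck[OF e1 e2 val])
      show "\<not> adj G (f u) (f v)" if "u \<in> tp_V True k - {TX True 1}" "v \<in> tp_V False k' - {TX False 1}" for u v
        using cross[of u v] that by blast
      \<comment> \<open>\<open>w\<close> and \<open>y\<close> of a tadpole are on different sides,
        so one of them is opposite to the end of the other tadpole.\<close>
      have "\<exists>a\<in>{TW False, TY False}. opp P (TX True 1) a" using wy by (auto simp: opp_def)
      then obtain a where "a \<in> {TW False, TY False}" "opp P (TX True 1) a" by blast
      moreover from this have "a \<in> tp_V False k' - {TX False 1}" by (auto simp: tp_V_mem)
      ultimately show "\<exists>a\<in>tp_V False k' - {TX False 1}. adj G (f (TX True 1)) (f a)"
        using cross[OF ends(1)] by blast
      have "\<exists>a\<in>{TW True, TY True}. opp P a (TX False 1)" using wy by (auto simp: opp_def)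
      then obtain a where "a \<in> {TW True, TY True}" "opp P a (TX False 1)" by blast
      moreover from this have "a \<in> tp_V True k - {TX True 1}" by (auto simp: tp_V_mem)
      ultimately show "\<exists>a\<in>tp_V True k - {TX True 1}. adj G (f (TX False 1)) (f a)"
        using cross[OF _ ends(2)] E_sym by blast
    qed
  qed
  show ?thesis
    unfolding stuck_family_def
  proof (intro allI ballI impI)
    fix G :: "'a sgraph" and X H f
    assume H: "H \<in> famJ" and GX: "bigraph G X" "embeds G H f"
    obtain t k t' k' P where "valid_tp t k" "valid_tp t' k'" "join_bip t k t' k' P" "H \<in> join_fam t k t' k' P"
      using H unfolding famJ_def join_bip_def by (auto split: if_splits)
    then show "sbg.stuck (adj G) (neg G) (\<lambda>u. u \<in> X) (f ` verts H)"
      using st GX unfolding stuck_family_def by blast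
  qed
qed

lemma (in bigraph) free_of_J:
  assumes free: "free_of G famJ" and t: "tad (x # p) w y z" "tad (x' # p') w' y' z'"
    and n: "\<And>u u'. u \<in> set p \<union> {w, y, z} \<Longrightarrow> u' \<in> set p' \<union> {w', y', z'} \<Longrightarrow> \<not> adj G u u'"
    and xx: "x \<noteq> x'" "x \<notin> set p' \<union> {w', y', z'}" "x' \<notin> set p \<union> {w, y, z}"
    and cx: "\<And>u. u \<in> insert x' (set p' \<union> {w', y', z'}) \<Longrightarrow> (u \<in> X) \<noteq> (x \<in> X) \<Longrightarrow>
      adj G x u \<and> (\<not> neg G x u \<or> u = w' \<and> p' = [])"
    and cx': "\<And>u. u \<in> insert x (set p \<union> {w, y, z}) \<Longrightarrow> (u \<in> X) \<noteq> (x' \<in> X) \<Longrightarrow>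
      adj G x' u \<and> (\<not> neg G x' u \<or> u = w \<and> p = [])"
  shows False
proof -
  define f where "f = tad_pair (x # p) w y z (x' # p') w' y' z'"
  define k k' T T' where "k = length (x # p)" and "k' = length (x' # p')"
    and "T = tad_type (x # p) w" and "T' = tad_type (x' # p') w'"
  have e1: "valid_tp T k" "tp_emb True T k f" "f ` tp_V True k = set (x # p) \<union> {w, y, z}"
  proof -
    note tp = tad_tp_emb[OF t(1), where f = f and b = True]
    show "valid_tp T k" unfolding T_def k_def by (rule tp(1)) (simp_all add: f_def)
    show "tp_emb True T k f" unfolding T_def k_def by (rule tp(2)) (simp_all add: f_def)
    show "f ` tp_V True k = set (x # p) \<union> {w, y, z}" unfolding k_def by (rule tp(3)) (simp_all add: f_def)
  qed
  have e2: "valid_tp T' k'" "tp_emb False T' k' f" "f ` tp_V False k' = set (x' # p') \<union> {w', y', z'}"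
  proof -
    note tp = tad_tp_emb[OF t(2), where f = f and b = False]
    show "valid_tp T' k'" unfolding T'_def k'_def by (rule tp(1)) (simp_all add: f_def)
    show "tp_emb False T' k' f" unfolding T'_def k'_def by (rule tp(2)) (simp_all add: f_def)
    show "f ` tp_V False k' = set (x' # p') \<union> {w', y', z'}" unfolding k'_def by (rule tp(3)) (simp_all add: f_def)
  qed
  have fx: "f (TX True 1) = x" "f (TX False 1) = x'" by (auto simp: f_def)
  have fw: "f (TW True) = w" "f (TW False) = w'" by (auto simp: f_def)
  have mem1: "TX True 1 \<in> tp_V True k" "TX False 1 \<in> tp_V False k'" by (auto simp: tp_V_mem k_def k'_def)
  note i1 = inj_on_eq_iff[OF e1(2)[unfolded tp_emb_def, THEN conjunct1]]
  note i2 = inj_on_eq_iff[OF e2(2)[unfolded tp_emb_def, THEN conjunct1]]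
  have V1: "f u \<in> insert x (set p \<union> {w, y, z})" if "u \<in> tp_V True k" for u
    using imageI[OF that, of f] unfolding e1(3) by auto
  have V2: "f u \<in> insert x' (set p' \<union> {w', y', z'})" if "u \<in> tp_V False k'" for u
    using imageI[OF that, of f] unfolding e2(3) by auto
  have R1: "f u \<in> set p \<union> {w, y, z}" if "u \<in> tp_V True k" "u \<noteq> TX True 1" for u
    using V1[OF that(1)] i1[OF that(1) mem1(1)] that(2) fx by auto
  have R2: "f u \<in> set p' \<union> {w', y', z'}" if "u \<in> tp_V False k'" "u \<noteq> TX False 1" for u
    using V2[OF that(1)] i2[OF that(1) mem1(2)] that(2) fx by auto
  have disj: "a \<notin> set p' \<union> {w', y', z'}" if "a \<in> set p \<union> {w, y, z}" for a
    using tad_nbr[OF t(1), of a] n[of _ a] that E_sym by auto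
  have fcross: "f u \<noteq> f v" if "u \<in> tp_V True k" "v \<in> tp_V False k'" for u v
    using V1[OF that(1)] V2[OF that(2)] disj[of "f u"] xx by auto
  \<comment> \<open>The bipartition is the one induced by \<open>X\<close>; it selects the relative
    orientation of the two tadpoles.\<close>
  define P where "P = {u \<in> tp_V True k \<union> tp_V False k'. f u \<in> X}"
  have opp: "opp P u v \<longleftrightarrow> (f u \<in> X) \<noteq> (f v \<in> X)"
    if "u \<in> tp_V True k \<union> tp_V False k'" "v \<in> tp_V True k \<union> tp_V False k'" for u v
    using that by (simp add: opp_def P_def)
  have adj1: "{u, v} \<in> tp_E True T k \<longleftrightarrow> adj G (f u) (f v)" if "u \<in> tp_V True k" "v \<in> tp_V True k" for u v
    using e1(2)[unfolded tp_emb_def, THEN conjunct2, THEN conjunct1] that by blast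
  have adj2: "{u, v} \<in> tp_E False T' k' \<longleftrightarrow> adj G (f u) (f v)" if "u \<in> tp_V False k'" "v \<in> tp_V False k'" for u v
    using e2(2)[unfolded tp_emb_def, THEN conjunct2, THEN conjunct1] that by blast
  have neg1: "neg G (f u) (f v)" if "u \<in> tp_V True k" "v \<in> tp_V True k" "{u, v} \<in> tp_Neg True T k" for u v
    using e1(2)[unfolded tp_emb_def, THEN conjunct2, THEN conjunct2] that by blast
  have neg2: "neg G (f u) (f v)" if "u \<in> tp_V False k'" "v \<in> tp_V False k'" "{u, v} \<in> tp_Neg False T' k'" for u v
    using e2(2)[unfolded tp_emb_def, THEN conjunct2, THEN conjunct2] that by blast
  have bip: "join_bip T k T' k' P"
    unfolding join_bip_def
  proof
    fix e assume "e \<in> tp_Neg True T k \<union> tp_Neg False T' k' \<union> tp_Free True k \<union> tp_Free False k'"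
    then have "e \<in> tp_E True T k \<or> e \<in> tp_E False T' k'" unfolding tp_E_def by blast
    then show "card (e \<inter> P) = 1"
    proof
      assume e: "e \<in> tp_E True T k"
      obtain u v where uv: "u \<in> tp_V True k" "v \<in> tp_V True k" "u \<noteq> v" "e = {u, v}" using tp_E_wf[OF e e1(1)] by blast
      then have "opp P u v" using opp[of u v] adj1[of u v] e E_col by blast
      then show ?thesis unfolding uv(4) using card_doubleton_opp[OF uv(3)] by blast
    next
      assume e: "e \<in> tp_E False T' k'"
      obtain u v where uv: "u \<in> tp_V False k'" "v \<in> tp_V False k'" "u \<noteq> v" "e = {u, v}" using tp_E_wf[OF e e2(1)] by blast
      then have "opp P u v" using opp[of u v] adj2[of u v] e E_col by blast
      then show ?thesis unfolding uv(4) using card_doubleton_opp[OF uv(3)] by blast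
    qed
  qed
  note J = join_edge_iff[OF e1(1) e2(1) bip]
  have cross: "adj G (f u) (f v) \<longleftrightarrow> opp P u v \<and> (u = TX True 1 \<or> v = TX False 1)"
    if uv: "u \<in> tp_V True k" "v \<in> tp_V False k'" for u v
  proof
    assume a: "adj G (f u) (f v)"
    then have "opp P u v" using opp[of u v] uv E_col by blast
    moreover have "u = TX True 1 \<or> v = TX False 1" using a n R1 R2 uv by blast
    ultimately show "opp P u v \<and> (u = TX True 1 \<or> v = TX False 1)" by blast
  next
    assume h: "opp P u v \<and> (u = TX True 1 \<or> v = TX False 1)"
    then have col: "(f u \<in> X) \<noteq> (f v \<in> X)" using opp[of u v] uv by blast
    from h show "adj G (f u) (f v)"
    proof (elim conjE disjE)
      assume "u = TX True 1"
      then show ?thesis using cx[OF V2[OF uv(2)]] col fx by auto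
    next
      assume "v = TX False 1"
      then have "adj G (f v) (f u)" using cx'[OF V1[OF uv(1)]] col fx by auto
      then show ?thesis by (rule E_sym)
    qed
  qed
  \<comment> \<open>A negative added edge must be exceptional: by hypothesis it ends in the head
    \<open>w\<close> of a tadpole with a one-vertex path. By colour such a tadpole has type 1, and
    its head is on the side of its end, so the two ends are opposite.\<close>
  have posx: "\<not> neg G (f u) (f v)"
    if uv: "u \<in> tp_V True k" "v \<in> tp_V False k'" and m: "{u, v} \<in> join_added k k' P - join_exc T k T' k' P" for u v
  proof
    assume N: "neg G (f u) (f v)"
    have h: "opp P u v" "u = TX True 1 \<or> v = TX False 1" using J(4)[OF uv] m by blast+
    have col: "(f u \<in> X) \<noteq> (f v \<in> X)" using opp[of u v] uv h(1) by blast
    from h(2) show False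
    proof
      assume u: "u = TX True 1"
      then have "f v = w' \<and> p' = []" using cx[OF V2[OF uv(2)]] col fx N by auto
      then have v: "v = TW False" "p' = []" using i2[OF uv(2) tp_V_mem(1)] fw by auto
      have "\<not> adj G x' w'" using E_col[of x' w'] tadD(17)[OF t(2)] v(2) by auto
      then have T1: "T' = 1" "k' = 1" using v(2) by (auto simp: T'_def tad_type_def k'_def)
      have "opp P (TX False 1) (TY False)" "opp P (TW False) (TY False)"
        using T1(2) by (auto intro!: join_bip_opp[OF bip] simp: tp_E_mem)
      then have "opp P (TX True 1) (TX False 1)" using h(1) u v(1) by (auto simp: opp_def)
      then have "{u, v} \<in> join_exc T k T' k' P" using T1 u v(1) by (simp add: join_exc_def)
      then show False using m by blast
    next
      assume v: "v = TX False 1"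
      have "neg G (f v) (f u)" using N by (rule Ng_sym)
      then have "f u = w \<and> p = []" using cx'[OF V1[OF uv(1)]] col fx v by auto
      then have u: "u = TW True" "p = []" using i1[OF uv(1) tp_V_mem(1)] fw by auto
      have "\<not> adj G x w" using E_col[of x w] tadD(17)[OF t(1)] u(2) by auto
      then have T1: "T = 1" "k = 1" using u(2) by (auto simp: T_def tad_type_def k_def)
      have "opp P (TX True 1) (TY True)" "opp P (TW True) (TY True)"
        using T1(2) by (auto intro!: join_bip_opp[OF bip] simp: tp_E_mem)
      then have "opp P (TX True 1) (TX False 1)" using h(1) u(1) v by (auto simp: opp_def)
      then have "{v, u} \<in> join_exc T k T' k' P" using T1 u(1) v by (simp add: join_exc_def)
      then show False using m doubleton_swap[of u v] by simp
    qed
  qed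
  define W where "W = tp_V True k \<union> tp_V False k'"
  define Nd where "Nd = tp_Neg True T k \<union> tp_Neg False T' k'"
  define Pd where "Pd = join_added k k' P - join_exc T k T' k' P"
  define Fd where "Fd = tp_Free True k \<union> tp_Free False k' \<union> join_exc T k T' k' P"
  note J' = J(1-3)[folded Nd_def Pd_def Fd_def]
  have A4: "{u, v} \<in> Nd \<union> Pd \<union> Fd \<longleftrightarrow> adj G (f u) (f v)" if "u \<in> tp_V False k'" "v \<in> tp_V True k" for u v
    using J'(3)[OF that(2,1)] cross[OF that(2,1)] E_comm[of "f u" "f v"] doubleton_swap[of u v] by simp
  have "emb G W Nd Pd Fd f"
    unfolding emb_def
  proof (intro conjI ballI impI)
    show "inj_on f W"
    proof (rule inj_onI)
      fix u v assume uv: "u \<in> W" "v \<in> W" "f u = f v"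
      consider "u \<in> tp_V True k" "v \<in> tp_V True k" | "u \<in> tp_V False k'" "v \<in> tp_V False k'"
        | "u \<in> tp_V True k" "v \<in> tp_V False k'" | "v \<in> tp_V True k" "u \<in> tp_V False k'"
        using uv(1,2) unfolding W_def by blast
      then show "u = v"
      proof cases
        case 1
        then show ?thesis using i1[OF 1] uv(3) by simp
      next
        case 2
        then show ?thesis using i2[OF 2] uv(3) by simp
      next
        case 3
        then show ?thesis using fcross[OF 3] uv(3) by simp
      next
        case 4
        then show ?thesis using fcross[OF 4] uv(3) by simp
      qed
    qed
    show "f ` W \<subseteq> verts G"
    proof -
      have "\<exists>b. adj G a b" if "a \<in> f ` tp_V True k \<union> f ` tp_V False k'" for a
        using that tad_nbr[OF t(1), of a] tad_nbr[OF t(2), of a] unfolding e1(3) e2(3) by blast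
      then have "f ` tp_V True k \<union> f ` tp_V False k' \<subseteq> verts G" using E_V by blast
      then show ?thesis unfolding W_def image_Un .
    qed
    fix u v assume uv: "u \<in> W" "v \<in> W"
    show "{u, v} \<in> Nd \<union> Pd \<union> Fd \<longleftrightarrow> adj G (f u) (f v)"
      using uv J'(1)[of u v] J'(2)[of u v] J'(3)[of u v] adj1[of u v] adj2[of u v] cross[of u v] A4[of u v]
      unfolding W_def by (elim UnE) simp_all
    {
      assume N: "{u, v} \<in> Nd"
      have "neg G (f u) (f v)"
      proof (cases "tag u")
        case True
        then have m: "{u, v} \<in> tp_Neg True T k" using tp_Neg_tag(1)[OF N[unfolded Nd_def] e1(1) e2(1)] by blast
        then have "tag v" using tag_tp_E[of u v True T k] tp_Neg_subset e1(1) by blast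
        then have "u \<in> tp_V True k" "v \<in> tp_V True k" using True uv tag_tp_V unfolding W_def by blast+
        then show ?thesis using neg1 m by blast
      next
        case False
        then have m: "{u, v} \<in> tp_Neg False T' k'" using tp_Neg_tag(2)[OF N[unfolded Nd_def] e1(1) e2(1)] by blast
        then have "\<not> tag v" using tag_tp_E[of u v False T' k'] tp_Neg_subset e2(1) by blast
        then have "u \<in> tp_V False k'" "v \<in> tp_V False k'" using False uv tag_tp_V unfolding W_def by blast+
        then show ?thesis using neg2 m by blast
      qed
      then show "\<not> pos G {f u, f v}" by (simp add: neg_def)
    }
    {
      assume m: "{u, v} \<in> Pd"
      have tg: "tag u \<noteq> tag v" using J(5)[of u v] m unfolding Pd_def by blast
      have a: "adj G (f u) (f v)"
        using m uv J'(1)[of u v] J'(2)[of u v] J'(3)[of u v] adj1[of u v] adj2[of u v] cross[of u v] A4[of u v]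
        unfolding W_def by (elim UnE) simp_all
      have "\<not> neg G (f u) (f v)"
      proof (cases "tag u")
        case True
        then have "u \<in> tp_V True k" "v \<in> tp_V False k'" using tg uv tag_tp_V unfolding W_def by blast+
        then show ?thesis using posx m unfolding Pd_def by blast
      next
        case False
        then have "v \<in> tp_V True k" "u \<in> tp_V False k'" using tg uv tag_tp_V unfolding W_def by blast+
        then have "\<not> neg G (f v) (f u)" using posx[of v u] m doubleton_swap[of u v] unfolding Pd_def by simp
        then show ?thesis using Ng_sym by blast
      qed
      then show "pos G {f u, f v}" using a by (simp add: neg_def adj_def)
    }
  qed
  moreover have "sfam W Nd Pd Fd \<subseteq> famJ"
  proof -
    have eq: "sfam W Nd Pd Fd = join_fam T k T' k' P"
      unfolding join_fam_alt W_def Nd_def Pd_def Fd_def ..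
    have "P \<in> {P. P \<subseteq> tp_V True k \<union> tp_V False k' \<and>
        (\<forall>e\<in>tp_Neg True T k \<union> tp_Neg False T' k' \<union> tp_Free True k \<union> tp_Free False k'. card (e \<inter> P) = 1)}"
      using bip unfolding join_bip_def by (auto simp: P_def)
    then have "sfam W Nd Pd Fd \<subseteq> (if valid_tp T k \<and> valid_tp T' k' then
       (\<Union>P\<in>{P. P \<subseteq> tp_V True k \<union> tp_V False k' \<and>
          (\<forall>e\<in>tp_Neg True T k \<union> tp_Neg False T' k' \<union> tp_Free True k \<union> tp_Free False k'. card (e \<inter> P) = 1)}.
        join_fam T k T' k' P) else {})"
      unfolding if_P[OF conjI[OF e1(1) e2(1)]] eq by (rule UN_upper)
    then show ?thesis
      unfolding famJ_def by (intro subsetI UN_I[of T] UN_I[of k] UN_I[of T'] UN_I[of k'] UNIV_I) (rule subsetD)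
  qed
  moreover have "\<exists>a\<in>W. \<exists>b\<in>W. e = {a, b}" if e: "e \<in> Nd \<union> Pd" for e
  proof -
    have "e \<in> Nd \<or> e \<in> join_added k k' P" using e unfolding Pd_def by blast
    then show ?thesis
    proof
      assume "e \<in> Nd"
      then show ?thesis using tp_Neg_wf e1(1) e2(1) unfolding Nd_def W_def by blast
    next
      assume "e \<in> join_added k k' P"
      then show ?thesis using mem1 unfolding join_added_def W_def by blast
    qed
  qed
  ultimately show False using not_emb_of_free_of[OF free] by blast
qed

section \<open>The equivalence\<close>

lemma (in bigraph) free_imp_sbg_free:
  assumes "F_free G"
  shows "sbg_free (verts G) (adj G) (neg G) (\<lambda>u. u \<in> X)"
proof -
  note F = assms[unfolded F_free_def]
  show ?thesis
  proof (unfold_locales, goal_cases)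
    case 1 then show ?case using free_of_F2 F by blast
  next
    case 2 then show ?case using free_of_F1 F by blast
  next
    case 3 then show ?case using free_of_F3 F by blast
  next
    case 4 then show ?case using free_of_F4 F by blast
  next
    case 5 then show ?case using free_of_F5 F by blast
  next
    case 6 then show ?case using free_of_F6 F by blast
  next
    case 7 then show ?case using free_of_D F by blast
  next
    case (8 q v)
    have "free_of G famC" using F by blast
    then show ?case using 8 by (rule free_of_C)
  next
    case (9 x p w y z p' w' y' z')
    have "free_of G famS" using F by blast
    then show ?case using 9 by (rule free_of_S)
  next
    case (10 x p w y z x' p' w' y' z')
    have "free_of G famJ" using F by blast
    then show ?case using 10 by (rule free_of_J)
  qed
qed

lemma (in bigraph) F_free_delete:
  assumes "F_free G" "signed_simplicial G X u v"
  shows "F_free (delete_edges G {{u, v}})"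
  unfolding F_free_def
  by (intro conjI free_of_delete[OF _ _ assms(2)] stuck_family_F stuck_family_C stuck_family_S stuck_family_J)
    (use assms(1) in \<open>simp_all add: F_free_def\<close>)

lemma (in bigraph) chordal_imp_F_free:
  assumes "chordal G X"
  shows "F_free G"
  unfolding F_free_def
  by (intro conjI chordal_free_of[OF _ assms] stuck_family_F stuck_family_C stuck_family_S stuck_family_J)

lemma finite_edges: "signed_graph G \<Longrightarrow> finite (edges G)"
  by (rule finite_subset[of _ "Pow (verts G)"]) (auto simp: signed_graph_def)

text \<open>A simplicial edge is put in front of an ordering for the graph without it. Deleting
  \<open>{u, v}\<close> and then \<open>S\<close> is deleting \<open>insert {u, v} S\<close>, so the
  later conditions carry over unchanged.\<close>

lemma F_free_imp_chordal:
  fixes G :: "'a sgraph"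
  assumes "bigraph G X" "F_free G"
  shows "chordal G X"
  using assms
proof (induction "card (edges G)" arbitrary: G)
  case 0
  then have "edges G = {}" using finite_edges bigraph.sg by fastforce
  then show ?case unfolding chordal_def by (intro exI[of _ "[]"]) simp
next
  case (Suc m)
  interpret bigraph G X by fact
  interpret F: sbg_free "verts G" "adj G" "neg G" "\<lambda>u. u \<in> X" by (rule free_imp_sbg_free) fact
  have fin: "finite (edges G)" using finite_edges sg .
  have "edges G \<noteq> {}" using Suc.hyps(2) by auto
  then obtain e where "e \<in> edges G" by blast
  then obtain a b where "adj G a b" using sg unfolding signed_graph_def adj_def by metis
  from F.ex_simplicial[OF this] obtain u v where s: "signed_simplicial G X u v"
    using signed_simplicial_iff by blast
  then have uv: "{u, v} \<in> edges G" by (simp add: signed_simplicial_def)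
  define D where "D = delete_edges G {{u, v}}"
  have eD: "edges D = edges G - {{u, v}}" by (simp add: D_def delete_edges_def)
  have "m = card (edges D)" using uv fin Suc.hyps(2) by (simp add: eD)
  moreover have "bigraph D X" "F_free D" unfolding D_def using bigraph_delete F_free_delete[OF Suc.prems(2) s] by blast+
  ultimately have "chordal D X" by (rule Suc.hyps(1))
  then obtain es where es: "distinct es" "set es = edges D"
    "\<And>i. i < length es \<Longrightarrow> \<exists>p q. es ! i = {p, q} \<and> signed_simplicial (delete_edges D (set (take i es))) X p q"
    unfolding chordal_def by blast
  have del: "delete_edges D S = delete_edges G (insert {u, v} S)" for S
    by (simp add: D_def delete_edges_def flip: Diff_insert2)
  show ?case
    unfolding chordal_def
  proof (intro exI[of _ "{u, v} # es"] conjI allI impI)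
    show "distinct ({u, v} # es)" using es(1,2) eD by simp
    show "set ({u, v} # es) = edges G" using es(2) eD uv by auto
    fix i assume i: "i < length ({u, v} # es)"
    show "\<exists>p q. ({u, v} # es) ! i = {p, q} \<and>
      signed_simplicial (delete_edges G (set (take i ({u, v} # es)))) X p q"
    proof (cases i)
      case 0
      have "delete_edges G {} = G" by (simp add: delete_edges_def)
      then show ?thesis using 0 s by auto
    next
      case (Suc j)
      then show ?thesis using es(3)[of j] i del by simp
    qed
  qed
qed

theorem theorem5p1:
  fixes G :: "'a sgraph" and X :: "'a set"
  assumes "signed_graph G" and "is_bipartition G X"
  shows "chordal G X \<longleftrightarrow> F_free G"
proof -
  have "bigraph G X" using assms by unfold_locales
  then show ?thesis using bigraph.chordal_imp_F_free F_free_imp_chordal by blast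
qed

end
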